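(* Let $\Delta$ be a thick, semiregular, right-angled building of irreducible type over $I$, with rank $|I|\ge 2$ and parameters $(q_i)_{i\in I}$. Let $\lambda$ be a legal colouring of $\Delta$ with colour sets $X_i$, $|X_i|=q_i$. For each $i\in I$, let $F_i\le\mathrm{Sym}(X_i)$. Then the universal group $\mathcal U_\Delta^\lambda(\mathbf F)$ is (abstractly) simple if and only if the local groups $F_i$ are generated by point stabilisers for all $i\in I$ and transitive for all $i$ in some vertex cover of the diagram of $\Delta$.
   Context: Buildings. Let $I$ be a finite set and $M=(m_{ij})_{i,j\in I}$ a right-angled Coxeter matrix: $m_{ii}=1$ and $m_{ij}=m_{ji}\in\{2,\infty\}$ for $i\ne j$; let $W$ be the Coxeter group with generators $(s_i)_{i\in I}$. The diagram is the graph on $I$ in which $i,j$ are joined iff $m_{ij}=\infty$; the type is irreducible if this graph is connected. A (right-angled) building $\Delta$ of type $M$ is viewed as a chamber system: a set of chambers with an equivalence relation $\sim_i$ ($i$-adjacency) for each $i\in I$, all classes having at least two elements, and a map $\delta:\Delta\times\Delta\to W$ such that for each reduced word $s_{i_1}\cdots s_{i_k}$, $\delta(c,d)=s_{i_1}\cdots s_{i_k}$ iff there is a gallery $c=c_0\sim_{i_1}c_1\sim_{i_2}\cdots\sim_{i_k}c_k=d$ (consecutive chambers distinct) of type $(i_1,\dots,i_k)$. An $i$-panel is an equivalence class of $\sim_i$; $\mathrm{Res}_i(\Delta)$ is the set of $i$-panels. $\mathrm{Aut}(\Delta)$ is the group of bijections of the chamber set preserving each $\sim_i$. $\Delta$ is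 semiregular with parameters $(q_i)_{i\in I}$ if every $i$-panel has the same (possibly infinite) cardinality $q_i\ge 2$, and thick if all panels have at least three chambers. Universal groups. Write $\mathbf F=(F_i)_{i\in I}$. A legal colouring is a map $\lambda=(\lambda_i)_{i\in I}:\Delta\to\prod_{i\in I}X_i$ such that for every $i$-panel $\mathcal P$, $\lambda_i|_{\mathcal P}:\mathcal P\to X_i$ is a bijection and $\lambda_j|_{\mathcal P}$ is constant for all $j\ne i$. The local action of $g\in\mathrm{Aut}(\Delta)$ at an $i$-panel $\mathcal P$ is $\sigma_\lambda(g,\mathcal P)=\lambda_i|_{g\mathcal P}\circ g|_{\mathcal P}\circ(\lambda_i|_{\mathcal P})^{-1}\in\mathrm{Sym}(X_i)$. The universal group is $\mathcal U_\Delta^\lambda(\mathbf F)=\{g\in\mathrm{Aut}(\Delta)\mid \sigma_\lambda(g,\mathcal P)\in F_i\text{ for all }i\in I,\ \mathcal P\in\mathrm{Res}_i(\Delta)\}$. A vertex cover of the diagram is a subset $V\subseteq I$ such that for all $i,j\in I$ with $m_{ij}=\infty$, $i\in V$ or $j\in V$. "$F_i$ is generated by point stabilisers" means that $F_i$ is generated by the union of the stabilisers $(F_i)_x$, $x\in X_i$. *)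

theory Defs
  imports
    "HOL-Algebra.Generated_Groups" "HOL-Algebra.Group_Action" "HOL-Algebra.SimpleGroups"
    "HOL-Library.Extended_Nat"
begin

unbundle cardinal_syntax

section \<open>Right-angled Coxeter groups\<close>

locale right_angled_coxeter_matrix =
  fixes I :: "'i set" and m :: "'i \<Rightarrow> 'i \<Rightarrow> enat"
  assumes finite_index: "finite I"
    and diagonal: "i \<in> I \<Longrightarrow> m i i = 1"
    and symmetric: "\<lbrakk>i \<in> I; j \<in> I\<rbrakk> \<Longrightarrow> m i j = m j i"
    and off_diagonal: "\<lbrakk>i \<in> I; j \<in> I; i \<noteq> j\<rbrakk> \<Longrightarrow> m i j = 2 \<or> m i j = \<infinity>"

text \<open>
  The Coxeter group is the group presented by the generators \<open>s\<^sub>i\<close> (\<open>i \<in> I\<close>) and the relations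
  \<open>(s\<^sub>i s\<^sub>j)\<^bsup>m i j\<^esup> = 1\<close> for \<open>m i j < \<infinity>\<close>. The relations \<open>s\<^sub>i\<^sup>2 = 1\<close>
  (from \<open>m i i = 1\<close>) make formal inverses superfluous, so it is the quotient of the free monoid
  of words over \<open>I\<close> by the least monoid congruence containing these relations.
\<close>

inductive coxeter_eq :: "'i set \<Rightarrow> ('i \<Rightarrow> 'i \<Rightarrow> enat) \<Rightarrow> 'i list \<Rightarrow> 'i list \<Rightarrow> bool"
  for I m where
    relator: "\<lbrakk>i \<in> I; j \<in> I; m i j = enat k\<rbrakk> \<Longrightarrow> coxeter_eq I m (concat (replicate k [i, j])) []"
  | refl: "w \<in> lists I \<Longrightarrow> coxeter_eq I m w w"
  | sym: "coxeter_eq I m v w \<Longrightarrow> coxeter_eq I m w v"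
  | trans: "\<lbrakk>coxeter_eq I m u v; coxeter_eq I m v w\<rbrakk> \<Longrightarrow> coxeter_eq I m u w"
  | append: "\<lbrakk>coxeter_eq I m u u'; coxeter_eq I m v v'\<rbrakk> \<Longrightarrow> coxeter_eq I m (u @ v) (u' @ v')"

definition coxeter_rel :: "'i set \<Rightarrow> ('i \<Rightarrow> 'i \<Rightarrow> enat) \<Rightarrow> ('i list \<times> 'i list) set"
  where "coxeter_rel I m = {(v, w). coxeter_eq I m v w}"

definition coxeter_group :: "'i set \<Rightarrow> ('i \<Rightarrow> 'i \<Rightarrow> enat) \<Rightarrow> 'i list set monoid"
  where "coxeter_group I m =
    \<lparr>carrier = lists I // coxeter_rel I m,
     monoid.mult = \<lambda>A B. \<Union>u\<in>A. \<Union>v\<in>B. coxeter_rel I m `` {u @ v},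
     one = coxeter_rel I m `` {[]}\<rparr>"

definition coxeter_gen :: "'i set \<Rightarrow> ('i \<Rightarrow> 'i \<Rightarrow> enat) \<Rightarrow> 'i \<Rightarrow> 'i list set"
  where "coxeter_gen I m i = coxeter_rel I m `` {[i]}"

text \<open>The element \<open>s\<^sub>i\<^sub>1 \<dots> s\<^sub>i\<^sub>k\<close> represented by a word:\<close>

definition coxeter_elt :: "'i set \<Rightarrow> ('i \<Rightarrow> 'i \<Rightarrow> enat) \<Rightarrow> 'i list \<Rightarrow> 'i list set"
  where "coxeter_elt I m w =
    foldr (\<lambda>i x. coxeter_gen I m i \<otimes>\<^bsub>coxeter_group I m\<^esub> x) w \<one>\<^bsub>coxeter_group I m\<^esub>"

definition reduced_word :: "'i set \<Rightarrow> ('i \<Rightarrow> 'i \<Rightarrow> enat) \<Rightarrow> 'i list \<Rightarrow> bool"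
  where "reduced_word I m w \<longleftrightarrow> w \<in> lists I \<and>
    (\<forall>v\<in>lists I. coxeter_elt I m v = coxeter_elt I m w \<longrightarrow> length w \<le> length v)"

lemma coxeter_eq_in_lists: "coxeter_eq I m v w \<Longrightarrow> v \<in> lists I \<and> w \<in> lists I"
  by (induction rule: coxeter_eq.induct) (auto split: if_splits)

lemma equiv_coxeter_rel: "equiv (lists I) (coxeter_rel I m)"
  by (rule equivI)
    (auto simp: coxeter_rel_def refl_on_def sym_def trans_def
      dest: coxeter_eq_in_lists intro: coxeter_eq.intros)

lemma coxeter_mult_class:
  assumes "u \<in> lists I" "v \<in> lists I"
  shows "(coxeter_rel I m `` {u}) \<otimes>\<^bsub>coxeter_group I m\<^esub> (coxeter_rel I m `` {v})
    = coxeter_rel I m `` {u @ v}"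
proof -
  have "coxeter_rel I m `` {u' @ v'} = coxeter_rel I m `` {u @ v}"
    if "u' \<in> coxeter_rel I m `` {u}" "v' \<in> coxeter_rel I m `` {v}" for u' v'
  proof -
    have "coxeter_eq I m (u @ v) (u' @ v')"
      using that by (intro coxeter_eq.append) (simp_all add: coxeter_rel_def)
    then have "(u @ v, u' @ v') \<in> coxeter_rel I m" by (simp add: coxeter_rel_def)
    from equiv_class_eq[OF equiv_coxeter_rel this] show ?thesis by simp
  qed
  moreover have "u \<in> coxeter_rel I m `` {u}" "v \<in> coxeter_rel I m `` {v}"
    using assms by (simp_all add: coxeter_rel_def coxeter_eq.refl)
  ultimately have "(\<Union>u'\<in>coxeter_rel I m `` {u}. \<Union>v'\<in>coxeter_rel I m `` {v}.
      coxeter_rel I m `` {u' @ v'}) = coxeter_rel I m `` {u @ v}"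
    by blast
  then show ?thesis by (simp add: coxeter_group_def)
qed

lemma coxeter_elt_eq_class:
  "w \<in> lists I \<Longrightarrow> coxeter_elt I m w = coxeter_rel I m `` {w}"
proof (induction w)
  case Nil
  then show ?case by (simp add: coxeter_elt_def coxeter_group_def)
next
  case (Cons i w)
  then have "coxeter_elt I m (i # w) =
      (coxeter_rel I m `` {[i]}) \<otimes>\<^bsub>coxeter_group I m\<^esub> (coxeter_rel I m `` {w})"
    by (simp add: coxeter_elt_def coxeter_gen_def)
  then show ?case using Cons.prems by (simp add: coxeter_mult_class)
qed

lemma (in right_angled_coxeter_matrix) coxeter_eq_rev_append:
  "w \<in> lists I \<Longrightarrow> coxeter_eq I m (rev w @ w) []"
proof (induction w)
  case Nil
  then show ?case by (auto intro: coxeter_eq.refl)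
next
  case (Cons i w)
  have "coxeter_eq I m [i, i] []"
    using coxeter_eq.relator[of i I i m 1] Cons.prems diagonal[of i]
    by (simp add: one_enat_def)
  then have "coxeter_eq I m ([i, i] @ w) ([] @ w)"
    by (rule coxeter_eq.append) (use Cons.prems in \<open>auto intro: coxeter_eq.refl\<close>)
  then have "coxeter_eq I m (rev w @ ([i, i] @ w)) (rev w @ ([] @ w))"
    by (rule coxeter_eq.append[rotated]) (use Cons.prems in \<open>auto intro: coxeter_eq.refl\<close>)
  then have "coxeter_eq I m (rev (i # w) @ (i # w)) (rev w @ w)" by simp
  moreover have "coxeter_eq I m (rev w @ w) []" using Cons by simp
  ultimately show ?case by (rule coxeter_eq.trans)
qed

lemma (in right_angled_coxeter_matrix) group_coxeter_group: "group (coxeter_group I m)"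
proof (rule groupI)
  let ?W = "coxeter_group I m" and ?R = "coxeter_rel I m"
  have carr: "x \<in> carrier ?W \<longleftrightarrow> (\<exists>w\<in>lists I. x = ?R `` {w})" for x
    by (auto simp: coxeter_group_def quotient_def)
  have one: "\<one>\<^bsub>?W\<^esub> = ?R `` {[]}" by (simp add: coxeter_group_def)
  show "\<one>\<^bsub>?W\<^esub> \<in> carrier ?W" unfolding carr one by auto
  fix x assume "x \<in> carrier ?W"
  then obtain u where u: "u \<in> lists I" "x = ?R `` {u}" unfolding carr by auto
  show "\<one>\<^bsub>?W\<^esub> \<otimes>\<^bsub>?W\<^esub> x = x"
    unfolding one u(2) using coxeter_mult_class[of "[]" I u m] u(1) by simp
  have ru: "rev u \<in> lists I" using u(1) by auto
  have "?R `` {rev u} \<otimes>\<^bsub>?W\<^esub> x = \<one>\<^bsub>?W\<^esub>"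
    unfolding one u(2) coxeter_mult_class[OF ru u(1)]
    by (rule equiv_class_eq[OF equiv_coxeter_rel])
      (use coxeter_eq_rev_append[OF u(1)] in \<open>simp add: coxeter_rel_def\<close>)
  then show "\<exists>y\<in>carrier ?W. y \<otimes>\<^bsub>?W\<^esub> x = \<one>\<^bsub>?W\<^esub>" using ru carr by blast
  fix y assume "y \<in> carrier ?W"
  then obtain v where v: "v \<in> lists I" "y = ?R `` {v}" unfolding carr by auto
  show "x \<otimes>\<^bsub>?W\<^esub> y \<in> carrier ?W"
    unfolding u(2) v(2) coxeter_mult_class[OF u(1) v(1)] carr
    by (rule bexI[of _ "u @ v"]) (use u(1) v(1) in simp_all)
  fix z assume "z \<in> carrier ?W"
  then obtain w where w: "w \<in> lists I" "z = ?R `` {w}" unfolding carr by auto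
  show "x \<otimes>\<^bsub>?W\<^esub> y \<otimes>\<^bsub>?W\<^esub> z = x \<otimes>\<^bsub>?W\<^esub> (y \<otimes>\<^bsub>?W\<^esub> z)"
    using u v w by (simp add: coxeter_mult_class)
qed

definition diagram :: "'i set \<Rightarrow> ('i \<Rightarrow> 'i \<Rightarrow> enat) \<Rightarrow> ('i \<times> 'i) set"
  where "diagram I m = {(i, j). i \<in> I \<and> j \<in> I \<and> m i j = \<infinity>}"

definition irreducible_type :: "'i set \<Rightarrow> ('i \<Rightarrow> 'i \<Rightarrow> enat) \<Rightarrow> bool"
  where "irreducible_type I m \<longleftrightarrow> (\<forall>i\<in>I. \<forall>j\<in>I. (i, j) \<in> (diagram I m)\<^sup>*)"

definition vertex_cover :: "'i set \<Rightarrow> ('i \<Rightarrow> 'i \<Rightarrow> enat) \<Rightarrow> 'i set \<Rightarrow> bool"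
  where "vertex_cover I m V \<longleftrightarrow> V \<subseteq> I \<and> (\<forall>(i, j)\<in>diagram I m. i \<in> V \<or> j \<in> V)"


section \<open>Buildings\<close>

text \<open>\<open>C\<close> is the set of chambers, \<open>adj i\<close> is \<open>i\<close>-adjacency.\<close>

fun gallery :: "('i \<Rightarrow> ('c \<times> 'c) set) \<Rightarrow> 'c \<Rightarrow> 'i list \<Rightarrow> 'c \<Rightarrow> bool"
  where
    "gallery adj c [] d \<longleftrightarrow> c = d"
  | "gallery adj c (i # w) d \<longleftrightarrow> (\<exists>e. (c, e) \<in> adj i \<and> c \<noteq> e \<and> gallery adj e w d)"

definition panels :: "'c set \<Rightarrow> ('i \<Rightarrow> ('c \<times> 'c) set) \<Rightarrow> 'i \<Rightarrow> 'c set set"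
  where "panels C adj i = C // adj i"

locale right_angled_building = right_angled_coxeter_matrix I m
  for I :: "'i set" and m :: "'i \<Rightarrow> 'i \<Rightarrow> enat" +
  fixes C :: "'c set" and adj :: "'i \<Rightarrow> ('c \<times> 'c) set" and \<delta> :: "'c \<Rightarrow> 'c \<Rightarrow> 'i list set"
  assumes chambers_nonempty: "C \<noteq> {}"
    and equiv_adj: "i \<in> I \<Longrightarrow> equiv C (adj i)"
    and panel_two: "\<lbrakk>i \<in> I; P \<in> panels C adj i\<rbrakk> \<Longrightarrow> \<exists>c\<in>P. \<exists>d\<in>P. c \<noteq> d"
    and delta_closed: "\<lbrakk>c \<in> C; d \<in> C\<rbrakk> \<Longrightarrow> \<delta> c d \<in> carrier (coxeter_group I m)"
    and delta_gallery: "\<lbrakk>c \<in> C; d \<in> C; reduced_word I m w\<rbrakk> \<Longrightarrow>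
      \<delta> c d = coxeter_elt I m w \<longleftrightarrow> gallery adj c w d"

definition thick :: "'i set \<Rightarrow> 'c set \<Rightarrow> ('i \<Rightarrow> ('c \<times> 'c) set) \<Rightarrow> bool"
  where "thick I C adj \<longleftrightarrow> (\<forall>i\<in>I. \<forall>P\<in>panels C adj i. infinite P \<or> 3 \<le> card P)"

text \<open>The parameters are cardinals, represented as in the library by minimal well-orders.\<close>

definition semiregular ::
    "'i set \<Rightarrow> 'c set \<Rightarrow> ('i \<Rightarrow> ('c \<times> 'c) set) \<Rightarrow> ('i \<Rightarrow> 'q rel) \<Rightarrow> bool"
  where "semiregular I C adj q \<longleftrightarrow>
    (\<forall>i\<in>I. Card_order (q i) \<and> (\<forall>P\<in>panels C adj i. |P| =o q i))"


section \<open>Universal groups\<close>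

definition building_aut :: "'i set \<Rightarrow> 'c set \<Rightarrow> ('i \<Rightarrow> ('c \<times> 'c) set) \<Rightarrow> ('c \<Rightarrow> 'c) set"
  where "building_aut I C adj =
    {g \<in> Bij C. \<forall>i\<in>I. \<forall>c\<in>C. \<forall>d\<in>C. (c, d) \<in> adj i \<longleftrightarrow> (g c, g d) \<in> adj i}"

definition legal_colouring ::
    "'i set \<Rightarrow> 'c set \<Rightarrow> ('i \<Rightarrow> ('c \<times> 'c) set) \<Rightarrow> ('i \<Rightarrow> 'x set) \<Rightarrow> ('i \<Rightarrow> 'c \<Rightarrow> 'x) \<Rightarrow> bool"
  where "legal_colouring I C adj X col \<longleftrightarrow>
    (\<forall>i\<in>I. \<forall>c\<in>C. col i c \<in> X i) \<and>
    (\<forall>i\<in>I. \<forall>P\<in>panels C adj i. bij_betw (col i) P (X i) \<and>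
      (\<forall>j\<in>I. j \<noteq> i \<longrightarrow> (\<forall>c\<in>P. \<forall>d\<in>P. col j c = col j d)))"

definition local_action ::
    "('i \<Rightarrow> 'x set) \<Rightarrow> ('i \<Rightarrow> 'c \<Rightarrow> 'x) \<Rightarrow> ('c \<Rightarrow> 'c) \<Rightarrow> 'i \<Rightarrow> 'c set \<Rightarrow> 'x \<Rightarrow> 'x"
  where "local_action X col g i P = (\<lambda>x\<in>X i. col i (g (inv_into P (col i) x)))"

definition universal_group ::
    "'i set \<Rightarrow> 'c set \<Rightarrow> ('i \<Rightarrow> ('c \<times> 'c) set) \<Rightarrow> ('i \<Rightarrow> 'x set) \<Rightarrow> ('i \<Rightarrow> 'c \<Rightarrow> 'x)
      \<Rightarrow> ('i \<Rightarrow> ('x \<Rightarrow> 'x) set) \<Rightarrow> ('c \<Rightarrow> 'c) monoid"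
  where "universal_group I C adj X col F = (BijGroup C)
    \<lparr>carrier := {g \<in> building_aut I C adj.
      \<forall>i\<in>I. \<forall>P\<in>panels C adj i. local_action X col g i P \<in> F i}\<rparr>"


section \<open>Group-theoretic properties\<close>

text \<open>
  The locale \<^locale>\<open>simple_group\<close> asks for \<open>order G > 1\<close>, and infinite groups have
  \<open>order G = 0\<close>, so it excludes all infinite groups.
\<close>

definition abstractly_simple :: "('a, 'b) monoid_scheme \<Rightarrow> bool"
  where "abstractly_simple G \<longleftrightarrow> group G \<and> carrier G \<noteq> {\<one>\<^bsub>G\<^esub>} \<and>
    (\<forall>N. N \<lhd> G \<longrightarrow> N = carrier G \<or> N = {\<one>\<^bsub>G\<^esub>})"

definition perm_group :: "'x set \<Rightarrow> ('x \<Rightarrow> 'x) set \<Rightarrow> ('x \<Rightarrow> 'x) monoid"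
  where "perm_group X H = (BijGroup X)\<lparr>carrier := H\<rparr>"

definition generated_by_point_stabilisers :: "'x set \<Rightarrow> ('x \<Rightarrow> 'x) set \<Rightarrow> bool"
  where "generated_by_point_stabilisers X H \<longleftrightarrow>
    generate (perm_group X H) (\<Union>x\<in>X. stabilizer (perm_group X H) (\<lambda>g. g) x) = H"

definition transitive_on :: "'x set \<Rightarrow> ('x \<Rightarrow> 'x) set \<Rightarrow> bool"
  where "transitive_on X H \<longleftrightarrow> transitive_action (perm_group X H) X (\<lambda>g. g)"

end

theory Submission
  imports Defs
begin

text \<open>
  A legal colouring lets the pairs \<open>(i, x)\<close> act on the chambers: the chamber \<open>mv c i x\<close> has colour
  \<open>x\<close> in the \<open>i\<close>-panel of \<open>c\<close>. The coloured building is the free system with such an action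
  (\<open>universal_property\<close>), because a word in a right-angled Coxeter group is reduced as soon as no
  letter occurs twice with only letters commuting with it in between. Two consequences are used
  throughout. Any two legal colourings differ by an automorphism, so elements of the universal
  group \<open>U\<close> can be built by prescribing compatible local actions (\<open>exists_with_local_actions\<close>).
  And a group-valued cocycle on the steps \<open>c \<rightarrow> mv c i x\<close> that is trivial around panels and around
  squares of commuting types is the difference of a function on chambers.

  The parity of the crossings of a wall (a residue of type \<open>i\<close> together with the types commuting
  with \<open>i\<close>) is such a cocycle. It shows that a wall separates the building into disjoint wings, one
  for each colour, which take over the role of half-trees in Tits' simplicity theorem.

  Sufficiency. Let \<open>N\<close> be a nontrivial normal subgroup. Some element of \<open>N\<close> moves a wing off itself
  (\<open>moved_wing\<close>), and its commutator with a translation whose axis has both ends in that wing is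
  an element \<open>n\<close> of \<open>N\<close> that contracts a region, so that the images of suitable wings under the powers
  of \<open>n\<close> are disjoint. If \<open>a\<close> is supported on such a wing, the infinite product \<open>g\<close> of the
  conjugates of \<open>a\<close> by the powers of \<open>n\<close> exists in \<open>U\<close>, and \<open>a\<close> is the commutator of \<open>g\<close> and \<open>n\<close>.
  Hence \<open>N\<close> contains everything that is supported on a wing, and so all chamber stabilisers, whose
  elements factor first into elements that change a single colour and then into two elements
  supported on wings (\<open>stabiliser_in_normal\<close>). If every local group is generated by point
  stabilisers, the orbits of \<open>N\<close> on a panel are as large as those of its local group. The types
  outside a vertex cover with transitive local groups commute, and therefore \<open>N\<close> and \<open>U\<close> have the
  same orbits on chambers (\<open>normal_subgroup_is_everything\<close>).

  Necessity. The local actions of an element at all \<open>i\<close>-panels agree modulo the point stabilisers,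
  which gives a homomorphism from \<open>U\<close> to the corresponding quotient of \<open>F i\<close>
  (\<open>generated_if_simple\<close>). If \<open>i\<close> and \<open>j\<close> are joined in the diagram and both local groups are
  intransitive, orbits of colours label the steps by two non-commuting involutions, and the
  resulting function on chambers gives a homomorphism from \<open>U\<close> to a symmetric group of degree three
  (\<open>transitive_if_simple\<close>). Elements whose local actions do not depend on the panel show that both
  kernels are proper and nontrivial.
\<close>

section \<open>Reduced words in right-angled Coxeter groups\<close>

text \<open>
  These are the words that are not reduced in the right-angled Coxeter group: the two letters
  \<open>i\<close> can be moved next to each other and deleted.
\<close>
definition cancellable :: "('i \<Rightarrow> 'i \<Rightarrow> enat) \<Rightarrow> 'i list \<Rightarrow> bool"
  where "cancellable m t \<longleftrightarrow> (\<exists>a i b e. t = a @ i # b @ i # e \<and> (\<forall>k\<in>set b. m i k = 2))"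

lemma not_cancellable_append:
  assumes "\<not> cancellable m (u @ v)"
  shows "\<not> cancellable m u" "\<not> cancellable m v"
proof -
  show "\<not> cancellable m u"
  proof
    assume "cancellable m u"
    then obtain a i b e where "u = a @ i # b @ i # e" "\<forall>k\<in>set b. m i k = 2"
      unfolding cancellable_def by blast
    then have "u @ v = a @ i # b @ i # (e @ v) \<and> (\<forall>k\<in>set b. m i k = 2)" by simp
    then show False using assms unfolding cancellable_def by blast
  qed
  show "\<not> cancellable m v"
  proof
    assume "cancellable m v"
    then obtain a i b e where "v = a @ i # b @ i # e" "\<forall>k\<in>set b. m i k = 2"
      unfolding cancellable_def by blast
    then have "u @ v = (u @ a) @ i # b @ i # e \<and> (\<forall>k\<in>set b. m i k = 2)" by simp
    then show False using assms unfolding cancellable_def by blast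
  qed
qed

context right_angled_coxeter_matrix
begin

text \<open>
  A word up to exchanges of commuting neighbours is determined by its restrictions to the pairs of
  non-commuting letters (the pairs \<open>i = j\<close> count the letters). Commuting pairs get a dummy value.
\<close>
definition projections :: "'i list \<Rightarrow> 'i \<Rightarrow> 'i \<Rightarrow> 'i list"
  where "projections w = (\<lambda>i j. if m i j \<noteq> 2 then filter (\<lambda>k. k = i \<or> k = j) w else [])"

text \<open>
  This detects from the projections whether \<open>k\<close> can be moved to the end of the word.
\<close>
definition ends_with :: "'i \<Rightarrow> ('i \<Rightarrow> 'i \<Rightarrow> 'i list) \<Rightarrow> bool"
  where "ends_with k p \<longleftrightarrow> (\<forall>j\<in>I. m k j \<noteq> 2 \<longrightarrow> p k j \<noteq> [] \<and> last (p k j) = k)"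

text \<open>
  Right multiplication by the generator \<open>k\<close> on normal forms.
\<close>
definition toggle :: "'i \<Rightarrow> ('i \<Rightarrow> 'i \<Rightarrow> 'i list) \<Rightarrow> 'i \<Rightarrow> 'i \<Rightarrow> 'i list"
  where "toggle k p = (\<lambda>i j. if m i j \<noteq> 2 \<and> (k = i \<or> k = j)
    then (if ends_with k p then butlast (p i j) else p i j @ [k]) else p i j)"

definition normal_states :: "('i \<Rightarrow> 'i \<Rightarrow> 'i list) set"
  where "normal_states = {projections w | w. w \<in> lists I \<and> \<not> cancellable m w}"

lemma m_diag_ne_2: "i \<in> I \<Longrightarrow> m i i \<noteq> 2"
  using diagonal[of i] by (simp add: one_enat_def numeral_eq_enat)

lemma toggle_append:
  "\<not> ends_with k (projections w) \<Longrightarrow> toggle k (projections w) = projections (w @ [k])"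
  by (intro ext) (auto simp: toggle_def projections_def)

lemma ends_with_split:
  assumes "w \<in> lists I" "k \<in> I" "ends_with k (projections w)"
  obtains a b where "w = a @ k # b" "\<forall>j\<in>set b. m k j = 2"
proof -
  have "projections w k k \<noteq> []"
    using assms m_diag_ne_2 unfolding ends_with_def by blast
  then have "k \<in> set w" using m_diag_ne_2[OF assms(2)]
    by (auto simp: projections_def filter_empty_conv)
  then obtain a b where ab: "w = a @ k # b" "k \<notin> set b"
    using split_list_last by fast
  have "m k j = 2" if "j \<in> set b" for j
  proof (rule ccontr)
    assume j: "m k j \<noteq> 2"
    let ?f = "filter (\<lambda>l. l = k \<or> l = j)"
    have "j \<in> I" using that assms(1) ab by auto
    then have l: "last (?f w) = k" using assms(3) j by (auto simp: ends_with_def projections_def)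
    have "?f b \<noteq> []" using that by (auto simp: filter_empty_conv)
    then have "last (?f w) = last (?f b)" using ab(1) by simp
    moreover have "last (?f b) \<in> set b" using \<open>?f b \<noteq> []\<close> last_in_set[of "?f b"] by auto
    ultimately show False using l ab(2) by simp
  qed
  then show ?thesis using that ab(1) by blast
qed

lemma not_cancellable_snoc:
  assumes w: "w \<in> lists I" and k: "k \<in> I" and n: "\<not> cancellable m w" and e: "\<not> ends_with k (projections w)"
  shows "\<not> cancellable m (w @ [k])"
proof
  assume "cancellable m (w @ [k])"
  then obtain a i b e' where eq: "w @ [k] = a @ i # b @ i # e'" and b: "\<forall>k\<in>set b. m i k = 2"
    unfolding cancellable_def by blast
  show False
  proof (cases e' rule: rev_cases)
    case Nil
    then have w: "w = a @ i # b" "k = i" using eq by (auto simp flip: append_assoc append_Cons)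
    have "ends_with k (projections w)" unfolding ends_with_def
    proof (intro ballI impI)
      fix j assume "j \<in> I" "m k j \<noteq> 2"
      then have "j \<notin> set b" "k \<notin> set b" using b w m_diag_ne_2[OF k] by auto
      then have "filter (\<lambda>l. l = k \<or> l = j) b = []" by (auto simp: filter_empty_conv)
      then show "projections w k j \<noteq> [] \<and> last (projections w k j) = k"
        using \<open>m k j \<noteq> 2\<close> w by (simp add: projections_def)
    qed
    then show False using e by simp
  next
    case (snoc e'' y)
    then have "w = a @ i # b @ i # e''" using eq by (auto simp flip: append_assoc append_Cons)
    then show False using n b unfolding cancellable_def by blast
  qed
qed

text \<open>
  Only letters commuting with \<open>k\<close> stand behind the last \<open>k\<close>, so deleting it is undone by
  appending \<open>k\<close>; a second \<open>k\<close> at the end of the remaining word would cancel with the first.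
\<close>
lemma toggle_delete:
  assumes w: "w \<in> lists I" and k: "k \<in> I" and n: "\<not> cancellable m w" and e: "ends_with k (projections w)"
  obtains v where "v \<in> lists I" "\<not> cancellable m v" "toggle k (projections w) = projections v"
    "\<not> ends_with k (projections v)" "toggle k (projections v) = projections w" "length v < length w"
proof -
  obtain a b where ab: "w = a @ k # b" "\<forall>j\<in>set b. m k j = 2" using ends_with_split[OF w k e] .
  have kb: "k \<notin> set b" using ab m_diag_ne_2[OF k] by auto
  let ?v = "a @ b"
  have fb: "filter (\<lambda>l. l = i \<or> l = j) b = []" if "m i j \<noteq> 2" "k = i \<or> k = j" for i j
    using that ab w kb symmetric[OF k] by (auto simp: filter_empty_conv)
  have v: "?v \<in> lists I" using w ab by auto
  have t: "toggle k (projections w) = projections ?v"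
    by (intro ext) (use e ab(1) fb in \<open>auto simp: toggle_def projections_def butlast_append\<close>)
  have ne: "\<not> ends_with k (projections ?v)"
  proof
    assume "ends_with k (projections ?v)"
    then obtain c d where cd: "a @ b = c @ k # d" "\<forall>j\<in>set d. m k j = 2"
      using ends_with_split[OF v k] by blast
    then have "\<exists>d1. a = c @ k # d1 \<and> d = d1 @ b" using kb
      by (auto simp: append_eq_append_conv2 Cons_eq_append_conv append_eq_Cons_conv)
    then obtain d1 where "a = c @ k # d1" "d = d1 @ b" by blast
    then have "w = c @ k # d1 @ k # b" "\<forall>j\<in>set d1. m k j = 2" using ab cd by auto
    then show False using n unfolding cancellable_def by blast
  qed
  have t2: "toggle k (projections ?v) = projections w"
    unfolding toggle_append[OF ne]
    by (intro ext) (use ab(1) fb in \<open>auto simp: projections_def\<close>)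
  have "\<not> cancellable m ?v"
  proof
    assume "cancellable m ?v"
    then obtain a1 i b1 e1 where eq: "a @ b = a1 @ i # b1 @ i # e1" and c: "\<forall>k\<in>set b1. m i k = 2"
      unfolding cancellable_def by blast
    consider (1) d where "a = a1 @ i # b1 @ i # d" "e1 = d @ b"
      | (2) d d' where "a = a1 @ i # d" "b = d' @ i # e1" "b1 = d @ d'"
      | (3) d where "b = d @ i # b1 @ i # e1" "a1 = a @ d"
      using eq by (auto simp: append_eq_append_conv2 Cons_eq_append_conv append_eq_Cons_conv)
    then show False
    proof cases
      case 1
      then have "w = a1 @ i # b1 @ i # (d @ k # b)" using ab by simp
      then show ?thesis using n c unfolding cancellable_def by blast
    next
      case 2
      have "i \<in> I" using 2 w ab by auto
      moreover have "m k i = 2" using ab 2 by auto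
      ultimately have "m i k = 2" using symmetric k by metis
      then have "w = a1 @ i # (d @ k # d') @ i # e1" "\<forall>j\<in>set (d @ k # d'). m i j = 2"
        using 2 ab c by auto
      then show ?thesis using n unfolding cancellable_def by blast
    next
      case 3
      then have "w = (a @ k # d) @ i # b1 @ i # e1" using ab by simp
      then show ?thesis using n c unfolding cancellable_def by blast
    qed
  qed
  then show ?thesis using that[OF v _ t ne t2] ab(1) by simp
qed

lemma toggle_in_normal_states:
  assumes "p \<in> normal_states" "k \<in> I"
  shows "toggle k p \<in> normal_states"
proof -
  obtain w where w: "w \<in> lists I" "\<not> cancellable m w" "p = projections w"
    using assms by (auto simp: normal_states_def)
  show ?thesis
  proof (cases "ends_with k p")
    case True
    with w(3) obtain v where "v \<in> lists I" "\<not> cancellable m v" "toggle k p = projections v"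
      using toggle_delete[OF w(1) assms(2) w(2)] by blast
    then show ?thesis unfolding normal_states_def by blast
  next
    case False
    then have "toggle k p = projections (w @ [k])" "\<not> cancellable m (w @ [k])" "w @ [k] \<in> lists I"
      using toggle_append not_cancellable_snoc w assms by auto
    then show ?thesis unfolding normal_states_def by blast
  qed
qed

lemma toggle_toggle:
  assumes "p \<in> normal_states" "k \<in> I"
  shows "toggle k (toggle k p) = p"
proof -
  obtain w where w: "w \<in> lists I" "\<not> cancellable m w" "p = projections w"
    using assms by (auto simp: normal_states_def)
  show ?thesis
  proof (cases "ends_with k p")
    case True
    with w(3) obtain v where "toggle k p = projections v" "toggle k (projections v) = p"
      using toggle_delete[OF w(1) assms(2) w(2)] by blast
    then show ?thesis by simp
  next
    case False
    then have "ends_with k (toggle k p)"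
      using assms(2) by (auto simp: ends_with_def toggle_def)
    then show ?thesis using False by (intro ext) (simp add: toggle_def[of k "toggle k p"] toggle_def)
  qed
qed

lemma toggle_commute:
  assumes "i \<in> I" "j \<in> I" "m i j = 2"
  shows "toggle i (toggle j p) = toggle j (toggle i p)"
proof -
  have ij: "m j i = 2" "i \<noteq> j" using assms symmetric m_diag_ne_2 by metis+
  have "toggle b p a l = p a l" if "m a l \<noteq> 2" "m a b = 2" "a \<noteq> b" for a b l
    unfolding toggle_def using that by metis
  then have e: "ends_with i (toggle j p) = ends_with i p" "ends_with j (toggle i p) = ends_with j p"
    unfolding ends_with_def using assms(3) ij by simp_all
  have ne: "\<not> (m s t \<noteq> 2 \<and> (i = s \<or> i = t) \<and> (j = s \<or> j = t))" for s t
    using ij assms(3) by metis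
  show ?thesis
  proof (intro ext)
    fix s t
    define P Q where "P \<longleftrightarrow> m s t \<noteq> 2 \<and> (i = s \<or> i = t)" and "Q \<longleftrightarrow> m s t \<noteq> 2 \<and> (j = s \<or> j = t)"
    have "\<not> (P \<and> Q)" using ne[of s t] unfolding P_def Q_def by blast
    then show "toggle i (toggle j p) s t = toggle j (toggle i p) s t"
      unfolding toggle_def[of i "toggle j p"] toggle_def[of j "toggle i p"] e
      unfolding toggle_def P_def[symmetric] Q_def[symmetric]
      by (cases P; cases Q) simp_all
  qed
qed

lemma foldl_toggle_in_normal_states:
  "w \<in> lists I \<Longrightarrow> p \<in> normal_states \<Longrightarrow> foldl (\<lambda>p k. toggle k p) p w \<in> normal_states"
  by (induction w arbitrary: p) (auto intro: toggle_in_normal_states)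

text \<open>
  The letters act as involutions on the states of non-cancellable words, and the action satisfies
  the defining relations, so the state reached from the empty word is an invariant of the group
  element (van der Waerden's method for word problems).
\<close>
lemma coxeter_eq_foldl_toggle:
  "coxeter_eq I m u v \<Longrightarrow> p \<in> normal_states \<Longrightarrow>
    foldl (\<lambda>p k. toggle k p) p u = foldl (\<lambda>p k. toggle k p) p v"
proof (induction arbitrary: p rule: coxeter_eq.induct)
  case (relator i j k)
  consider "i = j" "k = 1" | "m i j = 2" "k = 2"
    using relator(1-3) diagonal[of i] off_diagonal[of i j]
    by (cases "i = j") (auto simp: one_enat_def numeral_eq_enat)
  then show ?case
  proof cases
    case 1
    then show ?thesis using relator by (simp add: toggle_toggle)
  next
    case 2
    have e: "concat (replicate k [i, j]) = [i, j, i, j]" using 2 by (simp add: numeral_2_eq_2)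
    show ?thesis using 2 relator unfolding e
      by (simp add: toggle_toggle toggle_commute[of i j] toggle_in_normal_states)
  qed
next
  case (append u u' v v')
  then show ?case using coxeter_eq_in_lists foldl_toggle_in_normal_states
    by (metis foldl_append)
qed auto

lemma projections_Nil_in_normal_states: "projections [] \<in> normal_states"
  by (auto simp: normal_states_def cancellable_def)

lemma foldl_toggle_not_cancellable:
  "w \<in> lists I \<Longrightarrow> \<not> cancellable m w \<Longrightarrow> foldl (\<lambda>p k. toggle k p) (projections []) w = projections w"
proof (induction w rule: rev_induct)
  case (snoc k w)
  have n: "\<not> cancellable m w" using snoc.prems(2) not_cancellable_append by blast
  have "\<not> ends_with k (projections w)"
  proof
    assume "ends_with k (projections w)"
    moreover have "w \<in> lists I" "k \<in> I" using snoc.prems by auto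
    ultimately obtain a b where "w = a @ k # b" "\<forall>j\<in>set b. m k j = 2"
      using ends_with_split by blast
    then have "w @ [k] = a @ k # b @ k # []" "\<forall>j\<in>set b. m k j = 2" by auto
    then show False using snoc.prems(2) unfolding cancellable_def by blast
  qed
  then show ?case using snoc n toggle_append by simp
qed simp

lemma foldl_toggle_length:
  "w \<in> lists I \<Longrightarrow> \<exists>v\<in>lists I. foldl (\<lambda>p k. toggle k p) (projections []) w = projections v \<and>
    \<not> cancellable m v \<and> length v \<le> length w"
proof (induction w rule: rev_induct)
  case Nil
  then show ?case by (intro bexI[of _ "[]"]) (auto simp: cancellable_def)
next
  case (snoc k w)
  then obtain v where v: "v \<in> lists I" "foldl (\<lambda>p k. toggle k p) (projections []) w = projections v"
    "\<not> cancellable m v" "length v \<le> length w" by auto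
  have k: "k \<in> I" using snoc.prems by simp
  show ?case
  proof (cases "ends_with k (projections v)")
    case True
    obtain u where u: "u \<in> lists I" "\<not> cancellable m u"
      "toggle k (projections v) = projections u" "length u < length v"
      using toggle_delete[OF v(1) k v(3) True] by blast
    then show ?thesis using v by (intro bexI[of _ u]) auto
  next
    case False
    then show ?thesis using v k not_cancellable_snoc[OF v(1) k v(3)] toggle_append
      by (intro bexI[of _ "v @ [k]"]) auto
  qed
qed

lemma projections_eq_mset:
  assumes "u \<in> lists I" "v \<in> lists I" "projections u = projections v"
  shows "set u = set v" "length u = length v"
proof -
  have f: "filter (\<lambda>k. k = i) u = filter (\<lambda>k. k = i) v" if "i \<in> I" for i
    using fun_cong[OF fun_cong[OF assms(3), of i], of i] m_diag_ne_2[OF that]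
    by (simp add: projections_def)
  show s: "set u = set v"
  proof -
    have "k \<in> set u \<longleftrightarrow> k \<in> set v" for k
    proof (cases "k \<in> I")
      case True
      have \<open>k \<in> set w \<longleftrightarrow> filter (\<lambda>l. l = k) w \<noteq> []\<close> for w by (auto simp: filter_empty_conv)
      then show ?thesis using f[OF True] by simp
    next
      case False
      then show ?thesis using assms by auto
    qed
    then show ?thesis by blast
  qed
  have "length w = sum (count_list w) (set w)" for w :: "'i list"
    by (simp add: sum_count_set)
  moreover have "count_list u k = count_list v k" if "k \<in> set u" for k
  proof -
    have "k \<in> I" using that assms(1) by auto
    moreover have "(=) k = (\<lambda>l. l = k)" by auto
    ultimately show ?thesis using f[of k]
      by (simp add: count_list_eq_length_filter)
  qed
  moreover from this have "sum (count_list u) (set u) = sum (count_list v) (set u)" by (rule sum.cong[OF HOL.refl])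
  ultimately show "length u = length v" using s by simp
qed

text \<open>
  The state reached by a non-cancellable word is the word itself up to commutations, whereas a
  word of length \<open>n\<close> only reaches states of words of length at most \<open>n\<close>.
\<close>
theorem not_cancellable_reduced:
  assumes "w \<in> lists I" "\<not> cancellable m w"
  shows "reduced_word I m w"
  unfolding reduced_word_def
proof (intro conjI ballI impI)
  fix v assume v: "v \<in> lists I" "coxeter_elt I m v = coxeter_elt I m w"
  have "coxeter_eq I m v w"
    using v assms eq_equiv_class[OF _ equiv_coxeter_rel, of I m v w]
    by (simp add: coxeter_elt_eq_class coxeter_rel_def)
  then obtain v' where "v' \<in> lists I" "length v' \<le> length v" "projections w = projections v'"
    using foldl_toggle_length[OF v(1)] coxeter_eq_foldl_toggle[OF _ projections_Nil_in_normal_states]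
      foldl_toggle_not_cancellable[OF assms] by metis
  then show "length w \<le> length v" using projections_eq_mset(2) assms(1) by metis
qed fact

theorem not_cancellable_same_letters:
  assumes "u \<in> lists I" "\<not> cancellable m u" "v \<in> lists I" "\<not> cancellable m v"
    and "coxeter_elt I m u = coxeter_elt I m v"
  shows "set u = set v"
proof -
  have "coxeter_eq I m u v"
    using assms eq_equiv_class[OF _ equiv_coxeter_rel, of I m u v]
    by (simp add: coxeter_elt_eq_class coxeter_rel_def)
  then have "projections u = projections v"
    using assms coxeter_eq_foldl_toggle[OF _ projections_Nil_in_normal_states]
      foldl_toggle_not_cancellable by metis
  then show ?thesis using projections_eq_mset assms by blast
qed

end

section \<open>Coloured walks\<close>

definition walk :: "('s \<Rightarrow> 'i \<Rightarrow> 'x \<Rightarrow> 's) \<Rightarrow> 's \<Rightarrow> ('i \<times> 'x) list \<Rightarrow> 's"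
  where "walk mv s w = foldl (\<lambda>s l. mv s (fst l) (snd l)) s w"

lemma walk_simps [simp]:
  "walk mv s [] = s" "walk mv s (l # w) = walk mv (mv s (fst l) (snd l)) w"
  "walk mv s (u @ v) = walk mv (walk mv s u) v"
  by (simp_all add: walk_def)

text \<open>
  The colours reached by a walk depend only on the colours at its start. This makes walks in
  different systems comparable.
\<close>
definition colours_after :: "('i \<Rightarrow> 'x) \<Rightarrow> ('i \<times> 'x) list \<Rightarrow> 'i \<Rightarrow> 'x"
  where "colours_after a w = foldl (\<lambda>a l. a(fst l := snd l)) a w"

lemma colours_after_simps [simp]:
  "colours_after a [] = a" "colours_after a (l # w) = colours_after (a(fst l := snd l)) w"
  "colours_after a (u @ v) = colours_after (colours_after a u) v"
  by (simp_all add: colours_after_def)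

lemma colours_after_cong: "a k = a' k \<Longrightarrow> colours_after a w k = colours_after a' w k"
proof (induction w arbitrary: a a')
  case (Cons l w)
  show ?case unfolding colours_after_simps by (rule Cons.IH) (use Cons.prems in simp)
qed simp

definition stutters :: "('i \<Rightarrow> 'x) \<Rightarrow> ('i \<times> 'x) list \<Rightarrow> bool"
  where "stutters a w \<longleftrightarrow> (\<exists>u i v. w = u @ (i, colours_after a u i) # v)"

definition taut :: "('i \<Rightarrow> 'i \<Rightarrow> enat) \<Rightarrow> ('i \<Rightarrow> 'x) \<Rightarrow> ('i \<times> 'x) list \<Rightarrow> bool"
  where "taut m a w \<longleftrightarrow> \<not> stutters a w \<and> \<not> cancellable m (map fst w)"

text \<open>
  The two ways to shorten a walk that are valid in every system satisfying the axioms of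
  \<open>chamber_act\<close> below: omit a step that changes nothing, or omit a step of type \<open>i\<close> whose effect
  is overwritten by a later one that it can be moved to.
\<close>
definition shortens :: "('i \<Rightarrow> 'i \<Rightarrow> enat) \<Rightarrow> ('i \<Rightarrow> 'x) \<Rightarrow> ('i \<times> 'x) list \<Rightarrow> ('i \<times> 'x) list \<Rightarrow> bool"
  where "shortens m a w w' \<longleftrightarrow>
    (\<exists>u i v. w = u @ (i, colours_after a u i) # v \<and> w' = u @ v) \<or>
    (\<exists>u i x b y v. w = u @ (i, x) # b @ (i, y) # v \<and> (\<forall>l\<in>set b. m i (fst l) = 2)
      \<and> w' = u @ b @ (i, y) # v)"

lemma shortens_smaller: "shortens m a w w' \<Longrightarrow> set w' \<subseteq> set w \<and> length w' < length w"
  unfolding shortens_def by auto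

lemma not_taut_shortens:
  assumes "\<not> taut m a w"
  obtains w' where "shortens m a w w'"
proof (cases "stutters a w")
  case True
  then show ?thesis using that unfolding stutters_def shortens_def by blast
next
  case False
  then obtain p i q r where eq: "map fst w = p @ i # q @ i # r" and c: "\<forall>k\<in>set q. m i k = 2"
    using assms unfolding taut_def cancellable_def by blast
  obtain u w1 where 1: "w = u @ w1" "map fst w1 = i # q @ i # r" using eq by (auto simp: map_eq_append_conv)
  then obtain x w2 where 2: "w1 = (i, x) # w2" "map fst w2 = q @ i # r" by (cases w1) auto
  obtain b w3 where 3: "w2 = b @ w3" "map fst b = q" "map fst w3 = i # r" using 2 by (auto simp: map_eq_append_conv)
  then obtain y v where 4: "w3 = (i, y) # v" by (cases w3) auto
  have "\<forall>l\<in>set b. m i (fst l) = 2" using c unfolding 3(2)[symmetric] by simp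
  then have "shortens m a w (u @ b @ (i, y) # v)"
    unfolding shortens_def using 1(1) 2(1) 3(1) 4 by blast
  then show ?thesis by (rule that)
qed

lemma taut_append:
  assumes "taut m a (u @ v)"
  shows "taut m a u" "taut m (colours_after a u) v"
proof -
  have n: "\<not> stutters a (u @ v)" "\<not> cancellable m (map fst u @ map fst v)"
    using assms by (simp_all add: taut_def)
  have "\<not> stutters a u" "\<not> stutters (colours_after a u) v"
    using n(1) unfolding stutters_def by (metis append.assoc append_Cons) (metis append.assoc colours_after_simps(3) n(1) stutters_def)
  then show "taut m a u" "taut m (colours_after a u) v"
    using not_cancellable_append[OF n(2)] by (simp_all add: taut_def)
qed

text \<open>
  Systems in which the letter \<open>(i, x)\<close> acts by changing the \<open>i\<close>-th colour to \<open>x\<close>. Apart from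
  coloured buildings, these include products of a building with the values of a cocycle.
\<close>
locale chamber_act =
  fixes I :: "'i set" and m :: "'i \<Rightarrow> 'i \<Rightarrow> enat" and X :: "'i \<Rightarrow> 'x set"
    and S :: "'s set" and cl :: "'i \<Rightarrow> 's \<Rightarrow> 'x" and mv :: "'s \<Rightarrow> 'i \<Rightarrow> 'x \<Rightarrow> 's"
  assumes cl_in: "\<lbrakk>s \<in> S; i \<in> I\<rbrakk> \<Longrightarrow> cl i s \<in> X i"
    and mv_in: "\<lbrakk>s \<in> S; i \<in> I; x \<in> X i\<rbrakk> \<Longrightarrow> mv s i x \<in> S"
    and cl_mv: "\<lbrakk>s \<in> S; i \<in> I; x \<in> X i\<rbrakk> \<Longrightarrow> cl i (mv s i x) = x"
    and cl_mv_other: "\<lbrakk>s \<in> S; i \<in> I; x \<in> X i; j \<in> I; j \<noteq> i\<rbrakk> \<Longrightarrow> cl j (mv s i x) = cl j s"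
    and mv_mv: "\<lbrakk>s \<in> S; i \<in> I; x \<in> X i; y \<in> X i\<rbrakk> \<Longrightarrow> mv (mv s i x) i y = mv s i y"
    and mv_cl: "\<lbrakk>s \<in> S; i \<in> I\<rbrakk> \<Longrightarrow> mv s i (cl i s) = s"
    and mv_commute: "\<lbrakk>s \<in> S; i \<in> I; j \<in> I; m i j = 2; x \<in> X i; y \<in> X j\<rbrakk> \<Longrightarrow>
      mv (mv s i x) j y = mv (mv s j y) i x"
begin

abbreviation words :: "('i \<times> 'x) list set"
  where "words \<equiv> lists (Sigma I X)"

lemma walk_in: "s \<in> S \<Longrightarrow> w \<in> words \<Longrightarrow> walk mv s w \<in> S"
  by (induction w arbitrary: s) (auto simp: mv_in)

lemma cl_walk: "s \<in> S \<Longrightarrow> w \<in> words \<Longrightarrow> k \<in> I \<Longrightarrow> cl k (walk mv s w) = colours_after (\<lambda>k. cl k s) w k"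
proof (induction w arbitrary: s)
  case (Cons l w)
  then obtain i x where l: "l = (i, x)" "i \<in> I" "x \<in> X i" by auto
  have "cl k (walk mv s (l # w)) = colours_after (\<lambda>k. cl k (mv s i x)) w k"
    using Cons l by (auto simp: mv_in)
  also have "\<dots> = colours_after ((\<lambda>k. cl k s)(i := x)) w k"
    by (rule colours_after_cong) (use Cons l in \<open>auto simp: cl_mv cl_mv_other\<close>)
  finally show ?case using l by simp
qed simp

lemma walk_commute:
  "s \<in> S \<Longrightarrow> b \<in> words \<Longrightarrow> i \<in> I \<Longrightarrow> x \<in> X i \<Longrightarrow> \<forall>l\<in>set b. m i (fst l) = 2 \<Longrightarrow>
    walk mv (mv s i x) b = mv (walk mv s b) i x"
  by (induction b arbitrary: s) (auto simp: mv_in mv_commute)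

lemma shortens_walk:
  assumes s: "s \<in> S" and w: "w \<in> words" and sh: "shortens m a w w'" and a: "\<And>k. k \<in> I \<Longrightarrow> a k = cl k s"
  shows "walk mv s w' = walk mv s w"
proof -
  consider (1) u i v where "w = u @ (i, colours_after a u i) # v" "w' = u @ v"
    | (2) u i x b y v where "w = u @ (i, x) # b @ (i, y) # v" "\<forall>l\<in>set b. m i (fst l) = 2"
      "w' = u @ b @ (i, y) # v"
    using sh unfolding shortens_def by blast
  then show ?thesis
  proof cases
    case 1
    have u: "u \<in> words" "i \<in> I" using w 1 by auto
    have "colours_after a u i = cl i (walk mv s u)"
      unfolding cl_walk[OF s u] by (rule colours_after_cong) (use a u in auto)
    then have "mv (walk mv s u) i (colours_after a u i) = walk mv s u"
      using mv_cl[OF walk_in[OF s u(1)] u(2)] by simp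
    then show ?thesis using 1 by simp
  next
    case 2
    have u: "u \<in> words" "b \<in> words" "i \<in> I" "x \<in> X i" "y \<in> X i" using w 2 by auto
    let ?t = "walk mv s u"
    have t: "?t \<in> S" using walk_in s u by blast
    have "mv (walk mv (mv ?t i x) b) i y = mv (mv (walk mv ?t b) i x) i y"
      using walk_commute[OF t u(2,3,4) 2(2)] by simp
    also have "\<dots> = mv (walk mv ?t b) i y" using mv_mv walk_in t u by blast
    finally show ?thesis using 2 by simp
  qed
qed

text \<open>
  Shortening only removes letters and ends with a taut word.
\<close>
lemma taut_word_exists:
  assumes s: "s \<in> S" and w: "w \<in> words"
  obtains v where "v \<in> words" "set v \<subseteq> set w" "walk mv s v = walk mv s w" "taut m (\<lambda>k. cl k s) v"
proof -
  have "\<exists>v\<in>words. set v \<subseteq> set w \<and> walk mv s v = walk mv s w \<and> taut m (\<lambda>k. cl k s) v"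
    using w
  proof (induction w rule: length_induct)
    case (1 w)
    show ?case
    proof (cases "taut m (\<lambda>k. cl k s) w")
      case True
      then show ?thesis using 1 by blast
    next
      case False
      then obtain w' where w': "shortens m (\<lambda>k. cl k s) w w'" using not_taut_shortens by blast
      have "w' \<in> words" using shortens_smaller[OF w'] 1(2) by auto
      then show ?thesis using 1 shortens_smaller[OF w'] shortens_walk[OF s 1(2) w']
        by (metis order_trans)
    qed
  qed
  then show ?thesis using that by blast
qed

end

section \<open>Coloured buildings\<close>

locale coloured_building = right_angled_building I m C adj \<delta>
  for I :: "'i set" and m :: "'i \<Rightarrow> 'i \<Rightarrow> enat" and C :: "'c set"
    and adj :: "'i \<Rightarrow> ('c \<times> 'c) set" and \<delta> :: "'c \<Rightarrow> 'c \<Rightarrow> 'i list set" +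
  fixes X :: "'i \<Rightarrow> 'x set" and col :: "'i \<Rightarrow> 'c \<Rightarrow> 'x"
  assumes legal: "legal_colouring I C adj X col"
begin

text \<open>
  The chamber of colour \<open>x\<close> in the \<open>i\<close>-panel of \<open>c\<close>; it is unique since a legal colouring
  restricts to a bijection on this panel.
\<close>
definition mv :: "'c \<Rightarrow> 'i \<Rightarrow> 'x \<Rightarrow> 'c"
  where "mv c i x = (THE d. (c, d) \<in> adj i \<and> col i d = x)"

lemma adj_in: "i \<in> I \<Longrightarrow> (c, d) \<in> adj i \<Longrightarrow> c \<in> C \<and> d \<in> C"
  using equiv_adj[of i] by (auto dest: equiv_type)

lemma adj_refl: "i \<in> I \<Longrightarrow> c \<in> C \<Longrightarrow> (c, c) \<in> adj i"
  using equiv_adj[of i] by (auto simp: equiv_def refl_on_def)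

lemma adj_sym: "i \<in> I \<Longrightarrow> (c, d) \<in> adj i \<Longrightarrow> (d, c) \<in> adj i"
  using equiv_adj[of i] by (auto simp: equiv_def dest: symD)

lemma adj_trans: "i \<in> I \<Longrightarrow> (c, d) \<in> adj i \<Longrightarrow> (d, e) \<in> adj i \<Longrightarrow> (c, e) \<in> adj i"
  using equiv_adj[of i] by (auto simp: equiv_def dest: transD)

lemma panel_in_panels: "i \<in> I \<Longrightarrow> c \<in> C \<Longrightarrow> adj i `` {c} \<in> panels C adj i"
  unfolding panels_def by (rule quotientI)

lemma col_bij: "i \<in> I \<Longrightarrow> c \<in> C \<Longrightarrow> bij_betw (col i) (adj i `` {c}) (X i)"
  using legal panel_in_panels unfolding legal_colouring_def by blast

lemma col_in: "i \<in> I \<Longrightarrow> c \<in> C \<Longrightarrow> col i c \<in> X i"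
  using legal unfolding legal_colouring_def by blast

lemma adj_col_other: "i \<in> I \<Longrightarrow> j \<in> I \<Longrightarrow> j \<noteq> i \<Longrightarrow> (c, d) \<in> adj i \<Longrightarrow> col j d = col j c"
proof -
  assume i: "i \<in> I" "j \<in> I" "j \<noteq> i" "(c, d) \<in> adj i"
  then have "c \<in> adj i `` {c}" "d \<in> adj i `` {c}" "c \<in> C" using adj_in adj_refl by blast+
  then show ?thesis using legal panel_in_panels[OF i(1)] i(2,3) i(1) unfolding legal_colouring_def by metis
qed

lemma adj_col_inj: "i \<in> I \<Longrightarrow> (c, d) \<in> adj i \<Longrightarrow> (c, e) \<in> adj i \<Longrightarrow> col i d = col i e \<Longrightarrow> d = e"
  using bij_betw_imp_inj_on[OF col_bij, of i c] adj_in[of i c d] by (auto dest: inj_onD)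

lemma mv_props:
  assumes "c \<in> C" "i \<in> I" "x \<in> X i"
  shows "(c, mv c i x) \<in> adj i \<and> col i (mv c i x) = x"
proof -
  have "x \<in> col i ` (adj i `` {c})"
    using bij_betw_imp_surj_on[OF col_bij[OF assms(2,1)]] assms(3) by simp
  then have "\<exists>d. (c, d) \<in> adj i \<and> col i d = x" by auto
  then have "\<exists>!d. (c, d) \<in> adj i \<and> col i d = x" using adj_col_inj[OF assms(2)] by blast
  then show ?thesis unfolding mv_def by (rule theI')
qed

lemma mv_eqI: "i \<in> I \<Longrightarrow> (c, d) \<in> adj i \<Longrightarrow> col i d = x \<Longrightarrow> mv c i x = d"
  using mv_props[of c i x] adj_in[of i c d] col_in[of i d] adj_col_inj by metis

lemma adj_iff_mv: "i \<in> I \<Longrightarrow> c \<in> C \<Longrightarrow> (c, d) \<in> adj i \<longleftrightarrow> (\<exists>x\<in>X i. d = mv c i x)"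
  using mv_props mv_eqI adj_in col_in by metis

lemma gallery_walk:
  assumes "c \<in> C" "w \<in> lists (Sigma I X)" "\<not> stutters (\<lambda>k. col k c) w"
  shows "gallery adj c (map fst w) (walk mv c w)"
  using assms
proof (induction w arbitrary: c)
  case (Cons l w)
  then obtain i x where l: "l = (i, x)" "i \<in> I" "x \<in> X i" by auto
  let ?d = "mv c i x"
  have d: "(c, ?d) \<in> adj i" "col i ?d = x" using mv_props Cons l by auto
  have dC: "?d \<in> C" using adj_in d l by blast
  have "x \<noteq> col i c"
    using Cons.prems(3) l unfolding stutters_def by (metis append_Nil colours_after_simps(1))
  then have "c \<noteq> ?d" using d by auto
  moreover have "\<not> stutters (\<lambda>k. col k ?d) w"
  proof
    assume "stutters (\<lambda>k. col k ?d) w"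
    then obtain u j v where w: "w = u @ (j, colours_after (\<lambda>k. col k ?d) u j) # v"
      unfolding stutters_def by blast
    then have j: "j \<in> I" using Cons.prems by auto
    have "colours_after (\<lambda>k. col k ?d) u j = colours_after ((\<lambda>k. col k c)(i := x)) u j"
      by (rule colours_after_cong) (use d adj_col_other l j in auto)
    then have "l # w = (l # u) @ (j, colours_after (\<lambda>k. col k c) (l # u) j) # v"
      using w l by simp
    then show False using Cons.prems(3) unfolding stutters_def by blast
  qed
  ultimately show ?case using Cons dC d l by auto
qed simp

lemma gallery_to_walk:
  assumes "c \<in> C" "t \<in> lists I" "gallery adj c t d"
  shows "\<exists>w\<in>lists (Sigma I X). map fst w = t \<and> walk mv c w = d"
  using assms
proof (induction t arbitrary: c)
  case (Cons i t)
  then obtain e where e: "(c, e) \<in> adj i" "gallery adj e t d" by auto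
  have i: "i \<in> I" "e \<in> C" using Cons adj_in e by auto
  obtain w where w: "w \<in> lists (Sigma I X)" "map fst w = t" "walk mv e w = d"
    using Cons.IH[OF i(2) _ e(2)] Cons.prems by auto
  have "mv c i (col i e) = e" using mv_eqI i e by blast
  then show ?case using w i col_in by (intro bexI[of _ "(i, col i e) # w"]) auto
qed auto

lemma map_fst_words: "w \<in> lists (Sigma I X) \<Longrightarrow> map fst w \<in> lists I"
  by (induction w) auto

lemma reduced_Nil: "reduced_word I m []"
  by (simp add: reduced_word_def)

text \<open>
  A taut walk is a gallery of reduced type. If it is closed, this type represents the identity.
\<close>
lemma taut_not_closed:
  assumes "c \<in> C" "w \<in> lists (Sigma I X)" "taut m (\<lambda>k. col k c) w" "walk mv c w = c"
  shows "w = []"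
proof -
  have t: "map fst w \<in> lists I" "\<not> cancellable m (map fst w)" using assms map_fst_words by (auto simp: taut_def)
  have r: "reduced_word I m (map fst w)" using not_cancellable_reduced t by blast
  have "gallery adj c (map fst w) c" using gallery_walk assms by (metis taut_def)
  then have "\<delta> c c = coxeter_elt I m (map fst w)" using delta_gallery r assms by blast
  moreover have "\<delta> c c = coxeter_elt I m []" using delta_gallery[OF assms(1,1) reduced_Nil] by simp
  ultimately have "length (map fst w) \<le> length ([] :: 'i list)" using r unfolding reduced_word_def by auto
  then show ?thesis by simp
qed

text \<open>
  The words \<open>ij\<close> and \<open>ji\<close> are reduced and represent the same element, so a gallery of the first type
  can be replaced by one of the second type.
\<close>
lemma adj_commute:
  assumes ij: "i \<in> I" "j \<in> I" "m i j = 2" and c: "(c, d) \<in> adj i" "(d, e) \<in> adj j"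
  shows "\<exists>d'. (c, d') \<in> adj j \<and> (d', e) \<in> adj i"
proof (cases "c = d \<or> d = e")
  case True
  then show ?thesis using c ij adj_in adj_refl by metis
next
  case False
  have ij': "m j i = 2" "i \<noteq> j" using ij symmetric m_diag_ne_2 by metis+
  have C: "c \<in> C" "e \<in> C" using c ij adj_in by blast+
  have nc: "\<not> cancellable m [k, l]" if "k \<noteq> l" for k l :: 'i
    using that by (auto simp: cancellable_def append_eq_Cons_conv Cons_eq_append_conv)
  have r: "reduced_word I m [i, j]" "reduced_word I m [j, i]"
    using not_cancellable_reduced nc ij ij' by auto
  have "coxeter_eq I m (concat (replicate 2 [i, j])) []"
    by (rule coxeter_eq.relator) (use ij in \<open>auto simp: numeral_eq_enat\<close>)
  then have 1: "coxeter_eq I m [i, j, i, j] []" by (simp add: numeral_2_eq_2)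
  have 2: "coxeter_eq I m [k, k] []" if "k \<in> I" for k
    using coxeter_eq.relator[of k I k m 1] diagonal[of k] that by (simp add: one_enat_def)
  have r0: "coxeter_eq I m u u" if "u \<in> lists I" for u using that by (rule coxeter_eq.refl)
  have "coxeter_eq I m ([i, j, i, j] @ [j, i]) ([] @ [j, i])"
    by (rule coxeter_eq.append[OF 1 r0]) (use ij in auto)
  moreover have "coxeter_eq I m ([i, j, i] @ [j, j] @ [i]) ([i, j, i] @ [] @ [i])"
    by (intro coxeter_eq.append 2 r0) (use ij in auto)
  moreover have "coxeter_eq I m ([i, j] @ [i, i]) ([i, j] @ [])"
    by (intro coxeter_eq.append 2 r0) (use ij in auto)
  ultimately have "coxeter_eq I m [i, j] [j, i]"
    by simp (meson coxeter_eq.sym coxeter_eq.trans)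
  then have "([i, j], [j, i]) \<in> coxeter_rel I m" by (simp add: coxeter_rel_def)
  then have "coxeter_elt I m [i, j] = coxeter_elt I m [j, i]"
    using equiv_class_eq[OF equiv_coxeter_rel] ij by (simp add: coxeter_elt_eq_class)
  moreover have "gallery adj c [i, j] e" using c False by auto
  ultimately have "gallery adj c [j, i] e" using delta_gallery[OF C] r by metis
  then show ?thesis by auto
qed

sublocale chamber_act I m X C col mv
proof
  fix s i assume s: "s \<in> C" "i \<in> I"
  show "col i s \<in> X i" using col_in s by blast
  show "mv s i (col i s) = s" using mv_eqI adj_refl s by blast
  fix x assume x: "x \<in> X i"
  note p = mv_props[OF s x]
  show mi: "mv s i x \<in> C" and "col i (mv s i x) = x" using p adj_in s by blast+
  { fix j assume "j \<in> I" "j \<noteq> i" then show "col j (mv s i x) = col j s"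
      using adj_col_other p s by blast }
  { fix y assume y: "y \<in> X i" show "mv (mv s i x) i y = mv s i y"
      by (rule mv_eqI) (use p s y mv_props adj_sym adj_trans in blast)+ }
  { fix j y assume j: "j \<in> I" "m i j = 2" "y \<in> X j"
    have ij: "j \<noteq> i" using j s m_diag_ne_2 by metis
    have q: "(mv s i x, mv (mv s i x) j y) \<in> adj j" "col j (mv (mv s i x) j y) = y"
      using mv_props[OF mi j(1,3)] by auto
    obtain d' where d': "(s, d') \<in> adj j" "(d', mv (mv s i x) j y) \<in> adj i"
      using adj_commute[OF s(2) j(1,2)] p q by blast
    have "mv s j y = d'"
      using mv_eqI[OF j(1) d'(1)] adj_col_other[OF s(2) j(1) ij d'(2)] q(2) by simp
    moreover have "mv d' i x = mv (mv s i x) j y"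
      using mv_eqI[OF s(2) d'(2)] adj_col_other[OF j(1) s(2) ij[symmetric] q(1)] p by simp
    ultimately show "mv (mv s i x) j y = mv (mv s j y) i x" by simp }
qed

lemma connected:
  assumes "c \<in> C" "d \<in> C"
  obtains w where "w \<in> words" "walk mv c w = d"
proof -
  obtain u where u: "u \<in> lists I" "\<delta> c d = coxeter_rel I m `` {u}"
    using delta_closed[OF assms] by (auto simp: coxeter_group_def quotient_def)
  define P where "P = (\<lambda>v. v \<in> lists I \<and> coxeter_elt I m v = \<delta> c d)"
  have "P u" using u by (simp add: P_def coxeter_elt_eq_class)
  then obtain v where v: "P v" "\<And>v'. P v' \<Longrightarrow> length v \<le> length v'"
    using ex_has_least_nat[of P u length] by blast
  have "reduced_word I m v" using v unfolding reduced_word_def P_def by auto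
  then have "gallery adj c v d" using delta_gallery assms v(1) unfolding P_def by metis
  then show ?thesis using gallery_to_walk[OF assms(1)] v(1) that unfolding P_def by blast
qed

text \<open>
  The types of both walks are reduced words for the Weyl distance of their ends.
\<close>
lemma taut_same_types:
  assumes "c \<in> C" "u \<in> words" "v \<in> words" "taut m (\<lambda>k. col k c) u" "taut m (\<lambda>k. col k c) v"
    and e: "walk mv c u = walk mv c v"
  shows "fst ` set u = fst ` set v"
proof -
  have t: "map fst u \<in> lists I" "\<not> cancellable m (map fst u)" "map fst v \<in> lists I" "\<not> cancellable m (map fst v)"
    using assms map_fst_words by (auto simp: taut_def)
  have "gallery adj c (map fst u) (walk mv c u)" "gallery adj c (map fst v) (walk mv c v)"
    using gallery_walk assms(1-5) unfolding taut_def by blast+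
  then have "coxeter_elt I m (map fst u) = coxeter_elt I m (map fst v)"
    using delta_gallery[OF assms(1) walk_in[OF assms(1,2)]] not_cancellable_reduced t e by metis
  then show ?thesis using not_cancellable_same_letters[OF t] by simp
qed

text \<open>
  A nonempty closed walk in the building is not taut, hence can be shortened, and the same
  shortening is valid in the other system. By induction walks that are closed in the building are
  closed in the other system, and walks with a common end have a common end there. Sending the end of a
  walk in the building to the end of the same walk in the other system is therefore well defined.
\<close>
theorem universal_property:
  assumes act: "chamber_act I m X S cl mv'" and c0: "c0 \<in> C" and s0: "s0 \<in> S"
    and eq: "\<And>k. k \<in> I \<Longrightarrow> cl k s0 = col k c0"
  obtains \<phi> where "\<phi> c0 = s0" "\<And>e. e \<in> C \<Longrightarrow> \<phi> e \<in> S"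
    "\<And>e k. e \<in> C \<Longrightarrow> k \<in> I \<Longrightarrow> cl k (\<phi> e) = col k e"
    "\<And>e i x. e \<in> C \<Longrightarrow> i \<in> I \<Longrightarrow> x \<in> X i \<Longrightarrow> \<phi> (mv e i x) = mv' (\<phi> e) i x"
proof -
  interpret A: chamber_act I m X S cl mv' by (rule act)
  have closed: "walk mv' s0 w = s0" if "w \<in> words" "walk mv c0 w = c0" for w
    using that
  proof (induction w rule: length_induct)
    case (1 w)
    show ?case
    proof (cases "w = []")
      case False
      then have "\<not> taut m (\<lambda>k. col k c0) w" using taut_not_closed c0 1(2,3) by blast
      then obtain w' where w': "shortens m (\<lambda>k. col k c0) w w'" using not_taut_shortens by blast
      have "walk mv c0 w' = walk mv c0 w" using shortens_walk[OF c0 1(2) w'] by simp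
      moreover have "walk mv' s0 w' = walk mv' s0 w" using A.shortens_walk[OF s0 1(2) w'] eq by simp
      moreover have "w' \<in> words" "length w' < length w" using shortens_smaller[OF w'] 1(2) by auto
      ultimately show ?thesis using 1(1,3) by metis
    qed simp
  qed
  have col_eq: "cl k (walk mv' s0 w) = col k (walk mv c0 w)" if "w \<in> words" "k \<in> I" for w k
    unfolding cl_walk[OF c0 that] A.cl_walk[OF s0 that] by (rule colours_after_cong) (use eq that in simp)
  have wd: "walk mv' s0 u = walk mv' s0 v" if "u \<in> words" "v \<in> words" "walk mv c0 u = walk mv c0 v" for u v
    using that
  proof (induction v arbitrary: u rule: rev_induct)
    case Nil
    then show ?case using closed by simp
  next
    case (snoc l v)
    obtain i x where l: "l = (i, x)" "i \<in> I" "x \<in> X i" "v \<in> words" using snoc.prems by auto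
    let ?d = "walk mv c0 v" and ?d' = "walk mv' s0 v"
    define y where "y = col i ?d"
    have d: "?d \<in> C" "walk mv c0 u \<in> C" "walk mv' s0 u \<in> S" "?d' \<in> S"
      using walk_in A.walk_in c0 s0 l snoc.prems by blast+
    have y: "y \<in> X i" using d l col_in y_def by blast
    have u: "walk mv c0 u = mv ?d i x" using snoc.prems(3) l by simp
    then have "walk mv c0 (u @ [(i, y)]) = ?d"
      using mv_mv[OF d(1) l(2,3) y] mv_cl[OF d(1) l(2)] y_def by simp
    then have "walk mv' s0 (u @ [(i, y)]) = ?d'"
      using snoc.IH[of "u @ [(i, y)]"] l y snoc.prems(1) by simp
    then have "mv' (mv' (walk mv' s0 u) i y) i x = mv' ?d' i x" by simp
    then have "mv' (walk mv' s0 u) i x = mv' ?d' i x" using A.mv_mv[OF d(3) l(2) y l(3)] by simp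
    moreover have "cl i (walk mv' s0 u) = x"
      using col_eq[OF snoc.prems(1) l(2)] u cl_mv[OF d(1) l(2,3)] by simp
    ultimately show ?case using A.mv_cl[OF d(3) l(2)] l by auto
  qed
  define \<phi> where "\<phi> e = walk mv' s0 (SOME w. w \<in> words \<and> walk mv c0 w = e)" for e
  have \<phi>: "\<phi> (walk mv c0 w) = walk mv' s0 w" if "w \<in> words" for w
  proof -
    let ?P = "\<lambda>w'. w' \<in> words \<and> walk mv c0 w' = walk mv c0 w"
    have "?P (SOME w'. ?P w')" by (rule someI[of ?P w]) (use that in simp)
    then show ?thesis unfolding \<phi>_def using wd that by metis
  qed
  show ?thesis
  proof (rule that[of \<phi>])
    show "\<phi> c0 = s0" using \<phi>[of "[]"] by simp
    fix e assume "e \<in> C"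
    then obtain w where w: "w \<in> words" "walk mv c0 w = e" using connected c0 by blast
    show "\<phi> e \<in> S" using \<phi> w A.walk_in s0 by metis
    show "cl k (\<phi> e) = col k e" if "k \<in> I" for k using \<phi> w col_eq that by metis
    show "\<phi> (mv e i x) = mv' (\<phi> e) i x" if "i \<in> I" "x \<in> X i" for i x
      using \<phi>[of "w @ [(i, x)]"] \<phi>[OF w(1)] w that by simp
  qed
qed

lemma chamber_induct [consumes 2, case_names base step]:
  assumes "c \<in> C" "d \<in> C" "P c" "\<And>e i x. e \<in> C \<Longrightarrow> P e \<Longrightarrow> i \<in> I \<Longrightarrow> x \<in> X i \<Longrightarrow> P (mv e i x)"
  shows "P d"
proof -
  have "P (walk mv c w)" if "w \<in> words" for w
    using that
  proof (induction w rule: rev_induct)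
    case (snoc l w)
    then show ?case using assms(4)[OF walk_in[OF assms(1), of w], of "fst l" "snd l"] by auto
  qed (simp add: assms(3))
  then show ?thesis using connected assms(1,2) by metis
qed

end

section \<open>Walls and wings\<close>

context coloured_building
begin

text \<open>
  The residue of \<open>c\<close> of type \<open>{i} \<union> {j. m i j = 2}\<close>, which is the union of the \<open>i\<close>-panels parallel
  to that of \<open>c\<close>.
\<close>
inductive_set wall :: "'i \<Rightarrow> 'c \<Rightarrow> 'c set" for i c where
  base: "c \<in> wall i c"
| step: "\<lbrakk>e \<in> wall i c; j \<in> I; j = i \<or> m i j = 2; x \<in> X j\<rbrakk> \<Longrightarrow> mv e j x \<in> wall i c"

text \<open>
  The chambers that are reached from \<open>c\<close> without crossing its wall by an \<open>i\<close>-step. Equivalently,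
  these are the chambers that project to \<open>c\<close> in the \<open>i\<close>-panel of \<open>c\<close>.
\<close>
inductive_set wing :: "'i \<Rightarrow> 'c \<Rightarrow> 'c set" for i c where
  base: "c \<in> wing i c"
| step: "\<lbrakk>e \<in> wing i c; j \<in> I; j \<noteq> i \<or> e \<notin> wall i c; x \<in> X j\<rbrakk> \<Longrightarrow> mv e j x \<in> wing i c"

lemma wall_in: "e \<in> wall i c \<Longrightarrow> c \<in> C \<Longrightarrow> e \<in> C"
  by (induction rule: wall.induct) (auto simp: mv_in)

lemma wing_in: "e \<in> wing i c \<Longrightarrow> c \<in> C \<Longrightarrow> e \<in> C"
  by (induction rule: wing.induct) (auto simp: mv_in)

lemma mv_back: "e \<in> C \<Longrightarrow> j \<in> I \<Longrightarrow> x \<in> X j \<Longrightarrow> mv (mv e j x) j (col j e) = e"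
  by (simp add: mv_mv mv_cl cl_in)

lemma wall_trans: "e \<in> wall i d \<Longrightarrow> d \<in> wall i c \<Longrightarrow> e \<in> wall i c"
  by (induction rule: wall.induct) (auto intro: wall.step)

lemma wall_sym: "d \<in> wall i c \<Longrightarrow> c \<in> C \<Longrightarrow> c \<in> wall i d"
proof (induction rule: wall.induct)
  case (step e j x)
  have e: "e \<in> C" using wall_in step by blast
  have "mv (mv e j x) j (col j e) \<in> wall i (mv e j x)"
    by (rule wall.step) (use step e cl_in wall.base in auto)
  then have "e \<in> wall i (mv e j x)" using mv_back e step by simp
  then show ?case using step wall_trans by blast
qed (rule wall.base)

lemma wall_eq: "d \<in> wall i c \<Longrightarrow> c \<in> C \<Longrightarrow> wall i d = wall i c"
  using wall_sym wall_trans by blast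

lemma wall_mv: "c \<in> C \<Longrightarrow> i \<in> I \<Longrightarrow> x \<in> X i \<Longrightarrow> wall i (mv c i x) = wall i c"
  using wall_eq[OF wall.step[OF wall.base]] by blast

lemma mv_in_wall_iff:
  "e \<in> C \<Longrightarrow> j \<in> I \<Longrightarrow> j = i \<or> m i j = 2 \<Longrightarrow> x \<in> X j \<Longrightarrow> mv e j x \<in> wall i c \<longleftrightarrow> e \<in> wall i c"
  using wall.step[of "mv e j x" i c j "col j e"] wall.step[of e i c j x] mv_back cl_in by metis

lemma wall_col: "e \<in> wall i c \<Longrightarrow> c \<in> C \<Longrightarrow> j \<in> I \<Longrightarrow> j \<noteq> i \<Longrightarrow> m i j \<noteq> 2 \<Longrightarrow> col j e = col j c"
proof (induction rule: wall.induct)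
  case (step e k x)
  then show ?case using wall_in cl_mv_other by metis
qed simp

text \<open>
  The function \<open>\<beta>\<close> records the parity of the number of steps along the wall that change between
  the colour of \<open>c\<close> and the other colours. Such steps telescope in panels, and the number does
  not change when steps of commuting types are exchanged, so the parity is determined by the
  end of the walk: building and parity together form a \<open>chamber_act\<close>.
\<close>
lemma wall_sides:
  assumes c: "c \<in> C" and i: "i \<in> I"
  obtains \<beta> where "\<beta> c" "\<And>e j x. \<lbrakk>e \<in> C; j \<in> I; j \<noteq> i \<or> e \<notin> wall i c; x \<in> X j\<rbrakk> \<Longrightarrow> \<beta> (mv e j x) = \<beta> e"
    "\<And>e. e \<in> wall i c \<Longrightarrow> \<beta> e \<longleftrightarrow> col i e = col i c"
proof -
  let ?T = "wall i c" and ?a = "col i c"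
  define mv' where "mv' = (\<lambda>(e, b) j x. (mv e j x,
    if j = i \<and> e \<in> ?T then b \<noteq> ((col i e = ?a) \<noteq> (x = ?a)) else b))"
  have mv': "mv' (e, b) j x = (mv e j x,
    if j = i \<and> e \<in> ?T then b \<noteq> ((col i e = ?a) \<noteq> (x = ?a)) else b)" for e b j x
    by (simp add: mv'_def)
  have act: "chamber_act I m X (C \<times> (UNIV :: bool set)) (\<lambda>k s. col k (fst s)) mv'"
  proof (unfold_locales, goal_cases)
    case (1 s i) then show ?case using cl_in by auto
  next
    case (2 s i x) then show ?case using mv_in by (auto simp: mv'_def)
  next
    case (3 s i x) then show ?case using cl_mv by (auto simp: mv'_def)
  next
    case (4 s i x j) then show ?case using cl_mv_other by (auto simp: mv'_def)
  next
    case (5 s k x y)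
    obtain e b where s: "s = (e, b)" "e \<in> C" using 5 by auto
    show ?case
    proof (cases "k = i \<and> e \<in> ?T")
      case True
      then have "mv e i x \<in> ?T" "col i (mv e i x) = x" using 5 s mv_in_wall_iff cl_mv by blast+
      then show ?thesis using True 5 s by (simp add: mv' mv_mv) blast
    next
      case False
      then have "\<not> (k = i \<and> mv e k x \<in> ?T)" using 5 s mv_in_wall_iff by blast
      then show ?thesis using False 5 s by (auto simp: mv' mv_mv)
    qed
  next
    case (6 s k)
    then show ?case by (cases s) (auto simp: mv' mv_cl)
  next
    case (7 s k j x y)
    obtain e b where s: "s = (e, b)" "e \<in> C" using 7 by auto
    have kj: "k \<noteq> j" "m j k = 2" using 7 symmetric m_diag_ne_2 by metis+
    have 1: "mv (mv e k x) j y = mv (mv e j y) k x" using mv_commute s 7 by blast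
    have 2: "mv e k x \<in> ?T \<longleftrightarrow> e \<in> ?T" "col i (mv e k x) = col i e" if "j = i"
      using mv_in_wall_iff[of e k i x c] cl_mv_other[of e k x i] 7 s that kj by auto
    have 3: "mv e j y \<in> ?T \<longleftrightarrow> e \<in> ?T" "col i (mv e j y) = col i e" if "k = i"
      using mv_in_wall_iff[of e j i y c] cl_mv_other[of e j y i] 7 s that kj by auto
    show ?case using 1 2 3 kj s by (auto simp: mv')
  qed
  obtain \<phi> where \<phi>: "\<phi> c = (c, True)" "\<And>e. e \<in> C \<Longrightarrow> \<phi> e \<in> C \<times> UNIV"
    "\<And>e j x. e \<in> C \<Longrightarrow> j \<in> I \<Longrightarrow> x \<in> X j \<Longrightarrow> \<phi> (mv e j x) = mv' (\<phi> e) j x"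
    by (rule universal_property[OF act c, of "(c, True)"]) (use c in auto)
  have fst: "fst (\<phi> e) = e" if "e \<in> C" for e
    using c that by (induction rule: chamber_induct) (auto simp: \<phi> mv'_def split: prod.splits)
  have \<phi>m: "snd (\<phi> (mv e j x)) = (if j = i \<and> e \<in> ?T then snd (\<phi> e) \<noteq> ((col i e = ?a) \<noteq> (x = ?a)) else snd (\<phi> e))"
    if "e \<in> C" "j \<in> I" "x \<in> X j" for e j x
  proof -
    have "\<phi> e = (e, snd (\<phi> e))" using fst[OF that(1)] by (simp add: prod_eq_iff)
    then have "\<phi> (mv e j x) = mv' (e, snd (\<phi> e)) j x" using \<phi>(3)[OF that] by simp
    then show ?thesis unfolding mv' by simp
  qed
  have T: "snd (\<phi> e) \<longleftrightarrow> col i e = ?a" if "e \<in> ?T" for e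
    using that
  proof (induction rule: wall.induct)
    case (step e j x)
    have e: "e \<in> C" using step wall_in c by blast
    show ?case using \<phi>m[OF e step(2,4)] step cl_mv[OF e step(2,4)] cl_mv_other[OF e step(2,4) i] i
      by (cases "j = i") auto
  qed (simp add: \<phi>)
  show ?thesis
  proof (rule that[of "\<lambda>e. snd (\<phi> e)"])
    show "snd (\<phi> (mv e j x)) = snd (\<phi> e)" if "e \<in> C" "j \<in> I" "j \<noteq> i \<or> e \<notin> ?T" "x \<in> X j" for e j x
      using \<phi>m[of e j x] that by auto
  qed (use \<phi> T in auto)
qed

lemma wall_wing_col:
  assumes "c \<in> C" "i \<in> I" "e \<in> wall i c" "e \<in> wing i c"
  shows "col i e = col i c"
proof -
  obtain \<beta> where \<beta>: "\<beta> c" "\<And>e j x. \<lbrakk>e \<in> C; j \<in> I; j \<noteq> i \<or> e \<notin> wall i c; x \<in> X j\<rbrakk> \<Longrightarrow> \<beta> (mv e j x) = \<beta> e"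
    "\<And>e. e \<in> wall i c \<Longrightarrow> \<beta> e \<longleftrightarrow> col i e = col i c" using wall_sides[OF assms(1,2)] by blast
  have "\<beta> e" using assms(4) by (induction rule: wing.induct) (use \<beta> wing_in assms(1) in auto)
  then show ?thesis using \<beta> assms by blast
qed

lemma wing_disjoint:
  assumes "c \<in> C" "i \<in> I" "x \<in> X i" "x \<noteq> col i c"
  shows "wing i c \<inter> wing i (mv c i x) = {}"
proof -
  obtain \<beta> where \<beta>: "\<beta> c" "\<And>e j x. \<lbrakk>e \<in> C; j \<in> I; j \<noteq> i \<or> e \<notin> wall i c; x \<in> X j\<rbrakk> \<Longrightarrow> \<beta> (mv e j x) = \<beta> e"
    "\<And>e. e \<in> wall i c \<Longrightarrow> \<beta> e \<longleftrightarrow> col i e = col i c" using wall_sides[OF assms(1,2)] by blast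
  have 1: "\<beta> e" if "e \<in> wing i c" for e
    using that by (induction rule: wing.induct) (use \<beta> wing_in assms(1) in auto)
  have d: "mv c i x \<in> wall i c" using wall.step[OF wall.base] assms by blast
  have 2: "\<not> \<beta> e" if "e \<in> wing i (mv c i x)" for e
    using that
  proof (induction rule: wing.induct)
    case base
    then show ?case using \<beta>(3)[OF d] assms cl_mv by simp
  next
    case (step e j y)
    then show ?case using \<beta>(2) wing_in mv_in assms wall_mv by metis
  qed
  show ?thesis using 1 2 by blast
qed

lemma wing_disjoint':
  assumes "c \<in> C" "i \<in> I" "x \<in> X i" "y \<in> X i" "x \<noteq> y"
  shows "wing i (mv c i x) \<inter> wing i (mv c i y) = {}"
  using wing_disjoint[of "mv c i x" i y] assms mv_mv cl_mv mv_in by metis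

lemma wall_mv_wing:
  assumes "f \<in> wall i c" "c \<in> C" "i \<in> I" "y \<in> X i"
  shows "mv f i y \<in> wing i (mv c i y)"
  using assms(1)
proof (induction rule: wall.induct)
  case (step e j x)
  have e: "e \<in> C" using step wall_in assms by blast
  show ?case
  proof (cases "j = i")
    case True
    then show ?thesis using step e mv_mv assms by simp
  next
    case False
    then have "m j i = 2" using step symmetric assms by metis
    then have "mv (mv e j x) i y = mv (mv e i y) j x" using mv_commute e step assms by blast
    then show ?thesis using wing.step[OF step.IH step(2)] False step by simp
  qed
qed (rule wing.base)

lemma wing_cover:
  assumes "c \<in> C" "i \<in> I" "f \<in> C"
  shows "\<exists>x\<in>X i. f \<in> wing i (mv c i x)"
  using assms(1,3)
proof (induction rule: chamber_induct)
  case base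
  then show ?case using wing.base[of c i] mv_cl cl_in assms by metis
next
  case (step e j x)
  then obtain y where y: "y \<in> X i" "e \<in> wing i (mv c i y)" by blast
  show ?case
  proof (cases "j \<noteq> i \<or> e \<notin> wall i c")
    case True
    then have "mv e j x \<in> wing i (mv c i y)"
      using wing.step[OF y(2)] wall_mv[OF assms(1,2) y(1)] step by simp
    then show ?thesis using y by blast
  next
    case False
    then show ?thesis using wall_mv_wing assms step by blast
  qed
qed

text \<open>
  A panel that straddles the boundary of a wing meets the wing in a single chamber.
\<close>
lemma wing_panel:
  assumes "c \<in> C" "i \<in> I" "e \<in> wing i c" "k \<in> I"
  shows "(\<forall>x\<in>X k. mv e k x \<in> wing i c) \<or> (\<forall>x\<in>X k. mv e k x \<in> wing i c \<longrightarrow> mv e k x = e)"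
proof (cases "k \<noteq> i \<or> e \<notin> wall i c")
  case True
  then show ?thesis using wing.step assms by blast
next
  case False
  have e: "e \<in> C" using assms wing_in by blast
  have "mv e k x = e" if "x \<in> X k" "mv e k x \<in> wing i c" for x
  proof -
    have "mv e k x \<in> wall i c" using False wall.step assms that by blast
    then have "x = col i e" using wall_wing_col assms that False cl_mv[OF e] by metis
    then show ?thesis using mv_cl[OF e] False assms by simp
  qed
  then show ?thesis by blast
qed

text \<open>
  A walk inside \<open>wing l r\<close> could leave \<open>wing i c\<close> only at the wall of \<open>c\<close>.
\<close>
lemma wing_subset:
  assumes "c \<in> C" "i \<in> I" "r \<in> wing i c" "wing l r \<inter> wall i c = {}"
  shows "wing l r \<subseteq> wing i c"
proof
  fix e assume "e \<in> wing l r"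
  then show "e \<in> wing i c"
  proof (induction rule: wing.induct)
    case (step e j x)
    then show ?case using assms(4) wing.step[of e i c j x] by blast
  qed (rule assms(3))
qed

text \<open>
  Distinct walls of the same type are disjoint, so moving along one never crosses the other.
\<close>
lemma wall_subset_wing:
  assumes "c \<in> C" "r \<in> C" "e \<in> wall i c" "e \<in> wing i r" "wall i c \<noteq> wall i r"
  shows "wall i c \<subseteq> wing i r"
proof -
  have eq: "wall i e = wall i c" using wall_eq assms by blast
  have "f \<in> wing i r" if "f \<in> wall i e" for f
    using that
  proof (induction rule: wall.induct)
    case (step f j x)
    then have "f \<notin> wall i r" using wall_eq assms eq by metis
    then show ?case using wing.step step by blast
  qed (rule assms)
  then show ?thesis using eq by blast
qed

text \<open>
  The steps along the wall of type \<open>j\<close> at \<open>c\<close> are not of type \<open>i\<close>. Hence this wall stays inside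
  \<open>wing i c\<close> and does not meet any other wing of the \<open>i\<close>-panel of \<open>c\<close>.
\<close>
lemma wing_nest:
  assumes c: "c \<in> C" "i \<in> I" "j \<in> I" "m i j = \<infinity>" and x: "x \<in> X i" "x \<noteq> col i c"
  shows "wing i (mv c i x) \<subseteq> wing j c"
proof (rule wing_subset)
  have ij: "i \<noteq> j" "m j i = \<infinity>" using c symmetric diagonal by force+
  have sub: "f \<in> wing i c" if "f \<in> wall j c" for f
    using that
  proof (induction rule: wall.induct)
    case (step e k y)
    then have "k \<noteq> i" using ij by auto
    then show ?case using step wing.step by blast
  qed (rule wing.base)
  then show "wing i (mv c i x) \<inter> wall j c = {}" using wing_disjoint[OF c(1,2) x] by blast
  show "mv c i x \<in> wing j c" using wing.step[OF wing.base c(2)] ij x by blast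
qed (use assms in auto)

text \<open>
  In a tree, where chambers are edges, these are the two half-trees that overlap in the edge \<open>c\<close>.
\<close>
lemma wing_complement:
  assumes c: "c \<in> C" "i \<in> I" "j \<in> I" "m i j = \<infinity>"
  shows "C - wing i c \<subseteq> wing j c"
proof
  fix f assume f: "f \<in> C - wing i c"
  then obtain x where x: "x \<in> X i" "f \<in> wing i (mv c i x)" using wing_cover c by blast
  then have "x \<noteq> col i c" using f c mv_cl by auto
  then show "f \<in> wing j c" using wing_nest c x by blast
qed

text \<open>
  A taut walk crosses the wall of its first step, of type \<open>i\<close>, only once. The part before a second
  crossing would have both ends on the wall, hence use the same types as a taut walk along the wall,
  and the two crossings could be cancelled.
\<close>
lemma wings_separate:
  assumes e: "e \<in> C" "e' \<in> C" "e \<noteq> e'"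
  obtains i where "i \<in> I" "e' \<notin> wing i e"
proof -
  obtain w0 where "w0 \<in> words" "walk mv e w0 = e'" using connected e by blast
  then obtain w where w: "w \<in> words" "walk mv e w = e'" "taut m (\<lambda>k. col k e) w"
    using taut_word_exists e by metis
  then have "w \<noteq> []" using e by auto
  then obtain i x w' where w': "w = (i, x) # w'" by (metis list.exhaust surj_pair)
  have i: "i \<in> I" "x \<in> X i" "w' \<in> words" using w w' by auto
  let ?d = "mv e i x"
  have d: "?d \<in> C" using mv_in e i by blast
  have "x \<noteq> col i e"
    using w(3) w' unfolding taut_def stutters_def by (metis append_Nil colours_after_simps(1))
  note disj = wing_disjoint[OF e(1) i(1,2) this]
  have "walk mv ?d w1 \<in> wing i ?d" if "w' = w1 @ w2" for w1 w2
    using that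
  proof (induction w1 arbitrary: w2 rule: rev_induct)
    case Nil
    then show ?case by (simp add: wing.base)
  next
    case (snoc l w1)
    obtain j y where l: "l = (j, y)" "j \<in> I" "y \<in> X j" using snoc.prems i by auto
    have IH: "walk mv ?d w1 \<in> wing i ?d" using snoc.IH[of "l # w2"] snoc.prems by simp
    have "\<not> (j = i \<and> walk mv ?d w1 \<in> wall i ?d)"
    proof
      assume as: "j = i \<and> walk mv ?d w1 \<in> wall i ?d"
      have w1: "w1 \<in> words" using snoc.prems i by auto
      have "\<exists>v\<in>words. (\<forall>l\<in>set v. fst l = i \<or> m i (fst l) = 2) \<and> walk mv ?d v = f" if "f \<in> wall i ?d" for f
        using that
      proof (induction rule: wall.induct)
        case base
        then show ?case by (intro bexI[of _ "[]"]) auto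
      next
        case (step f k z)
        then obtain v where "v \<in> words" "\<forall>l\<in>set v. fst l = i \<or> m i (fst l) = 2" "walk mv ?d v = f" by blast
        then show ?case using step by (intro bexI[of _ "v @ [(k, z)]"]) auto
      qed
      then obtain v0 where v0: "v0 \<in> words" "\<forall>l\<in>set v0. fst l = i \<or> m i (fst l) = 2"
        "walk mv ?d v0 = walk mv ?d w1" using as by blast
      obtain v where v: "v \<in> words" "set v \<subseteq> set v0" "walk mv ?d v = walk mv ?d w1"
        "taut m (\<lambda>k. col k ?d) v" using taut_word_exists[OF d v0(1)] v0(3) by metis
      have "w = [(i, x)] @ (w1 @ (l # w2))" using w' snoc.prems by simp
      then have "taut m (colours_after (\<lambda>k. col k e) [(i, x)]) (w1 @ (l # w2))"
        using taut_append(2) w(3) by blast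
      then have t: "taut m (colours_after (\<lambda>k. col k e) [(i, x)]) w1" using taut_append(1) by blast
      have "taut m (\<lambda>k. col k ?d) w1"
      proof -
        have "\<not> stutters (\<lambda>k. col k ?d) w1"
        proof
          assume "stutters (\<lambda>k. col k ?d) w1"
          then obtain u k q where u: "w1 = u @ (k, colours_after (\<lambda>k. col k ?d) u k) # q"
            unfolding stutters_def by blast
          then have k: "k \<in> I" using w1 by auto
          have "colours_after (\<lambda>k. col k ?d) u k = colours_after (colours_after (\<lambda>k. col k e) [(i, x)]) u k"
            by (rule colours_after_cong) (use cl_mv cl_mv_other e i k in auto)
          then show False using t u unfolding taut_def stutters_def by metis
        qed
        then show ?thesis using t unfolding taut_def by blast
      qed
      then have "fst ` set w1 = fst ` set v" using taut_same_types[OF d w1 v(1) _ v(4)] v(3) by simp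
      then have ty: "k = i \<or> m i k = 2" if "k \<in> set (map fst w1)" for k
        using that v(2) v0(2) by (auto 0 3)
      have nc: "\<not> cancellable m (map fst w)" using w(3) unfolding taut_def by blast
      have "map fst w = [] @ i # map fst w1 @ i # map fst w2" using w' snoc.prems l as by simp
      moreover have "\<exists>b r. map fst w1 @ i # map fst w2 = b @ i # r \<and> (\<forall>k\<in>set b. m i k = 2)"
      proof (cases "i \<in> set (map fst w1)")
        case True
        then obtain b r where br: "map fst w1 = b @ i # r" "i \<notin> set b" by (meson split_list_first)
        then have "\<forall>k\<in>set b. m i k = 2" using ty by (metis UnCI set_append)
        moreover have "map fst w1 @ i # map fst w2 = b @ i # (r @ i # map fst w2)" using br by simp
        ultimately show ?thesis by blast
      next
        case False
        then show ?thesis using ty by blast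
      qed
      ultimately show False using nc unfolding cancellable_def by (metis append_Nil)
    qed
    then show ?case using wing.step[OF IH l(2) _ l(3)] l by auto
  qed
  from this[of w' "[]"] have "e' \<in> wing i ?d" using w w' by simp
  then show ?thesis using that i disj by blast
qed

end

section \<open>Thick irreducible buildings\<close>

text \<open>
  Thickness is expressed by the colours: no two of them exhaust a panel.
\<close>
locale thick_irreducible_building = coloured_building I m C adj \<delta> X col
  for I :: "'i set" and m :: "'i \<Rightarrow> 'i \<Rightarrow> enat" and C :: "'c set"
    and adj :: "'i \<Rightarrow> ('c \<times> 'c) set" and \<delta> :: "'c \<Rightarrow> 'c \<Rightarrow> 'i list set"
    and X :: "'i \<Rightarrow> 'x set" and col :: "'i \<Rightarrow> 'c \<Rightarrow> 'x" +
  assumes irreducible: "irreducible_type I m" and rank: "2 \<le> card I"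
    and colours3: "\<And>i a b. i \<in> I \<Longrightarrow> \<exists>x\<in>X i. x \<noteq> a \<and> x \<noteq> b"
begin

lemma neighbour: "i \<in> I \<Longrightarrow> \<exists>j\<in>I. m i j = \<infinity>"
proof -
  assume i: "i \<in> I"
  have "\<not> I \<subseteq> {i}" using rank card_mono[of "{i}" I] by auto
  then obtain k where "k \<in> I" "k \<noteq> i" by blast
  then have "(i, k) \<in> (diagram I m)\<^sup>*" using irreducible i unfolding irreducible_type_def by blast
  then show ?thesis using \<open>k \<noteq> i\<close> by (cases rule: converse_rtranclE) (auto simp: diagram_def)
qed

text \<open>
  A \<open>j\<close>-panel with \<open>j\<close> not commuting with \<open>i\<close> meets a wall of type \<open>i\<close> at most once, so some chamber
  of the intersection lies on neither of the two walls. Each of these walls meets only one wing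
  of the \<open>i\<close>-panel of this chamber, and a third wing of the panel avoids both.
\<close>
lemma wing_in_intersection:
  assumes c: "c \<in> C" "d \<in> C" "i \<in> I" and e: "e \<in> wing i c" "e \<in> wing i d"
  obtains r where "r \<in> C" "wing i r \<subseteq> wing i c" "wing i r \<subseteq> wing i d"
proof -
  obtain j where j: "j \<in> I" "m i j = \<infinity>" using neighbour c by blast
  then have ij: "j \<noteq> i" "m i j \<noteq> 2" using diagonal c by force+
  have eC: "e \<in> C" using e wing_in c by blast
  have inj: "y = z" if "y \<in> X j" "z \<in> X j" "mv e j y \<in> wall i b" "mv e j z \<in> wall i b" "b \<in> C" for b y z
    using wall_col[OF that(3,5) j(1) ij] wall_col[OF that(4,5) j(1) ij] cl_mv[OF eC j(1)] that by simp
  have "\<exists>y\<in>X j. mv e j y \<notin> wall i c \<and> mv e j y \<notin> wall i d"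
  proof -
    obtain y1 where y1: "y1 \<in> X j" using colours3 j by blast
    obtain y2 where y2: "y2 \<in> X j" "y2 \<noteq> y1" using colours3[OF j(1)] by metis
    obtain y3 where y3: "y3 \<in> X j" "y3 \<noteq> y1" "y3 \<noteq> y2" using colours3[OF j(1)] by metis
    show ?thesis using inj c y1 y2 y3 by metis
  qed
  then obtain y where y: "y \<in> X j" "mv e j y \<notin> wall i c" "mv e j y \<notin> wall i d" by blast
  define f where "f = mv e j y"
  have f: "f \<in> C" "f \<in> wing i c" "f \<in> wing i d" "f \<notin> wall i c" "f \<notin> wall i d"
    using mv_in eC j y wing.step[OF _ j(1)] e ij by (auto simp: f_def)
  have inj2: "x = z" if "x \<in> X i" "z \<in> X i" "wing i (mv f i x) \<inter> wall i b \<noteq> {}"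
    "wing i (mv f i z) \<inter> wall i b \<noteq> {}" "b \<in> C" "f \<notin> wall i b" for b x z
  proof (rule ccontr)
    assume "x \<noteq> z"
    have ne: "wall i b \<noteq> wall i (mv f i t)" if "t \<in> X i" for t
      using wall_mv[OF f(1) c(3) that] wall.base[of f i] \<open>f \<notin> wall i b\<close> by metis
    have "wall i b \<subseteq> wing i (mv f i x)" "wall i b \<subseteq> wing i (mv f i z)"
      using wall_subset_wing[OF \<open>b \<in> C\<close>] ne that mv_in[OF f(1) c(3)] by blast+
    then show False using wing_disjoint'[OF f(1) c(3) that(1,2) \<open>x \<noteq> z\<close>] wall.base by blast
  qed
  have "\<exists>x\<in>X i. wing i (mv f i x) \<inter> wall i c = {} \<and> wing i (mv f i x) \<inter> wall i d = {}"
  proof -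
    obtain y1 where y1: "y1 \<in> X i" using colours3 c by blast
    obtain y2 where y2: "y2 \<in> X i" "y2 \<noteq> y1" using colours3[OF c(3)] by metis
    obtain y3 where y3: "y3 \<in> X i" "y3 \<noteq> y1" "y3 \<noteq> y2" using colours3[OF c(3)] by metis
    show ?thesis using inj2[OF _ _ _ _ c(1) f(4)] inj2[OF _ _ _ _ c(2) f(5)] y1 y2 y3 by metis
  qed
  then obtain x where x: "x \<in> X i" "wing i (mv f i x) \<inter> wall i c = {}" "wing i (mv f i x) \<inter> wall i d = {}"
    by blast
  have "mv f i x \<in> wing i c" "mv f i x \<in> wing i d" using wing.step[OF _ c(3)] f x by blast+
  then show ?thesis using that[of "mv f i x"] wing_subset x c f mv_in by metis
qed

text \<open>
  Steps of types \<open>i, j, i, j, i\<close> that all change the colour give a chain of nested wings. With three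
  colours in each panel this is possible for any prescribed colours at the end; fewer steps would
  not do if \<open>c\<close> already has the prescribed colours.
\<close>
lemma wing_contains_wing_across_edge:
  assumes c: "c \<in> C" "i \<in> I" "j \<in> I" "m i j = \<infinity>" and t: "s \<in> X i" "t \<in> X j"
  shows "\<exists>e\<in>C. wing i e \<subseteq> wing j c \<and> col i e = s \<and> col j e = t \<and> (\<forall>k\<in>I. k \<noteq> i \<longrightarrow> k \<noteq> j \<longrightarrow> col k e = col k c)"
proof -
  have ij: "i \<noteq> j" "m j i = \<infinity>" using c symmetric diagonal by force+
  obtain x1 where x1: "x1 \<in> X i" "x1 \<noteq> col i c" using colours3 c by metis
  obtain y1 where y1: "y1 \<in> X j" "y1 \<noteq> col j c" "y1 \<noteq> t" using colours3 c by metis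
  obtain x2 where x2: "x2 \<in> X i" "x2 \<noteq> x1" "x2 \<noteq> s" using colours3 c by metis
  define c1 where "c1 = mv c i x1"
  define c2 where "c2 = mv c1 j y1"
  define c3 where "c3 = mv c2 i x2"
  define c4 where "c4 = mv c3 j t"
  define c5 where "c5 = mv c4 i s"
  have C1: "c1 \<in> C" "col i c1 = x1" "\<And>k. k \<in> I \<Longrightarrow> k \<noteq> i \<Longrightarrow> col k c1 = col k c"
    using c x1 by (auto simp: c1_def mv_in cl_mv cl_mv_other)
  have C2: "c2 \<in> C" "col j c2 = y1" "\<And>k. k \<in> I \<Longrightarrow> k \<noteq> j \<Longrightarrow> col k c2 = col k c1"
    using c C1 y1 by (auto simp: c2_def mv_in cl_mv cl_mv_other)
  have C3: "c3 \<in> C" "col i c3 = x2" "\<And>k. k \<in> I \<Longrightarrow> k \<noteq> i \<Longrightarrow> col k c3 = col k c2"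
    using c C2 x2 by (auto simp: c3_def mv_in cl_mv cl_mv_other)
  have C4: "c4 \<in> C" "col j c4 = t" "\<And>k. k \<in> I \<Longrightarrow> k \<noteq> j \<Longrightarrow> col k c4 = col k c3"
    using c C3 t by (auto simp: c4_def mv_in cl_mv cl_mv_other)
  have C5: "c5 \<in> C" "col i c5 = s" "\<And>k. k \<in> I \<Longrightarrow> k \<noteq> i \<Longrightarrow> col k c5 = col k c4"
    using c C4 t by (auto simp: c5_def mv_in cl_mv cl_mv_other)
  have "wing i c5 \<subseteq> wing j c4" unfolding c5_def
    by (rule wing_nest) (use c C4 C3 x2 t ij in auto)
  also have "\<dots> \<subseteq> wing i c3" unfolding c4_def
    by (rule wing_nest) (use c C3 C2 y1 t ij in auto)
  also have "\<dots> \<subseteq> wing j c2" unfolding c3_def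
    by (rule wing_nest) (use c C2 C1 x2 t ij in auto)
  also have "\<dots> \<subseteq> wing i c1" unfolding c2_def
    by (rule wing_nest) (use c C1 y1 t ij in auto)
  also have "\<dots> \<subseteq> wing j c" unfolding c1_def
    by (rule wing_nest) (use c x1 t ij in auto)
  finally show ?thesis using C1 C2 C3 C4 C5 c ij by (intro bexI[of _ c5]) auto
qed

text \<open>
  Nested wings are followed along paths in the connected diagram. Each passage through an edge
  leaves the colours of its ends as prescribed and does not touch the others, so the colours can be
  corrected one type after the other.
\<close>
lemma wing_contains_prescribed_wing:
  assumes c: "c \<in> C" "l \<in> I" "k \<in> I" and \<tau>: "\<And>h. h \<in> I \<Longrightarrow> \<tau> h \<in> X h"
  obtains r where "r \<in> C" "wing k r \<subseteq> wing l c" "\<And>h. h \<in> I \<Longrightarrow> col h r = \<tau> h"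
proof -
  define ok where "ok e e' \<longleftrightarrow> (\<forall>h\<in>I. col h e = \<tau> h \<longrightarrow> col h e' = \<tau> h)" for e e'
  have edge: "\<exists>e\<in>C. wing i e \<subseteq> wing j c \<and> ok c e \<and> col i e = \<tau> i" if "c \<in> C" "(j, i) \<in> diagram I m" for c i j
  proof -
    have ij: "i \<in> I" "j \<in> I" "m i j = \<infinity>" using that symmetric by (auto simp: diagram_def)
    show ?thesis using wing_contains_wing_across_edge[OF that(1) ij \<tau> \<tau>] ij unfolding ok_def by metis
  qed
  have path: "\<exists>e\<in>C. wing i e \<subseteq> wing j c \<and> ok c e" if "c \<in> C" "(j, i) \<in> (diagram I m)\<^sup>*" for c i j
    using that(2)
  proof (induction rule: rtrancl_induct)
    case base
    then show ?case using that unfolding ok_def by blast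
  next
    case (step i i')
    then obtain e where e: "e \<in> C" "wing i e \<subseteq> wing j c" "ok c e" by blast
    obtain e' where "e' \<in> C" "wing i' e' \<subseteq> wing i e" "ok e e'" using edge[OF e(1) step(2)] by blast
    then show ?case using e unfolding ok_def by blast
  qed
  have conn: "(i, j) \<in> (diagram I m)\<^sup>*" if "i \<in> I" "j \<in> I" for i j
    using that irreducible unfolding irreducible_type_def by blast
  have visit: "\<exists>e\<in>C. wing i e \<subseteq> wing j c \<and> ok c e \<and> col i e = \<tau> i" if c: "c \<in> C" "i \<in> I" "j \<in> I" for c i j
  proof -
    obtain n where n: "n \<in> I" "m i n = \<infinity>" using neighbour c(2) by blast
    then have d: "(n, i) \<in> diagram I m" using symmetric c by (auto simp: diagram_def)
    obtain e where e: "e \<in> C" "wing n e \<subseteq> wing j c" "ok c e" using path[OF c(1) conn[OF c(3) n(1)]] by blast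
    obtain e' where "e' \<in> C" "wing i e' \<subseteq> wing n e" "ok e e'" "col i e' = \<tau> i" using edge[OF e(1) d] by blast
    then show ?thesis using e unfolding ok_def by blast
  qed
  have all: "\<exists>e\<in>C. \<exists>j\<in>I. wing j e \<subseteq> wing l c \<and> (\<forall>h\<in>K. col h e = \<tau> h)" if "finite K" "K \<subseteq> I" for K
    using that
  proof (induction rule: finite_induct)
    case empty
    then show ?case using c by blast
  next
    case (insert i K)
    then obtain e j where e: "e \<in> C" "j \<in> I" "wing j e \<subseteq> wing l c" "\<forall>h\<in>K. col h e = \<tau> h" by blast
    obtain e' where "e' \<in> C" "wing i e' \<subseteq> wing j e" "ok e e'" "col i e' = \<tau> i"
      using visit[OF e(1) _ e(2), of i] insert.prems by blast
    then show ?case using e insert.prems unfolding ok_def by blast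
  qed
  obtain e j where e: "e \<in> C" "j \<in> I" "wing j e \<subseteq> wing l c" "\<forall>h\<in>I. col h e = \<tau> h"
    using all[OF finite_index] by blast
  obtain r where "r \<in> C" "wing k r \<subseteq> wing j e" "ok e r" using visit[OF e(1) c(3) e(2)] by blast
  then show ?thesis using that e unfolding ok_def by (metis subset_trans)
qed

end

section \<open>Universal groups\<close>

locale universal_building = thick_irreducible_building I m C adj \<delta> X col
  for I :: "'i set" and m :: "'i \<Rightarrow> 'i \<Rightarrow> enat" and C :: "'c set"
    and adj :: "'i \<Rightarrow> ('c \<times> 'c) set" and \<delta> :: "'c \<Rightarrow> 'c \<Rightarrow> 'i list set"
    and X :: "'i \<Rightarrow> 'x set" and col :: "'i \<Rightarrow> 'c \<Rightarrow> 'x" +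
  fixes F :: "'i \<Rightarrow> ('x \<Rightarrow> 'x) set"
  assumes F_subgroup: "\<And>i. i \<in> I \<Longrightarrow> subgroup (F i) (BijGroup (X i))"
begin

lemma F_Bij: "i \<in> I \<Longrightarrow> f \<in> F i \<Longrightarrow> f \<in> Bij (X i)"
  using subgroup.subset[OF F_subgroup] by (auto simp: BijGroup_def)

lemma F_in: "i \<in> I \<Longrightarrow> f \<in> F i \<Longrightarrow> x \<in> X i \<Longrightarrow> f x \<in> X i"
  using F_Bij Bij_imp_funcset by blast

lemma F_id: "i \<in> I \<Longrightarrow> (\<lambda>x\<in>X i. x) \<in> F i"
  using subgroup.one_closed[OF F_subgroup] by (simp add: BijGroup_def)

lemma F_compose: "i \<in> I \<Longrightarrow> f \<in> F i \<Longrightarrow> g \<in> F i \<Longrightarrow> compose (X i) f g \<in> F i"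
  using subgroup.m_closed[OF F_subgroup, of i f g] F_Bij[of i f] F_Bij[of i g] by (simp add: BijGroup_def)

lemma F_inverse:
  assumes "i \<in> I" "f \<in> F i"
  obtains f' where "f' \<in> F i" "\<And>x. x \<in> X i \<Longrightarrow> f' (f x) = x" "\<And>x. x \<in> X i \<Longrightarrow> f (f' x) = x"
proof -
  have f: "f \<in> Bij (X i)" using F_Bij assms by blast
  then have "restrict (inv_into (X i) f) (X i) \<in> F i"
    using subgroup.m_inv_closed[OF F_subgroup[OF assms(1)] assms(2)] inv_BijGroup by metis
  moreover have "bij_betw f (X i) (X i)" using f by (simp add: Bij_def)
  ultimately show ?thesis using that[of "restrict (inv_into (X i) f) (X i)"] F_in assms
    by (auto simp: bij_betw_inv_into_left bij_betw_inv_into_right)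
qed

definition aut :: "('c \<Rightarrow> 'c) set" where "aut = building_aut I C adj"

text \<open>
  The local action at the \<open>i\<close>-panel of the chamber \<open>e\<close>.
\<close>
definition loc :: "('c \<Rightarrow> 'c) \<Rightarrow> 'i \<Rightarrow> 'c \<Rightarrow> 'x \<Rightarrow> 'x"
  where "loc g i e = (\<lambda>x\<in>X i. col i (g (mv e i x)))"

abbreviation G :: "('c \<Rightarrow> 'c) monoid" where "G \<equiv> universal_group I C adj X col F"
abbreviation U :: "('c \<Rightarrow> 'c) set" where "U \<equiv> carrier G"

lemma aut_Bij: "g \<in> aut \<Longrightarrow> g \<in> Bij C"
  by (simp add: aut_def building_aut_def)

lemma aut_in: "g \<in> aut \<Longrightarrow> e \<in> C \<Longrightarrow> g e \<in> C"
  using aut_Bij Bij_imp_funcset by blast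

lemma aut_inj: "g \<in> aut \<Longrightarrow> e \<in> C \<Longrightarrow> d \<in> C \<Longrightarrow> g e = g d \<longleftrightarrow> e = d"
  using aut_Bij[of g] unfolding Bij_def bij_betw_def by (auto dest: inj_onD)

lemma aut_surj: "g \<in> aut \<Longrightarrow> e \<in> C \<Longrightarrow> \<exists>d\<in>C. g d = e"
  using aut_Bij[of g] bij_betw_imp_surj_on[of g C C] unfolding Bij_def by (metis (no_types) IntD2 imageE mem_Collect_eq)

lemma aut_adj: "g \<in> aut \<Longrightarrow> i \<in> I \<Longrightarrow> c \<in> C \<Longrightarrow> d \<in> C \<Longrightarrow> (g c, g d) \<in> adj i \<longleftrightarrow> (c, d) \<in> adj i"
  by (auto simp: aut_def building_aut_def)

lemma adj_mv: "c \<in> C \<Longrightarrow> i \<in> I \<Longrightarrow> x \<in> X i \<Longrightarrow> (c, mv c i x) \<in> adj i"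
  using mv_props by blast

lemma loc_apply: "x \<in> X i \<Longrightarrow> loc g i e x = col i (g (mv e i x))"
  by (simp add: loc_def)

lemma aut_mv: "g \<in> aut \<Longrightarrow> e \<in> C \<Longrightarrow> i \<in> I \<Longrightarrow> x \<in> X i \<Longrightarrow> g (mv e i x) = mv (g e) i (loc g i e x)"
  using mv_eqI[of i "g e" "g (mv e i x)" "loc g i e x"] adj_mv aut_adj mv_in loc_apply by metis

lemma loc_in: "g \<in> aut \<Longrightarrow> e \<in> C \<Longrightarrow> i \<in> I \<Longrightarrow> x \<in> X i \<Longrightarrow> loc g i e x \<in> X i"
  by (simp add: loc_apply cl_in aut_in mv_in)

lemma local_action_loc:
  assumes "e \<in> C" "i \<in> I"
  shows "local_action X col g i (adj i `` {e}) = loc g i e"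
  unfolding local_action_def loc_def
proof (rule restrict_ext)
  fix x assume x: "x \<in> X i"
  have "inv_into (adj i `` {e}) (col i) x = mv e i x"
  proof (rule inv_into_f_eq)
    show "inj_on (col i) (adj i `` {e})" using col_bij[OF assms(2,1)] bij_betw_imp_inj_on by blast
  qed (use adj_mv cl_mv assms x in auto)
  then show "col i (g (inv_into (adj i `` {e}) (col i) x)) = col i (g (mv e i x))" by simp
qed

lemma U_iff: "g \<in> U \<longleftrightarrow> g \<in> aut \<and> (\<forall>i\<in>I. \<forall>e\<in>C. loc g i e \<in> F i)"
proof -
  have "(\<forall>P\<in>panels C adj i. local_action X col g i P \<in> F i) \<longleftrightarrow> (\<forall>e\<in>C. loc g i e \<in> F i)" if "i \<in> I" for i
    unfolding panels_def quotient_def using local_action_loc[OF _ that] by auto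
  then show ?thesis unfolding universal_group_def aut_def by auto
qed

lemma U_aut: "g \<in> U \<Longrightarrow> g \<in> aut" and U_loc: "g \<in> U \<Longrightarrow> i \<in> I \<Longrightarrow> e \<in> C \<Longrightarrow> loc g i e \<in> F i"
  by (simp_all add: U_iff)

lemma aut_compose: "g \<in> aut \<Longrightarrow> h \<in> aut \<Longrightarrow> compose C g h \<in> aut"
  using aut_in[of h] by (auto simp: aut_def building_aut_def compose_Bij) (auto simp: compose_def)

lemma aut_inverse: "g \<in> aut \<Longrightarrow> restrict (inv_into C g) C \<in> aut"
proof -
  assume g: "g \<in> aut"
  let ?h = "restrict (inv_into C g) C"
  have h: "?h \<in> Bij C" using restrict_inv_into_Bij aut_Bij g by blast
  have gh: "?h e \<in> C" "g (?h e) = e" if "e \<in> C" for e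
    using funcset_mem[OF Bij_imp_funcset[OF h] that] that aut_Bij[OF g]
    by (simp_all add: Bij_def bij_betw_inv_into_right[of g C C])
  have "(c, d) \<in> adj i \<longleftrightarrow> (?h c, ?h d) \<in> adj i" if "i \<in> I" "c \<in> C" "d \<in> C" for c d i
    using aut_adj[OF g that(1) gh(1)[OF that(2)] gh(1)[OF that(3)]] gh(2) that by simp
  then show ?thesis using h by (auto simp: aut_def building_aut_def)
qed

lemma loc_compose:
  assumes "g \<in> aut" "h \<in> aut" "i \<in> I" "e \<in> C"
  shows "loc (compose C g h) i e = compose (X i) (loc g i (h e)) (loc h i e)"
  unfolding compose_def[of "X i"] loc_def[of "compose C g h"]
  by (rule restrict_ext)
    (use assms loc_in in \<open>simp add: compose_def mv_in aut_mv[of h] loc_apply[of _ i g]\<close>)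

lemma U_subgroup: "subgroup U (BijGroup C)"
proof (rule group.subgroupI[OF group_BijGroup])
  show "U \<subseteq> carrier (BijGroup C)" using U_aut aut_Bij by (auto simp: BijGroup_def)
  have id: "(\<lambda>e\<in>C. e) \<in> U"
  proof -
    have "loc (\<lambda>e\<in>C. e) i e = (\<lambda>x\<in>X i. x)" if "i \<in> I" "e \<in> C" for i e
      unfolding loc_def by (rule restrict_ext) (use that mv_in cl_mv in simp)
    then show ?thesis using F_id by (auto simp: U_iff aut_def building_aut_def id_Bij)
  qed
  then show "U \<noteq> {}" by blast
  fix g assume g: "g \<in> U"
  let ?h = "restrict (inv_into C g) C"
  have ga: "g \<in> aut" and h: "?h \<in> aut" using g U_aut aut_inverse by blast+
  have gh: "g (?h e) = e" if "e \<in> C" for e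
    using that aut_Bij[OF ga] by (simp add: Bij_def bij_betw_inv_into_right[of g C C])
  have "loc ?h i e \<in> F i" if i: "i \<in> I" "e \<in> C" for i e
  proof -
    let ?d = "?h e"
    have d: "?d \<in> C" using aut_in h i by blast
    obtain f where f: "f \<in> F i" "\<And>x. x \<in> X i \<Longrightarrow> f (loc g i ?d x) = x"
      using F_inverse U_loc[OF g i(1) d] i(1) by metis
    have "loc ?h i e = f"
    proof (rule extensionalityI)
      show "loc ?h i e \<in> extensional (X i)" by (simp add: loc_def)
      show "f \<in> extensional (X i)" using F_Bij[OF i(1) f(1)] by (simp add: Bij_def)
      fix x assume x: "x \<in> X i"
      have hx: "?h (mv e i x) = mv ?d i (loc ?h i e x)" using aut_mv h i x by blast
      have "mv e i x = g (mv ?d i (loc ?h i e x))" using gh[OF mv_in[OF i(2,1) x]] hx by metis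
      then have "loc g i ?d (loc ?h i e x) = x"
        using loc_apply[OF loc_in[OF h i(2,1) x], of g ?d] cl_mv[OF i(2,1) x] by metis
      then show "loc ?h i e x = f x" using f(2)[OF loc_in[OF h i(2,1) x]] by simp
    qed
    then show ?thesis using f by simp
  qed
  then show "inv\<^bsub>BijGroup C\<^esub> g \<in> U"
    using h inv_BijGroup[OF aut_Bij[OF ga]] by (simp add: U_iff)
  fix g' assume g': "g' \<in> U"
  then have a': "g' \<in> aut" by (rule U_aut)
  have "compose C g g' \<in> U"
    unfolding U_iff using aut_compose[OF ga a'] loc_compose[OF ga a'] U_loc g g' F_compose aut_in a' by simp
  then show "g \<otimes>\<^bsub>BijGroup C\<^esub> g' \<in> U" using aut_Bij ga a' by (simp add: BijGroup_def)
qed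

sublocale G: group G
proof -
  have "group ((BijGroup C)\<lparr>carrier := U\<rparr>)"
    by (rule subgroup.subgroup_is_group[OF U_subgroup group_BijGroup])
  then show "group G" by (simp add: universal_group_def)
qed

lemma U_in: "g \<in> U \<Longrightarrow> e \<in> C \<Longrightarrow> g e \<in> C"
  using U_aut aut_in by blast

lemma U_inj: "g \<in> U \<Longrightarrow> e \<in> C \<Longrightarrow> d \<in> C \<Longrightarrow> g e = g d \<longleftrightarrow> e = d"
  using U_aut aut_inj by blast

lemma U_mv: "g \<in> U \<Longrightarrow> e \<in> C \<Longrightarrow> i \<in> I \<Longrightarrow> x \<in> X i \<Longrightarrow> g (mv e i x) = mv (g e) i (loc g i e x)"
  using U_aut aut_mv by blast

lemma U_eqI: "g \<in> U \<Longrightarrow> h \<in> U \<Longrightarrow> (\<And>e. e \<in> C \<Longrightarrow> g e = h e) \<Longrightarrow> g = h"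
  by (rule extensionalityI[of g C h]) (simp_all add: Bij_imp_extensional aut_Bij U_aut)

lemma mult_apply [simp]: "g \<in> U \<Longrightarrow> h \<in> U \<Longrightarrow> e \<in> C \<Longrightarrow> (g \<otimes>\<^bsub>G\<^esub> h) e = g (h e)"
proof -
  assume a: "g \<in> U" "h \<in> U" "e \<in> C"
  then have "g \<in> Bij C" "h \<in> Bij C" using U_aut aut_Bij by blast+
  moreover have "g \<otimes>\<^bsub>G\<^esub> h = g \<otimes>\<^bsub>BijGroup C\<^esub> h" by (simp add: universal_group_def)
  ultimately show ?thesis using a(3) by (simp add: BijGroup_def compose_def)
qed

lemma one_apply [simp]: "e \<in> C \<Longrightarrow> \<one>\<^bsub>G\<^esub> e = e"
  by (simp add: universal_group_def BijGroup_def)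

lemma inv_apply [simp]: "g \<in> U \<Longrightarrow> e \<in> C \<Longrightarrow> (inv\<^bsub>G\<^esub> g) (g e) = e"
  "g \<in> U \<Longrightarrow> e \<in> C \<Longrightarrow> g ((inv\<^bsub>G\<^esub> g) e) = e"
  using mult_apply[of "inv\<^bsub>G\<^esub> g" g e] mult_apply[of g "inv\<^bsub>G\<^esub> g" e] by simp_all

lemma inv_in: "g \<in> U \<Longrightarrow> e \<in> C \<Longrightarrow> (inv\<^bsub>G\<^esub> g) e \<in> C"
  using U_in by simp

lemma loc_mult:
  assumes "g \<in> U" "h \<in> U" "i \<in> I" "e \<in> C" "x \<in> X i"
  shows "loc (g \<otimes>\<^bsub>G\<^esub> h) i e x = loc g i (h e) (loc h i e x)"
  using assms U_aut loc_in by (simp add: loc_apply[of _ i "g \<otimes>\<^bsub>G\<^esub> h"] mv_in U_mv[of h] loc_apply[of _ i g])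

text \<open>
  The universal group is closed under patching: the defining conditions concern one panel at a time.
\<close>
lemma local_criterion:
  assumes ext: "g \<in> extensional C" and bij: "bij_betw g C C"
    and l: "\<And>i e. i \<in> I \<Longrightarrow> e \<in> C \<Longrightarrow> \<exists>u\<in>U. \<forall>x\<in>X i. g (mv e i x) = u (mv e i x)"
  shows "g \<in> U"
proof -
  have B: "g \<in> Bij C" using ext bij by (simp add: Bij_def)
  have "(c, d) \<in> adj i \<longleftrightarrow> (g c, g d) \<in> adj i" if i: "i \<in> I" "c \<in> C" "d \<in> C" for i c d
  proof -
    obtain u where u: "u \<in> U" "\<forall>x\<in>X i. g (mv c i x) = u (mv c i x)" using l i by blast
    have gc: "g c = u c" using u(2) mv_cl cl_in i by metis
    have fw: "g e = u e" if "(c, e) \<in> adj i" for e using that u(2) adj_iff_mv[OF i(1,2), of e] by auto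
    show ?thesis
    proof
      assume "(c, d) \<in> adj i"
      then show "(g c, g d) \<in> adj i" using gc fw aut_adj U_aut u i by metis
    next
      assume a: "(g c, g d) \<in> adj i"
      obtain e where e: "e \<in> C" "u e = g d"
        using aut_surj[OF U_aut[OF u(1)]] Bij_imp_funcset[OF B] i by blast
      then have "(c, e) \<in> adj i" using a gc aut_adj[OF U_aut[OF u(1)] i(1,2) e(1)] by simp
      moreover from this have "g e = g d" using fw e by simp
      ultimately show "(c, d) \<in> adj i" using bij e i unfolding bij_betw_def by (auto dest: inj_onD)
    qed
  qed
  then have "g \<in> aut" using B unfolding aut_def building_aut_def by blast
  moreover have "loc g i e \<in> F i" if ie: "i \<in> I" "e \<in> C" for i e
  proof -
    obtain u where u: "u \<in> U" "\<forall>x\<in>X i. g (mv e i x) = u (mv e i x)" using l ie by blast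
    then have "loc g i e = loc u i e" unfolding loc_def by (intro restrict_ext) simp
    then show ?thesis using U_loc u ie by simp
  qed
  ultimately show ?thesis by (simp add: U_iff)
qed

text \<open>
  The universal property is applied to \<open>\<mu>\<close> and to \<open>col\<close>; the two resulting maps are inverse to each
  other.
\<close>
lemma exists_automorphism:
  assumes \<mu>: "legal_colouring I C adj X \<mu>" and c0: "c0 \<in> C" and d0: "d0 \<in> C"
    and eq: "\<And>k. k \<in> I \<Longrightarrow> col k d0 = \<mu> k c0"
  obtains g where "g \<in> aut" "g c0 = d0" "\<And>e k. e \<in> C \<Longrightarrow> k \<in> I \<Longrightarrow> col k (g e) = \<mu> k e"
proof -
  interpret M: coloured_building I m C adj \<delta> X \<mu> by unfold_locales (rule \<mu>)
  obtain \<phi> where \<phi>: "\<phi> c0 = d0" "\<And>e. e \<in> C \<Longrightarrow> \<phi> e \<in> C"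
    "\<And>e k. e \<in> C \<Longrightarrow> k \<in> I \<Longrightarrow> col k (\<phi> e) = \<mu> k e"
    "\<And>e i x. e \<in> C \<Longrightarrow> i \<in> I \<Longrightarrow> x \<in> X i \<Longrightarrow> \<phi> (M.mv e i x) = mv (\<phi> e) i x"
    by (rule M.universal_property[OF chamber_act_axioms c0 d0 eq]) blast+
  obtain \<psi> where \<psi>: "\<psi> d0 = c0" "\<And>e. e \<in> C \<Longrightarrow> \<psi> e \<in> C"
    "\<And>e k. e \<in> C \<Longrightarrow> k \<in> I \<Longrightarrow> \<mu> k (\<psi> e) = col k e"
    "\<And>e i x. e \<in> C \<Longrightarrow> i \<in> I \<Longrightarrow> x \<in> X i \<Longrightarrow> \<psi> (mv e i x) = M.mv (\<psi> e) i x"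
    by (rule universal_property[OF M.chamber_act_axioms d0 c0 eq[symmetric]]) blast+
  have 1: "\<psi> (\<phi> e) = e" if "e \<in> C" for e
    using c0 that by (induction rule: M.chamber_induct) (simp_all add: \<phi> \<psi>)
  have 2: "\<phi> (\<psi> e) = e" if "e \<in> C" for e
    using d0 that by (induction rule: chamber_induct) (simp_all add: \<phi> \<psi>)
  define g where "g = restrict \<phi> C"
  have bij: "bij_betw g C C"
    by (rule bij_betw_byWitness[where f' = \<psi>]) (use 1 2 \<phi> \<psi> in \<open>auto simp: g_def\<close>)
  have "(c, d) \<in> adj i \<longleftrightarrow> (g c, g d) \<in> adj i" if i: "i \<in> I" "c \<in> C" "d \<in> C" for i c d
  proof
    assume "(c, d) \<in> adj i"
    then obtain x where "x \<in> X i" "d = M.mv c i x" using M.adj_iff_mv i by blast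
    then have "g d = mv (g c) i x" using \<phi> i by (simp add: g_def)
    then show "(g c, g d) \<in> adj i" using adj_mv \<open>x \<in> X i\<close> i \<phi> by (simp add: g_def)
  next
    assume "(g c, g d) \<in> adj i"
    then have "(\<phi> c, \<phi> d) \<in> adj i" using i by (simp add: g_def)
    then obtain x where x: "x \<in> X i" "\<phi> d = mv (\<phi> c) i x" using adj_iff_mv i \<phi>(2) by metis
    then have "d = M.mv c i x" using 1 \<psi>(4) \<phi>(2) i by metis
    then show "(c, d) \<in> adj i" using M.mv_props i x by blast
  qed
  moreover have "g \<in> Bij C" using bij by (simp add: Bij_def g_def)
  ultimately have "g \<in> aut" unfolding aut_def building_aut_def by blast
  then show ?thesis using that[of g] \<phi> c0 by (simp add: g_def)
qed

text \<open>
  The hypotheses say that \<open>s k e (col k e)\<close> defines a legal colouring: on a panel the local action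
  does not depend on the chamber, and across a step of another type it agrees at the common colour.
\<close>
lemma exists_with_local_actions:
  assumes s: "\<And>i e. i \<in> I \<Longrightarrow> e \<in> C \<Longrightarrow> s i e \<in> F i"
    and s1: "\<And>i e x. i \<in> I \<Longrightarrow> e \<in> C \<Longrightarrow> x \<in> X i \<Longrightarrow> s i (mv e i x) = s i e"
    and s2: "\<And>i e j y. i \<in> I \<Longrightarrow> j \<in> I \<Longrightarrow> j \<noteq> i \<Longrightarrow> e \<in> C \<Longrightarrow> y \<in> X j \<Longrightarrow> s i (mv e j y) (col i e) = s i e (col i e)"
    and c0: "c0 \<in> C" and d0: "d0 \<in> C" and eq: "\<And>k. k \<in> I \<Longrightarrow> col k d0 = s k c0 (col k c0)"
  obtains g where "g \<in> U" "g c0 = d0" "\<And>e k. e \<in> C \<Longrightarrow> k \<in> I \<Longrightarrow> col k (g e) = s k e (col k e)"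
proof -
  define \<mu> where "\<mu> k e = s k e (col k e)" for k e
  have "legal_colouring I C adj X \<mu>"
    unfolding legal_colouring_def
  proof (intro conjI ballI impI)
    show "\<mu> i c \<in> X i" if "i \<in> I" "c \<in> C" for i c using that s F_in cl_in by (simp add: \<mu>_def)
  next
    fix i P assume i: "i \<in> I" and "P \<in> panels C adj i"
    then obtain e where e: "e \<in> C" "P = adj i `` {e}" unfolding panels_def by (auto elim: quotientE)
    have P: "d \<in> P \<longleftrightarrow> (\<exists>x\<in>X i. d = mv e i x)" for d using adj_iff_mv[OF i e(1)] e by simp
    have "bij_betw (s i e \<circ> col i) P (X i)"
      using col_bij[OF i e(1)] F_Bij[OF i s[OF i e(1)]] bij_betw_trans unfolding e(2) Bij_def by blast
    then show "bij_betw (\<mu> i) P (X i)"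
      by (rule iffD1[OF bij_betw_cong, rotated]) (use P s1 i e in \<open>auto simp: \<mu>_def\<close>)
    fix j c d assume j: "j \<in> I" "j \<noteq> i" and cd: "c \<in> P" "d \<in> P"
    have "\<mu> j f = \<mu> j e" if "f \<in> P" for f
      using that P s2[OF j(1) i j(2)[symmetric] e(1)] cl_mv_other[OF e(1) i _ j] by (auto simp: \<mu>_def)
    then show "\<mu> j c = \<mu> j d" using cd by simp
  qed
  then obtain g where g: "g \<in> aut" "g c0 = d0" "\<And>e k. e \<in> C \<Longrightarrow> k \<in> I \<Longrightarrow> col k (g e) = \<mu> k e"
    by (rule exists_automorphism[OF _ c0 d0]) (use eq \<mu>_def in auto)
  have "loc g i e \<in> F i" if i: "i \<in> I" "e \<in> C" for i e
  proof -
    have "loc g i e = s i e"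
    proof (rule extensionalityI)
      show "loc g i e \<in> extensional (X i)" by (simp add: loc_def)
      show "s i e \<in> extensional (X i)" using F_Bij[OF i(1) s[OF i]] by (simp add: Bij_def)
      fix x assume x: "x \<in> X i"
      show "loc g i e x = s i e x"
        using g(3)[OF mv_in[OF i(2,1) x] i(1)] x i by (simp add: loc_apply \<mu>_def s1 cl_mv)
    qed
    then show ?thesis using s i by simp
  qed
  then have "g \<in> U" using g by (simp add: U_iff)
  then show ?thesis using that g by (simp add: \<mu>_def)
qed

lemma exists_homogeneous:
  assumes f: "\<And>i. i \<in> I \<Longrightarrow> f i \<in> F i" and c: "c \<in> C" "d \<in> C" and eq: "\<And>k. k \<in> I \<Longrightarrow> col k d = f k (col k c)"
  obtains g where "g \<in> U" "g c = d" "\<And>e k. e \<in> C \<Longrightarrow> k \<in> I \<Longrightarrow> col k (g e) = f k (col k e)"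
  by (rule exists_with_local_actions[of "\<lambda>i e. f i" c d]) (use assms in auto)

lemma exists_translation:
  assumes c: "c \<in> C" "d \<in> C" and eq: "\<And>k. k \<in> I \<Longrightarrow> col k d = col k c"
  obtains g where "g \<in> U" "g c = d" "\<And>e k. e \<in> C \<Longrightarrow> k \<in> I \<Longrightarrow> col k (g e) = col k e"
  by (rule exists_homogeneous[of "\<lambda>i. \<lambda>x\<in>X i. x" c d]) (use assms F_id cl_in in auto)

lemma U_fix_mv: "g \<in> U \<Longrightarrow> e \<in> C \<Longrightarrow> i \<in> I \<Longrightarrow> x \<in> X i \<Longrightarrow> g e = e \<Longrightarrow> col i (g (mv e i x)) = x
    \<Longrightarrow> g (mv e i x) = mv e i x"
  using U_mv[of g e i x] loc_apply[of x i g e] by metis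

lemma U_wall_imp: "e \<in> wall i c \<Longrightarrow> g \<in> U \<Longrightarrow> c \<in> C \<Longrightarrow> i \<in> I \<Longrightarrow> g e \<in> wall i (g c)"
proof (induction rule: wall.induct)
  case (step e j x)
  have e: "e \<in> C" using wall_in step by blast
  show ?case unfolding U_mv[OF step.prems(1) e step.hyps(2,4)]
    by (rule wall.step) (use step loc_in U_aut e in auto)
qed (rule wall.base)

lemma U_wall: "g \<in> U \<Longrightarrow> c \<in> C \<Longrightarrow> i \<in> I \<Longrightarrow> e \<in> C \<Longrightarrow> g e \<in> wall i (g c) \<longleftrightarrow> e \<in> wall i c"
  using U_wall_imp[of e i c g] U_wall_imp[of "g e" i "g c" "inv\<^bsub>G\<^esub> g"] U_in by auto

lemma U_wing_imp: "e \<in> wing i c \<Longrightarrow> g \<in> U \<Longrightarrow> c \<in> C \<Longrightarrow> i \<in> I \<Longrightarrow> g e \<in> wing i (g c)"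
proof (induction rule: wing.induct)
  case (step e j x)
  have e: "e \<in> C" using wing_in step by blast
  show ?case unfolding U_mv[OF step.prems(1) e step.hyps(2,4)]
    by (rule wing.step) (use step loc_in U_aut e U_wall in auto)
qed (rule wing.base)

lemma U_wing: "g \<in> U \<Longrightarrow> c \<in> C \<Longrightarrow> i \<in> I \<Longrightarrow> e \<in> C \<Longrightarrow> g e \<in> wing i (g c) \<longleftrightarrow> e \<in> wing i c"
  using U_wing_imp[of e i c g] U_wing_imp[of "g e" i "g c" "inv\<^bsub>G\<^esub> g"] U_in by auto

section \<open>Elements supported on a wing\<close>

text \<open>
  The panel of type \<open>k\<close> contains a chamber outside the wing, which is fixed. So \<open>a\<close> preserves this
  panel as well as the wing, and they have only \<open>e\<close> in common.
\<close>
lemma wing_panel_fixed: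
  assumes a: "a \<in> U" and c: "c \<in> C" "i \<in> I" and fx: "\<And>e. e \<in> C \<Longrightarrow> e \<notin> wing i c \<Longrightarrow> a e = e"
    and e: "e \<in> wing i c" "k \<in> I" and y: "y \<in> X k" "mv e k y \<notin> wing i c"
  shows "a e = e"
proof -
  have eC: "e \<in> C" using wing_in e c by blast
  let ?f = "mv e k y"
  have f: "?f \<in> C" "a ?f = ?f" using fx y mv_in eC e by blast+
  have ae: "a e \<in> wing i c"
    using fx[of "a e"] U_in a eC U_inj e by metis
  have "e = mv ?f k (col k e)" using mv_back eC e y by simp
  then have "a e = mv ?f k (loc a k ?f (col k e))"
    using U_mv[OF a f(1) e(2), of "col k e"] cl_in eC e f(2) by metis
  then have "a e = mv e k (loc a k ?f (col k e))"
    using mv_mv[OF eC e(2) y(1)] loc_in[OF U_aut[OF a] f(1) e(2)] cl_in eC e by simp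
  moreover have "loc a k ?f (col k e) \<in> X k" using loc_in[OF U_aut[OF a] f(1) e(2)] cl_in eC e by blast
  ultimately show ?thesis using wing_panel[OF c e] y ae by metis
qed

text \<open>
  The images of the wing under the powers of \<open>n\<close> are disjoint, since the \<open>k\<close>-th one lies in
  \<open>n\<^sup>k B - n\<^sup>k\<^sup>+\<^sup>1 B\<close>. So there is a bijection \<open>g\<close> that acts on the \<open>k\<close>-th image as \<open>n\<^sup>k a n\<^sup>-\<^sup>k\<close> and fixes
  all other chambers; it belongs to \<open>U\<close> because on each panel it agrees with one of these factors or
  with the identity. Conjugation by \<open>n\<close> removes the factor for \<open>k = 0\<close>, which is \<open>a\<close>, so that
  \<open>a\<close> is the commutator of \<open>g\<close> and \<open>n\<close>.
\<close>
lemma contracted_wing_group_in_normal: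
  assumes N: "N \<lhd> G" and n: "n \<in> N" and c: "c \<in> C" "i \<in> I" and B: "B \<subseteq> C" "n ` B \<subseteq> B"
    and A: "wing i c \<subseteq> B" "wing i c \<inter> n ` B = {}"
    and a: "a \<in> U" and fx: "\<And>e. e \<in> C \<Longrightarrow> e \<notin> wing i c \<Longrightarrow> a e = e"
  shows "a \<in> N"
proof -
  let ?A = "wing i c"
  have nU: "n \<in> U" using N n normal_imp_subgroup subgroup.subset by blast
  define pw where "pw k = n [^]\<^bsub>G\<^esub> k" for k :: nat
  have pU: "pw k \<in> U" for k unfolding pw_def using nU by simp
  have p0: "pw 0 e = e" if "e \<in> C" for e using that by (simp add: pw_def)
  have pS: "pw (Suc k) e = n (pw k e)" if "e \<in> C" for k e
    unfolding pw_def G.nat_pow_Suc2[OF nU] using that nU pU[of k] by (simp add: pw_def)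
  have pS': "pw (Suc k) e = pw k (n e)" if "e \<in> C" for k e
    using that nU pU[of k] by (simp add: pw_def)
  have AC: "?A \<subseteq> C" using wing_in c by blast
  have pC: "pw k e \<in> C" if "e \<in> C" for k e using that pU U_in by blast
  have pB: "pw k ` B \<subseteq> B" for k
  proof (induction k)
    case 0 then show ?case using p0 B by auto
  next
    case (Suc k) then show ?case using pS B unfolding image_subset_iff by (metis subsetD)
  qed
  have disj: "pw j e \<noteq> pw k e'" if "j < k" "e \<in> ?A" "e' \<in> ?A" for j k e e'
    using that
  proof (induction j arbitrary: k)
    case 0
    then obtain l where k: "k = Suc l" by (cases k) auto
    have "pw l e' \<in> B" using pB 0 A by blast
    then have "pw k e' \<in> n ` B" using pS 0 AC k by auto
    then show ?case using p0 0 A AC by (metis disjoint_iff subsetD)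
  next
    case (Suc j)
    then obtain l where k: "k = Suc l" by (cases k) auto
    have "pw j e \<noteq> pw l e'" using Suc k by simp
    then show ?case using pS k Suc AC pC U_inj[OF nU] by (metis subsetD)
  qed
  have uniq: "j = k \<and> e = e'" if "e \<in> ?A" "e' \<in> ?A" "pw j e = pw k e'" for j k e e'
    using disj[of j k e e'] disj[of k j e' e] that U_inj[OF pU] AC by (metis nat_neq_iff subsetD)
  \<comment> \<open>The product over all \<open>k\<close> of the conjugates of \<open>b\<close> by the \<open>k\<close>-th power of \<open>n\<close>.\<close>
  define lift where "lift b e = (if e \<notin> C then undefined else
    if \<exists>k. \<exists>e0\<in>?A. e = pw k e0 then (let k = (SOME k. \<exists>e0\<in>?A. e = pw k e0) in pw k (b ((inv\<^bsub>G\<^esub> (pw k)) e))) else e)" for b e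
  have lift1: "lift b (pw k e) = pw k (b e)" if e: "e \<in> ?A" for b k e
  proof -
    have sm: "(SOME l. \<exists>e0\<in>?A. pw k e = pw l e0) = k"
      by (rule some_equality) (use e uniq in blast)+
    have ex: "\<exists>l. \<exists>e0\<in>?A. pw k e = pw l e0" using e by blast
    have "e \<in> C" using e AC by blast
    then show ?thesis
      unfolding lift_def Let_def sm if_P[OF ex] using pC inv_apply(1)[OF pU] by simp
  qed
  have lift2: "lift b e = e" if "e \<in> C" "\<And>k e0. e0 \<in> ?A \<Longrightarrow> e \<noteq> pw k e0" for b e
    using that unfolding lift_def by auto
  have presA: "b e \<in> ?A" if "b \<in> U" "\<And>e. e \<in> C \<Longrightarrow> e \<notin> ?A \<Longrightarrow> b e = e" "e \<in> ?A" for b e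
    using that(2)[of "b e"] U_in U_inj that AC by (metis subsetD)
  have liftC: "lift b e \<in> C" if "e \<in> C" "\<And>e. e \<in> ?A \<Longrightarrow> b e \<in> ?A" for b e
    using lift1 lift2 that AC pC by (metis subsetD)
  have comp: "lift b (lift b' e) = e" if e: "e \<in> C" and b: "\<And>e. e \<in> ?A \<Longrightarrow> b (b' e) = e" "\<And>e. e \<in> ?A \<Longrightarrow> b' e \<in> ?A" for b b' e
  proof (cases "\<exists>k. \<exists>e0\<in>?A. e = pw k e0")
    case True
    then show ?thesis using lift1 b by metis
  next
    case False
    then show ?thesis using lift2 e by metis
  qed
  define a' where "a' = inv\<^bsub>G\<^esub> a"
  have a': "a' \<in> U" "\<And>e. e \<in> C \<Longrightarrow> e \<notin> ?A \<Longrightarrow> a' e = e"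
    using a inv_apply(1)[OF a] fx unfolding a'_def by (auto, metis)
  have aa': "a' (a e) = e" "a (a' e) = e" if "e \<in> C" for e using a that by (simp_all add: a'_def)
  define g where "g = lift a"
  have inA: "a e \<in> ?A" "a' e \<in> ?A" if "e \<in> ?A" for e
    using presA[OF a fx that] presA[OF a' that] by blast+
  have "lift a' (lift a e) = e" "lift a (lift a' e) = e" "lift a e \<in> C" "lift a' e \<in> C" if "e \<in> C" for e
    using comp[OF that, of a' a] comp[OF that, of a a'] liftC[OF that, of a] liftC[OF that, of a']
      inA aa' AC by blast+
  then have bij: "bij_betw g C C"
    by (intro bij_betw_byWitness[where f' = "lift a'"]) (auto simp: g_def)
  have gU: "g \<in> U"
  proof (rule local_criterion[OF _ bij])
    show "g \<in> extensional C" by (auto simp: g_def lift_def extensional_def)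
    fix k e assume k: "k \<in> I" and e: "e \<in> C"
    show "\<exists>u\<in>U. \<forall>x\<in>X k. g (mv e k x) = u (mv e k x)"
    proof (cases "\<exists>l. \<forall>x\<in>X k. \<exists>e0\<in>?A. mv e k x = pw l e0")
      case True
      then obtain l where l: "\<forall>x\<in>X k. \<exists>e0\<in>?A. mv e k x = pw l e0" by blast
      let ?u = "pw l \<otimes>\<^bsub>G\<^esub> a \<otimes>\<^bsub>G\<^esub> inv\<^bsub>G\<^esub> (pw l)"
      have "g (mv e k x) = ?u (mv e k x)" if x: "x \<in> X k" for x
      proof -
        obtain e0 where e0: "e0 \<in> ?A" "mv e k x = pw l e0" using l x by blast
        then have "e0 \<in> C" using AC by blast
        then show ?thesis using e0 pU a lift1 by (simp add: g_def U_in)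
      qed
      moreover have "?u \<in> U" using pU a by simp
      ultimately show ?thesis by blast
    next
      case False
      have "g (mv e k x) = mv e k x" if x: "x \<in> X k" for x
      proof (cases "\<exists>l. \<exists>e0\<in>?A. mv e k x = pw l e0")
        case True
        then obtain l e0 where e0: "e0 \<in> ?A" "mv e k x = pw l e0" by blast
        obtain y where y: "y \<in> X k" "\<not> (\<exists>e0\<in>?A. mv e k y = pw l e0)" using False by blast
        have e0C: "e0 \<in> C" using e0 AC by blast
        let ?z = "loc (inv\<^bsub>G\<^esub> (pw l)) k (pw l e0) y"
        have z: "?z \<in> X k" using loc_in[OF U_aut pC[OF e0C] k y(1)] pU by simp
        have "mv e k y = mv (pw l e0) k y" using mv_mv[OF e k x y(1)] e0(2) by simp
        then have "(inv\<^bsub>G\<^esub> (pw l)) (mv e k y) = mv ((inv\<^bsub>G\<^esub> (pw l)) (pw l e0)) k ?z"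
          using U_mv[OF _ pC[OF e0C] k y(1)] pU by simp
        then have "pw l (mv e0 k ?z) = mv e k y"
          using inv_apply[OF pU] e0C mv_in e k y(1) by metis
        then have "mv e0 k ?z \<notin> ?A" using y(2) by metis
        then have "a e0 = e0" using wing_panel_fixed[OF a c fx e0(1) k z] by blast
        then show ?thesis using lift1[OF e0(1)] e0(2) by (simp add: g_def)
      next
        case False
        then show ?thesis using lift2 mv_in e k x by (simp add: g_def)
      qed
      then show ?thesis using mv_in e k by (intro bexI[of _ "\<one>\<^bsub>G\<^esub>"]) simp_all
    qed
  qed
  \<comment> \<open>That is, \<open>g\<close> is the product of \<open>a\<close> and the conjugate of \<open>g\<close> by \<open>n\<close>.\<close>
  have key: "a (n (g e)) = g (n e)" if e: "e \<in> C" for e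
  proof (cases "\<exists>k. \<exists>e0\<in>?A. e = pw k e0")
    case True
    then obtain k e0 where e0: "e0 \<in> ?A" "e = pw k e0" by blast
    have e0C: "e0 \<in> C" "a e0 \<in> ?A" "a e0 \<in> C" using e0 AC presA[OF a fx] U_in[OF a] by blast+
    have "g e = pw k (a e0)" using lift1 e0 by (simp add: g_def)
    then have 1: "n (g e) = pw (Suc k) (a e0)" using pS e0C by simp
    have "n e = pw (Suc k) e0" using pS e0C e0 by simp
    then have 2: "g (n e) = pw (Suc k) (a e0)" using lift1 e0 by (simp add: g_def)
    have "pw (Suc k) (a e0) \<notin> ?A" using disj[of 0 "Suc k" _ "a e0"] p0 AC e0C by (metis subsetD zero_less_Suc)
    then show ?thesis unfolding 1 2 using fx pC e0C by blast
  next
    case False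
    then have ge: "g e = e" using lift2 e by (simp add: g_def)
    show ?thesis
    proof (cases "n e \<in> ?A")
      case True
      then show ?thesis using ge lift1[of "n e" a 0] p0 U_in[OF nU e] U_in[OF a] by (simp add: g_def)
    next
      case ne: False
      have "n e \<noteq> pw k e0" if "e0 \<in> ?A" for k e0
      proof (cases k)
        case 0
        then show ?thesis using ne p0 AC that by auto
      next
        case (Suc l)
        have "e \<noteq> pw l e0" using False that by blast
        moreover have "e0 \<in> C" using that AC by blast
        ultimately show ?thesis using Suc pS U_inj[OF nU e pC] by metis
      qed
      then have "g (n e) = n e" using lift2 U_in[OF nU e] by (simp add: g_def)
      then show ?thesis using ge fx ne U_in[OF nU e] by simp
    qed
  qed
  have "a = (g \<otimes>\<^bsub>G\<^esub> n \<otimes>\<^bsub>G\<^esub> inv\<^bsub>G\<^esub> g) \<otimes>\<^bsub>G\<^esub> inv\<^bsub>G\<^esub> n"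
  proof (rule U_eqI)
    fix e assume e: "e \<in> C"
    define d where "d = (inv\<^bsub>G\<^esub> g) ((inv\<^bsub>G\<^esub> n) e)"
    have d: "d \<in> C" "n (g d) = e" using e inv_in gU nU by (simp_all add: d_def)
    have "((g \<otimes>\<^bsub>G\<^esub> n \<otimes>\<^bsub>G\<^esub> inv\<^bsub>G\<^esub> g) \<otimes>\<^bsub>G\<^esub> inv\<^bsub>G\<^esub> n) e = g (n d)"
      using e gU nU inv_in by (simp add: d_def)
    then show "a e = ((g \<otimes>\<^bsub>G\<^esub> n \<otimes>\<^bsub>G\<^esub> inv\<^bsub>G\<^esub> g) \<otimes>\<^bsub>G\<^esub> inv\<^bsub>G\<^esub> n) e"
      using key[OF d(1)] d(2) by simp
  qed (use a gU nU in auto)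
  moreover have "g \<otimes>\<^bsub>G\<^esub> n \<otimes>\<^bsub>G\<^esub> inv\<^bsub>G\<^esub> g \<in> N"
    using normal.inv_op_closed2[OF N gU n] .
  ultimately show ?thesis
    using n subgroup.m_closed[OF normal_imp_subgroup[OF N]] subgroup.m_inv_closed[OF normal_imp_subgroup[OF N]]
    by metis
qed

text \<open>
  A wall separates a moved chamber \<open>e\<close> from \<open>n e\<close>. Let \<open>E\<close> be its wing that contains \<open>n e\<close>. Both
  \<open>wing i e\<close> and the preimage of \<open>E\<close> under \<open>n\<close> contain \<open>e\<close>, and any wing in their intersection is
  mapped into \<open>E\<close>, which is disjoint from \<open>wing i e\<close>.
\<close>
lemma moved_wing:
  assumes n: "n \<in> U" "n \<noteq> \<one>\<^bsub>G\<^esub>"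
  obtains i c where "i \<in> I" "c \<in> C" "\<And>e. e \<in> wing i c \<Longrightarrow> n e \<notin> wing i c"
proof -
  obtain e where e: "e \<in> C" "n e \<noteq> e" using U_eqI[OF n(1) G.one_closed] n by auto
  have ne: "n e \<in> C" using U_in n e by blast
  obtain i where i: "i \<in> I" "n e \<notin> wing i e" using wings_separate[OF e(1) ne] e by metis
  obtain x where x: "x \<in> X i" "n e \<in> wing i (mv e i x)" using wing_cover[OF e(1) i(1) ne] by blast
  then have "x \<noteq> col i e" using i e mv_cl by auto
  then have disj: "wing i e \<inter> wing i (mv e i x) = {}" using wing_disjoint e i x by blast
  define d where "d = (inv\<^bsub>G\<^esub> n) (mv e i x)"
  have d: "d \<in> C" "n d = mv e i x" using inv_in n mv_in e i x by (simp_all add: d_def)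
  have "e \<in> wing i d" using U_wing[OF n(1) d(1) i(1) e(1)] d x by simp
  then obtain r where r: "r \<in> C" "wing i r \<subseteq> wing i e" "wing i r \<subseteq> wing i d"
    using wing_in_intersection[OF e(1) d(1) i(1) wing.base] by blast
  have "n f \<notin> wing i r" if "f \<in> wing i r" for f
    using U_wing_imp[OF _ n(1) d(1) i(1), of f] that r disj d by auto
  then show ?thesis using that i r by blast
qed

text \<open>
  Let \<open>n0\<close> in \<open>N\<close> move the wing \<open>D = wing l r\<close> off itself. Two disjoint wings inside \<open>D\<close> contain
  \<open>wing j a0\<close> and \<open>wing i b\<close>, where \<open>a0\<close> and \<open>b\<close> have the same colours, so a translation \<open>g\<close> maps \<open>a0\<close>
  to \<open>b\<close>. It maps \<open>wing i a0\<close>, whose complement is contained in \<open>wing j a0\<close>, onto \<open>wing i b\<close>. By a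
  ping-pong argument, the commutator \<open>n\<close> of \<open>n0\<close> and \<open>g\<close> maps the complement of \<open>wing i b\<close> into
  \<open>n0 (wing i b)\<close>, which is disjoint from \<open>D\<close>. Hence \<open>n\<close> contracts the complement of \<open>wing i b\<close> off
  every wing in the rest of \<open>D\<close>, and one of these is a translate of \<open>wing i c\<close>.
\<close>
lemma wing_group_in_normal:
  assumes N: "N \<lhd> G" "N \<noteq> {\<one>\<^bsub>G\<^esub>}" and c: "c \<in> C" "i \<in> I"
    and a: "a \<in> U" and fx: "\<And>e. e \<in> C \<Longrightarrow> e \<notin> wing i c \<Longrightarrow> a e = e"
  shows "a \<in> N"
proof -
  have Nsub: "subgroup N G" using N normal_imp_subgroup by blast
  obtain n0 where n0: "n0 \<in> N" "n0 \<noteq> \<one>\<^bsub>G\<^esub>" using N(2) subgroup.one_closed[OF Nsub] by blast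
  have n0U: "n0 \<in> U" using n0 subgroup.subset[OF Nsub] by blast
  obtain l r where l: "l \<in> I" "r \<in> C" and moved: "\<And>e. e \<in> wing l r \<Longrightarrow> n0 e \<notin> wing l r"
    using moved_wing[OF n0U n0(2)] by blast
  obtain k where k: "k \<in> I" "m k l = \<infinity>" using neighbour[OF l(1)] symmetric l by metis
  obtain x where x: "x \<in> X k" "x \<noteq> col k r" using colours3 k by metis
  obtain y where y: "y \<in> X k" "y \<noteq> col k r" "y \<noteq> x" using colours3 k by metis
  have nx: "wing k (mv r k x) \<subseteq> wing l r" using wing_nest l k x by blast
  have ny: "wing k (mv r k y) \<subseteq> wing l r" using wing_nest l k y by blast
  have disj: "wing k (mv r k x) \<inter> wing k (mv r k y) = {}"
    using wing_disjoint' l k x y by metis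
  have rx: "mv r k x \<in> C" "mv r k y \<in> C" using mv_in l k x y by blast+
  obtain j where j: "j \<in> I" "m i j = \<infinity>" using neighbour c by blast
  obtain a0 where a0: "a0 \<in> C" "wing j a0 \<subseteq> wing k (mv r k x)" "\<And>h. h \<in> I \<Longrightarrow> col h a0 = col h c"
    by (rule wing_contains_prescribed_wing[OF rx(1) k(1) j(1), of "\<lambda>h. col h c"]) (use cl_in c in auto)
  obtain b where b: "b \<in> C" "wing i b \<subseteq> wing k (mv r k y)" "\<And>h. h \<in> I \<Longrightarrow> col h b = col h c"
    by (rule wing_contains_prescribed_wing[OF rx(2) k(1) c(2), of "\<lambda>h. col h c"]) (use cl_in c in auto)
  obtain c' where c': "c' \<in> C" "wing i c' \<subseteq> wing k (mv r k x)" "\<And>h. h \<in> I \<Longrightarrow> col h c' = col h c"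
    by (rule wing_contains_prescribed_wing[OF rx(1) k(1) c(2), of "\<lambda>h. col h c"]) (use cl_in c in auto)
  obtain g where g: "g \<in> U" "g a0 = b" using exists_translation[OF a0(1) b(1)] a0 b by metis
  obtain v where v: "v \<in> U" "v c = c'" using exists_translation[OF c(1) c'(1)] c' by metis
  define n where "n = n0 \<otimes>\<^bsub>G\<^esub> (g \<otimes>\<^bsub>G\<^esub> inv\<^bsub>G\<^esub> n0 \<otimes>\<^bsub>G\<^esub> inv\<^bsub>G\<^esub> g)"
  have nN: "n \<in> N" unfolding n_def
    using subgroup.m_closed[OF Nsub n0(1)] normal.inv_op_closed2[OF N(1) g(1)] subgroup.m_inv_closed[OF Nsub n0(1)] by blast
  have n_eq: "n e = n0 (g ((inv\<^bsub>G\<^esub> n0) ((inv\<^bsub>G\<^esub> g) e)))" if "e \<in> C" for e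
    using that n0U g inv_in by (simp add: n_def U_in)
  let ?B = "C - wing i b"
  \<comment> \<open>First \<open>inv g\<close> maps \<open>e\<close> out of \<open>wing i a0\<close>, hence into the wing that \<open>n0\<close> moves off itself;
    then \<open>inv n0\<close> maps it back into \<open>wing i a0\<close>, which \<open>g\<close> maps onto \<open>wing i b\<close>.\<close>
  have into: "\<exists>f\<in>wing i b. n e = n0 f" if e: "e \<in> ?B" for e
  proof -
    define d where "d = (inv\<^bsub>G\<^esub> g) e"
    have d: "d \<in> C" "g d = e" using e g inv_in by (simp_all add: d_def)
    have "d \<notin> wing i a0" using U_wing[OF g(1) a0(1) c(2) d(1)] d g e by simp
    then have "d \<in> wing l r" using wing_complement[OF a0(1) c(2) j] d a0 nx by blast
    define d' where "d' = (inv\<^bsub>G\<^esub> n0) d"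
    have d': "d' \<in> C" "n0 d' = d" using d n0U inv_in by (simp_all add: d'_def)
    have "d' \<in> wing i a0"
    proof (rule ccontr)
      assume "d' \<notin> wing i a0"
      then have "d' \<in> wing l r" using wing_complement[OF a0(1) c(2) j] d' a0 nx by blast
      then show False using moved d' \<open>d \<in> wing l r\<close> by metis
    qed
    then have "g d' \<in> wing i b" using U_wing_imp[OF _ g(1) a0(1) c(2)] g by metis
    moreover have "n e = n0 (g d')" using n_eq e by (simp add: d'_def d_def)
    ultimately show ?thesis by blast
  qed
  have bl: "wing i b \<subseteq> wing l r" using b ny by blast
  have c'l: "wing i c' \<subseteq> wing l r" using c' nx by blast
  define a' where "a' = v \<otimes>\<^bsub>G\<^esub> a \<otimes>\<^bsub>G\<^esub> inv\<^bsub>G\<^esub> v"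
  have "a' \<in> N"
  proof (rule contracted_wing_group_in_normal[OF N(1) nN c'(1) c(2), of ?B])
    show "?B \<subseteq> C" by blast
    show "n ` ?B \<subseteq> ?B"
    proof
      fix e assume "e \<in> n ` ?B"
      then obtain f where f: "f \<in> wing i b" "e = n0 f" using into by blast
      then have "e \<notin> wing l r" using moved bl by blast
      then show "e \<in> ?B" using f bl U_in[OF n0U] wing_in b by blast
    qed
    show "wing i c' \<subseteq> ?B" using c' b disj wing_in by blast
    show "wing i c' \<inter> n ` ?B = {}"
    proof -
      have "e \<notin> wing i c'" if "e \<in> n ` ?B" for e
      proof -
        obtain f where f: "f \<in> wing i b" "e = n0 f" using into \<open>e \<in> n ` ?B\<close> by blast
        then have "e \<notin> wing l r" using moved bl by blast
        then show ?thesis using c'l by blast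
      qed
      then show ?thesis by blast
    qed
    show "a' \<in> U" using a v by (simp add: a'_def)
    fix e assume e: "e \<in> C" "e \<notin> wing i c'"
    define d where "d = (inv\<^bsub>G\<^esub> v) e"
    have d: "d \<in> C" "v d = e" using e v inv_in by (simp_all add: d_def)
    then have "d \<notin> wing i c" using U_wing[OF v(1) c d(1)] v e by simp
    then have "a d = d" using fx d by blast
    then show "a' e = e" using e v a d inv_in by (simp add: a'_def d_def)
  qed
  then have "inv\<^bsub>G\<^esub> v \<otimes>\<^bsub>G\<^esub> a' \<otimes>\<^bsub>G\<^esub> inv\<^bsub>G\<^esub> (inv\<^bsub>G\<^esub> v) \<in> N"
    using normal.inv_op_closed2[OF N(1), of "inv\<^bsub>G\<^esub> v" a'] v by simp
  moreover have "inv\<^bsub>G\<^esub> v \<otimes>\<^bsub>G\<^esub> a' \<otimes>\<^bsub>G\<^esub> inv\<^bsub>G\<^esub> (inv\<^bsub>G\<^esub> v) = a"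
    by (rule U_eqI) (use a v in \<open>auto simp: a'_def U_in\<close>)
  ultimately show ?thesis by simp
qed

section \<open>Chamber stabilisers\<close>

text \<open>
  The chambers of the wall that lie in \<open>wing i c\<close> are reached from \<open>c\<close> by steps of types other than
  \<open>i\<close> and are therefore fixed by \<open>h\<close>. So \<open>h\<close> can be replaced by the identity on \<open>wing i c\<close>. The
  result is supported on the complement of \<open>wing i c\<close>, hence on \<open>wing j c\<close> for any \<open>j\<close> joined to \<open>i\<close>,
  and it differs from \<open>h\<close> by an element supported on \<open>wing i c\<close>.
\<close>
lemma one_colour_stabiliser_in_normal:
  assumes N: "N \<lhd> G" "N \<noteq> {\<one>\<^bsub>G\<^esub>}" and c: "c \<in> C" "i \<in> I"
    and h: "h \<in> U" "h c = c" and pres: "\<And>e j. e \<in> C \<Longrightarrow> j \<in> I \<Longrightarrow> j \<noteq> i \<Longrightarrow> col j (h e) = col j e"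
  shows "h \<in> N"
proof -
  obtain j where j: "j \<in> I" "m i j = \<infinity>" using neighbour c by blast
  have colc: "col i c \<in> X i" using cl_in c by blast
  have fx: "h (mv f i (col i c)) = mv f i (col i c)" if "f \<in> wall i c" for f
    using that
  proof (induction rule: wall.induct)
    case base
    then show ?case using h mv_cl c by simp
  next
    case (step f k x)
    have f: "f \<in> C" using wall_in step c by blast
    show ?case
    proof (cases "k = i")
      case True
      then show ?thesis using step f colc c mv_mv by simp
    next
      case False
      then have k: "m k i = 2" using step symmetric c by metis
      let ?g = "mv f i (col i c)"
      have g: "?g \<in> C" using mv_in f c colc by blast
      have "mv (mv f k x) i (col i c) = mv ?g k x"
        using mv_commute[OF f step.hyps(2) c(2) k step.hyps(4) colc] .
      moreover have "h (mv ?g k x) = mv ?g k x"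
        by (rule U_fix_mv) (use h g step False pres cl_mv mv_in in auto)
      ultimately show ?thesis by simp
    qed
  qed
  define h' where "h' e = (if e \<in> C then if e \<in> wing i c then e else h e else undefined)" for e
  have hw: "h e \<in> wing i c \<longleftrightarrow> e \<in> wing i c" if "e \<in> C" for e
    using U_wing[OF h(1) c that] h by simp
  have hw': "(inv\<^bsub>G\<^esub> h) e \<in> wing i c \<longleftrightarrow> e \<in> wing i c" if "e \<in> C" for e
    using hw[OF inv_in[OF h(1) that]] inv_apply(2)[OF h(1) that] by simp
  let ?k = "\<lambda>e. if e \<in> wing i c then e else (inv\<^bsub>G\<^esub> h) e"
  have "?k (h' e) = e" "h' (?k e) = e" "h' e \<in> C" "?k e \<in> C" if "e \<in> C" for e
    using hw[OF that] hw'[OF that] inv_apply[OF h(1) that] U_in[OF h(1) that] inv_in[OF h(1) that] that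
    by (simp_all add: h'_def)
  then have bij: "bij_betw h' C C"
    by (intro bij_betw_byWitness[where f' = ?k]) blast+
  have h'U: "h' \<in> U"
  proof (rule local_criterion[OF _ bij])
    show "h' \<in> extensional C" by (auto simp: h'_def extensional_def)
    fix k e assume k: "k \<in> I" and e: "e \<in> C"
    show "\<exists>u\<in>U. \<forall>x\<in>X k. h' (mv e k x) = u (mv e k x)"
    proof (cases "k = i \<and> e \<in> wall i c")
      case True
      have "h' (mv e k x) = h (mv e k x)" if x: "x \<in> X k" for x
      proof (cases "mv e k x \<in> wing i c")
        case w: True
        have ww: "mv e k x \<in> wall i c" using True x wall.step k by blast
        have "x = col i c" using wall_wing_col[OF c ww w] True cl_mv[OF e k x] by simp
        then show ?thesis using fx True w mv_in[OF e k x] by (simp add: h'_def)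
      next
        case False
        then show ?thesis using mv_in e k x by (simp add: h'_def)
      qed
      then show ?thesis using h by blast
    next
      case False
      have iff: "mv e k x \<in> wing i c \<longleftrightarrow> e \<in> wing i c" if x: "x \<in> X k" for x
      proof
        assume a: "mv e k x \<in> wing i c"
        have "k \<noteq> i \<or> mv e k x \<notin> wall i c" using False mv_in_wall_iff[OF e k _ x] by blast
        then have "mv (mv e k x) k (col k e) \<in> wing i c" using wing.step[OF a k] cl_in e k by blast
        then show "e \<in> wing i c" using mv_back e k x by simp
      next
        assume "e \<in> wing i c"
        then show "mv e k x \<in> wing i c" using wing.step k x False by blast
      qed
      show ?thesis
      proof (cases "e \<in> wing i c")
        case True
        then show ?thesis using iff mv_in e k by (intro bexI[of _ "\<one>\<^bsub>G\<^esub>"]) (auto simp: h'_def)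
      next
        case False
        then show ?thesis using iff mv_in e k h by (intro bexI[of _ h]) (auto simp: h'_def)
      qed
    qed
  qed
  have "h' \<in> N"
  proof (rule wing_group_in_normal[OF N c(1) j(1) h'U])
    fix e assume "e \<in> C" "e \<notin> wing j c"
    then have "e \<in> wing i c" using wing_complement[OF c j] by blast
    then show "h' e = e" using \<open>e \<in> C\<close> by (simp add: h'_def)
  qed
  moreover have "h \<otimes>\<^bsub>G\<^esub> inv\<^bsub>G\<^esub> h' \<in> N"
  proof (rule wing_group_in_normal[OF N c])
    show "h \<otimes>\<^bsub>G\<^esub> inv\<^bsub>G\<^esub> h' \<in> U" using h h'U by simp
    fix e assume e: "e \<in> C" "e \<notin> wing i c"
    define d where "d = (inv\<^bsub>G\<^esub> h') e"
    have d: "d \<in> C" "h' d = e" using e h'U inv_in by (simp_all add: d_def)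
    then have "h d = e" using e by (auto simp: h'_def split: if_splits)
    then show "(h \<otimes>\<^bsub>G\<^esub> inv\<^bsub>G\<^esub> h') e = e" using e h h'U d by (simp add: d_def)
  qed
  ultimately have "(h \<otimes>\<^bsub>G\<^esub> inv\<^bsub>G\<^esub> h') \<otimes>\<^bsub>G\<^esub> h' \<in> N"
    using subgroup.m_closed[OF normal_imp_subgroup[OF N(1)]] by blast
  moreover have "(h \<otimes>\<^bsub>G\<^esub> inv\<^bsub>G\<^esub> h') \<otimes>\<^bsub>G\<^esub> h' = h"
    using h h'U by (simp add: G.m_assoc)
  ultimately show ?thesis by simp
qed

text \<open>
  The colours are peeled off one at a time: there is an element \<open>h\<close> fixing \<open>c\<close> that has the same
  effect on the \<open>i\<close>-th colour as \<open>g\<close> and preserves the other colours, and \<open>g h\<^sup>-\<^sup>1\<close> changes one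
  colour less. An element that fixes a chamber and preserves all colours is trivial.
\<close>
lemma stabiliser_in_normal:
  assumes N: "N \<lhd> G" "N \<noteq> {\<one>\<^bsub>G\<^esub>}" and c: "c \<in> C" and g: "g \<in> U" "g c = c"
  shows "g \<in> N"
proof -
  have "\<forall>g\<in>U. g c = c \<longrightarrow> (\<forall>e\<in>C. \<forall>j\<in>I - J. col j (g e) = col j e) \<longrightarrow> g \<in> N"
    if "finite J" "J \<subseteq> I" for J
    using that
  proof (induction rule: finite_induct)
    case empty
    show ?case
    proof (intro ballI impI)
      fix g assume g: "g \<in> U" "g c = c" and pres: "\<forall>e\<in>C. \<forall>j\<in>I - {}. col j (g e) = col j e"
      have "g e = e" if "e \<in> C" for e
        using c that by (induction rule: chamber_induct) (use g pres U_fix_mv cl_mv mv_in in auto)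
      then have "g = \<one>\<^bsub>G\<^esub>" by (intro U_eqI) (use g in auto)
      then show "g \<in> N" using subgroup.one_closed[OF normal_imp_subgroup[OF N(1)]] by simp
    qed
  next
    case (insert i J)
    then have i: "i \<in> I" by blast
    show ?case
    proof (intro ballI impI)
      fix g assume g: "g \<in> U" "g c = c" and pres: "\<forall>e\<in>C. \<forall>j\<in>I - insert i J. col j (g e) = col j e"
      define s where "s k e = (if k = i then loc g i e else (\<lambda>x\<in>X k. x))" for k e
      have sc: "s k e (col k e) = (if k = i then col i (g e) else col k e)" if "k \<in> I" "e \<in> C" for k e
        using cl_in[OF that(2,1)] mv_cl[OF that(2,1)] loc_apply[of "col k e" k g e] by (auto simp: s_def)
      obtain h where h: "h \<in> U" "h c = c" "\<And>e k. e \<in> C \<Longrightarrow> k \<in> I \<Longrightarrow> col k (h e) = s k e (col k e)"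
      proof (rule exists_with_local_actions[of s c c])
        show "s k e \<in> F k" if "k \<in> I" "e \<in> C" for k e using U_loc[OF g(1) that] F_id that by (auto simp: s_def)
        show "s k (mv e k x) = s k e" if "k \<in> I" "e \<in> C" "x \<in> X k" for k e x
        proof -
          have "loc g k (mv e k x) = loc g k e" unfolding loc_def
            by (rule restrict_ext) (use that mv_mv in simp)
          then show ?thesis by (auto simp: s_def)
        qed
        show "s k (mv e j y) (col k e) = s k e (col k e)"
          if k: "k \<in> I" "j \<in> I" "j \<noteq> k" "e \<in> C" "y \<in> X j" for k e j y
        proof -
          have ck: "col k (mv e j y) = col k e" using cl_mv_other k by blast
          have "col k (g (mv e j y)) = col k (g e)"
            using U_mv[OF g(1) k(4,2,5)] cl_mv_other[OF U_in[OF g(1) k(4)] k(2) loc_in[OF U_aut[OF g(1)] k(4,2,5)] k(1)] k by auto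
          then show ?thesis using sc[OF k(1,4)] sc[OF k(1) mv_in[OF k(4,2,5)]] ck by auto
        qed
        show "col k c = s k c (col k c)" if "k \<in> I" for k using sc[OF that c] g by simp
      qed (use c in auto)
      have hN: "h \<in> N"
        by (rule one_colour_stabiliser_in_normal[OF N c i h(1,2)]) (use h(3) sc in auto)
      let ?k = "g \<otimes>\<^bsub>G\<^esub> inv\<^bsub>G\<^esub> h"
      have "?k \<in> U" using g h by simp
      moreover have "?k c = c" using g h c inv_apply(1)[OF h(1) c] by simp
      moreover have "col j (?k e) = col j e" if ej: "e \<in> C" "j \<in> I - J" for e j
      proof -
        define d where "d = (inv\<^bsub>G\<^esub> h) e"
        have d: "d \<in> C" "h d = e" using ej h inv_in by (simp_all add: d_def)
        have "col j (g d) = col j (h d)" using h(3)[OF d(1), of j] sc[OF _ d(1), of j] pres d ej by auto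
        then show ?thesis using g h ej d by (simp add: d_def)
      qed
      ultimately have "?k \<in> N" using insert by blast
      then have "?k \<otimes>\<^bsub>G\<^esub> h \<in> N" using hN subgroup.m_closed[OF normal_imp_subgroup[OF N(1)]] by blast
      then show "g \<in> N" using g h by (simp add: G.m_assoc)
    qed
  qed
  from this[OF finite_index] show ?thesis using g by blast
qed

section \<open>Orbits of normal subgroups\<close>

lemma stabilizer_perm_group: "stabilizer (perm_group Y H) (\<lambda>g. g) x = {g \<in> H. g x = x}"
  by (simp add: stabilizer_def perm_group_def)

lemma perm_group_group: "i \<in> I \<Longrightarrow> group (perm_group (X i) (F i))"
  unfolding perm_group_def by (rule subgroup.subgroup_is_group[OF F_subgroup group_BijGroup])

lemma perm_group_mult:
  assumes "i \<in> I" "f \<in> F i" "g \<in> F i"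
  shows "f \<otimes>\<^bsub>perm_group (X i) (F i)\<^esub> g = compose (X i) f g"
  using F_Bij[OF assms(1,2)] F_Bij[OF assms(1,3)] by (simp add: perm_group_def BijGroup_def)

lemma perm_group_one: "\<one>\<^bsub>perm_group (X i) (F i)\<^esub> = (\<lambda>x\<in>X i. x)"
  by (simp add: perm_group_def BijGroup_def)

lemma perm_group_carrier [simp]: "carrier (perm_group Y H) = H"
  by (simp add: perm_group_def)

lemma perm_group_inv_apply:
  assumes "i \<in> I" "f \<in> F i" "x \<in> X i"
  shows "(inv\<^bsub>perm_group (X i) (F i)\<^esub> f) (f x) = x"
proof -
  interpret P: group "perm_group (X i) (F i)" using perm_group_group assms by blast
  have f': "inv\<^bsub>perm_group (X i) (F i)\<^esub> f \<in> F i" using P.inv_closed[of f] assms by simp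
  have "inv\<^bsub>perm_group (X i) (F i)\<^esub> f \<otimes>\<^bsub>perm_group (X i) (F i)\<^esub> f = \<one>\<^bsub>perm_group (X i) (F i)\<^esub>"
    using P.l_inv[of f] assms by simp
  then have "compose (X i) (inv\<^bsub>perm_group (X i) (F i)\<^esub> f) f = (\<lambda>x\<in>X i. x)"
    using perm_group_mult[OF assms(1) f' assms(2)] perm_group_one by simp
  then have "compose (X i) (inv\<^bsub>perm_group (X i) (F i)\<^esub> f) f x = x" using assms by simp
  then show ?thesis using assms by (simp add: compose_def)
qed

lemma transitive_on_iff:
  assumes "i \<in> I"
  shows "transitive_on (X i) (F i) \<longleftrightarrow> (\<forall>x\<in>X i. \<forall>y\<in>X i. \<exists>f\<in>F i. f x = y)"
proof -
  have "group_hom (perm_group (X i) (F i)) (BijGroup (X i)) (\<lambda>g. g)"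
    unfolding group_hom_def group_hom_axioms_def hom_def
    using perm_group_group[OF assms] group_BijGroup F_Bij[OF assms]
    by (auto simp: perm_group_def BijGroup_def)
  then show ?thesis
    unfolding transitive_on_def transitive_action_def transitive_action_axioms_def group_action_def
    by (simp, blast)
qed

text \<open>
  If \<open>f\<close> fixes the colour \<open>x\<close>, then the homogeneous element with local action \<open>f\<close> of type \<open>i\<close> that
  fixes the chamber of colour \<open>x\<close> in the panel of \<open>c\<close> belongs to \<open>N\<close>. The \<open>f\<close> with the claimed
  property for all \<open>c\<close> are closed under composition.
\<close>
lemma panel_orbit:
  assumes N: "N \<lhd> G" "\<And>g c. g \<in> U \<Longrightarrow> c \<in> C \<Longrightarrow> g c = c \<Longrightarrow> g \<in> N"
    and i: "i \<in> I" and gen: "generated_by_point_stabilisers (X i) (F i)"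
    and f: "f \<in> F i" and c: "c \<in> C"
  shows "\<exists>h\<in>N. h c = mv c i (f (col i c))"
proof -
  have Nsub: "subgroup N G" and NU: "N \<subseteq> U"
    using N normal_imp_subgroup subgroup.subset by blast+
  have stab: "\<exists>h\<in>N. h c = mv c i (f (col i c))" if f: "f \<in> F i" "f x = x" "x \<in> X i" and c: "c \<in> C" for f x c
  proof -
    let ?d = "mv c i x"
    have d: "?d \<in> C" "col i ?d = x" using mv_in cl_mv c i f by blast+
    obtain g where g: "g \<in> U" "g ?d = ?d"
      "\<And>e k. e \<in> C \<Longrightarrow> k \<in> I \<Longrightarrow> col k (g e) = (if k = i then f else (\<lambda>x\<in>X k. x)) (col k e)"
      by (rule exists_homogeneous[of "\<lambda>k. if k = i then f else (\<lambda>x\<in>X k. x)" ?d ?d])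
        (use f d F_id cl_in in auto)
    have cc: "mv ?d i (col i c) = c" using mv_back c i f by blast
    have xc: "col i c \<in> X i" using cl_in c i by blast
    have "loc g i ?d (col i c) = f (col i c)" using loc_apply[OF xc, of g ?d] cc g(3)[OF c i] by simp
    then have "g c = mv ?d i (f (col i c))" using U_mv[OF g(1) d(1) i xc] cc g(2) by simp
    then have "g c = mv c i (f (col i c))" using mv_mv[OF c i f(3) F_in[OF i f(1) xc]] by simp
    then show ?thesis using N(2)[OF g(1) d(1) g(2)] by blast
  qed
  have "f \<in> generate (perm_group (X i) (F i)) (\<Union>x\<in>X i. stabilizer (perm_group (X i) (F i)) (\<lambda>g. g) x)"
    using gen f unfolding generated_by_point_stabilisers_def by simp
  then have "f \<in> F i \<and> (\<forall>c\<in>C. \<exists>h\<in>N. h c = mv c i (f (col i c)))"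
  proof (induction rule: generate.induct)
    case one
    have "\<exists>h\<in>N. h c = mv c i ((\<lambda>x\<in>X i. x) (col i c))" if "c \<in> C" for c
      using that cl_in[OF that i] mv_cl[OF that i] subgroup.one_closed[OF Nsub]
      by (intro bexI[of _ "\<one>\<^bsub>G\<^esub>"]) simp_all
    then show ?case using F_id[OF i] unfolding perm_group_one by blast
  next
    case (incl h)
    then show ?case using stab unfolding stabilizer_perm_group by blast
  next
    case (inv h)
    then obtain x where x: "x \<in> X i" "h \<in> F i" "h x = x" unfolding stabilizer_perm_group by blast
    let ?h = "inv\<^bsub>perm_group (X i) (F i)\<^esub> h"
    have "?h \<in> F i" using group.inv_closed[OF perm_group_group[OF i], of h] x by simp
    moreover have "?h x = x" using perm_group_inv_apply[OF i x(2,1)] x by simp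
    ultimately show ?case using stab x by blast
  next
    case (eng f1 f2)
    have "\<exists>h\<in>N. h c = mv c i (compose (X i) f1 f2 (col i c))" if c: "c \<in> C" for c
    proof -
      have xc: "col i c \<in> X i" using cl_in c i by blast
      let ?d = "mv c i (f2 (col i c))"
      have f2: "f2 (col i c) \<in> X i" using F_in i eng xc by blast
      have d: "?d \<in> C" "col i ?d = f2 (col i c)" using mv_in[OF c i f2] cl_mv[OF c i f2] by blast+
      obtain h2 where h2: "h2 \<in> N" "h2 c = ?d" using eng c by blast
      obtain h1 where h1: "h1 \<in> N" "h1 ?d = mv ?d i (f1 (col i ?d))" using eng d by blast
      have "h1 ?d = mv c i (f1 (f2 (col i c)))"
        using h1 d mv_mv[OF c i f2] F_in[OF i _ f2] eng by simp
      then have "(h1 \<otimes>\<^bsub>G\<^esub> h2) c = mv c i (compose (X i) f1 f2 (col i c))"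
        using h1 h2 NU c xc by (simp add: subsetD compose_def)
      then show ?thesis using subgroup.m_closed[OF Nsub] h1 h2 by blast
    qed
    then show ?case using eng F_compose[OF i] perm_group_mult[OF i] by simp
  qed
  then show ?thesis using c by blast
qed

text \<open>
  As \<open>N\<close> contains the chamber stabilisers, it suffices that \<open>c\<close> and \<open>g c\<close> lie in the same \<open>N\<close>-orbit.
  Steps of a type in \<open>V\<close> do not change the orbit. The other types commute with each other, so modulo
  \<open>N\<close> a chamber is determined by its colours of these types (\<open>reach_word\<close>), and these colours may
  be changed within the orbits of the local groups (\<open>return\<close>), where those of \<open>c\<close> and \<open>g c\<close> agree.
\<close>
theorem normal_subgroup_is_everything:
  assumes N: "N \<lhd> G" "N \<noteq> {\<one>\<^bsub>G\<^esub>}"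
    and gen: "\<And>i. i \<in> I \<Longrightarrow> generated_by_point_stabilisers (X i) (F i)"
    and V: "vertex_cover I m V" "\<And>i. i \<in> V \<Longrightarrow> transitive_on (X i) (F i)"
  shows "N = U"
proof
  have Nsub: "subgroup N G" and NU: "N \<subseteq> U"
    using N normal_imp_subgroup subgroup.subset by blast+
  show "N \<subseteq> U" by (rule NU)
  have stab: "g \<in> N" if "g \<in> U" "c \<in> C" "g c = c" for g c
    using stabiliser_in_normal N that by blast
  define R where "R d e \<longleftrightarrow> (\<exists>h\<in>N. h d = e)" for d e
  have R_refl: "R d d" if "d \<in> C" for d
    unfolding R_def using that subgroup.one_closed[OF Nsub] by (intro bexI[of _ "\<one>\<^bsub>G\<^esub>"]) simp_all
  have R_sym: "R e d" if "R d e" "d \<in> C" for d e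
    using that NU subgroup.m_inv_closed[OF Nsub] unfolding R_def by (metis inv_apply(1) subsetD)
  have R_trans: "R d f" if R: "R d e" "R e f" "d \<in> C" for d e f
  proof -
    obtain h k where h: "h \<in> N" "h d = e" and k: "k \<in> N" "k e = f" using R unfolding R_def by blast
    then have "(k \<otimes>\<^bsub>G\<^esub> h) d = f" using mult_apply[of k h d] NU R(3) by blast
    then show ?thesis unfolding R_def using subgroup.m_closed[OF Nsub k(1) h(1)] by blast
  qed
  have R_panel: "R c (mv c i (f (col i c)))" if "c \<in> C" "i \<in> I" "f \<in> F i" for c i f
    unfolding R_def using panel_orbit[OF N(1) stab that(2) gen[OF that(2)] that(3,1)] .
  have R_V: "R c (mv c i y)" if c: "c \<in> C" "i \<in> V" "y \<in> X i" for c i y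
  proof -
    have i: "i \<in> I" using V(1) c by (auto simp: vertex_cover_def)
    obtain f where "f \<in> F i" "f (col i c) = y"
      using V(2)[OF c(2)] transitive_on_iff[OF i] cl_in[OF c(1) i] c(3) by blast
    then show ?thesis using R_panel c i by metis
  qed
  have R_mv: "R (mv e i y) (mv e' i y)" if e: "R e e'" "e \<in> C" "i \<in> I" "y \<in> X i" for e e' i y
  proof -
    obtain h where h: "h \<in> N" "h e = e'" using e R_def by blast
    have hU: "h \<in> U" using h NU by blast
    have e': "e' \<in> C" using h hU e U_in by blast
    let ?f = "loc h i e"
    have f: "?f \<in> F i" using U_loc hU e by blast
    have "h (mv e i y) = mv e' i (?f y)" using U_mv[OF hU e(2-4)] h by simp
    then have 1: "R (mv e i y) (mv e' i (?f y))" using h R_def by blast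
    let ?d = "mv e' i y"
    have d: "?d \<in> C" using mv_in e' e by blast
    have "mv ?d i (?f (col i ?d)) = mv e' i (?f y)"
      using mv_mv[OF e' e(3,4) F_in[OF e(3) f e(4)]] cl_mv[OF e' e(3,4)] by simp
    then have "R ?d (mv e' i (?f y))" using R_panel[OF d e(3) f] by simp
    then show ?thesis using 1 R_trans R_sym d mv_in e by blast
  qed
  show "U \<subseteq> N"
  proof
    fix g assume g: "g \<in> U"
    obtain c where c: "c \<in> C" using chambers_nonempty by blast
    obtain ws where ws: "set ws = I - V" "distinct ws"
      using finite_distinct_list[of "I - V"] finite_index by blast
    define w where "w e vs = map (\<lambda>i. (i, col i e)) vs" for e vs
    have w_in: "w e vs \<in> words" if "e \<in> C" "set vs \<subseteq> I" for e vs
      using that cl_in by (auto simp: w_def subset_iff)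
    have reach_word: "R e (walk mv c (w e ws))" if "e \<in> C" for e
      using c that
    proof (induction rule: chamber_induct)
      case base
      have "walk mv c (w c vs) = c" if "set vs \<subseteq> I" for vs
        using that by (induction vs) (auto simp: w_def mv_cl c)
      then show ?case using R_refl c ws by simp
    next
      case (step e i y)
      have iC: "mv e i y \<in> C" using mv_in step by blast
      show ?case
      proof (cases "i \<in> V")
        case True
        have "col j (mv e i y) = col j e" if "j \<in> set ws" for j
          using cl_mv_other[OF step.hyps, of j] True ws(1) that by (cases "j = i") auto
        then have "w (mv e i y) ws = w e ws" by (simp add: w_def)
        then show ?thesis using R_V[OF step.hyps(1) True step.hyps(3)] R_sym R_trans step.hyps(1) step.IH iC by metis
      next
        case False
        then have "i \<in> set ws" using ws step by blast
        then obtain us vs where uv: "ws = us @ i # vs" by (meson split_list)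
        have sub: "set us \<subseteq> I" "set vs \<subseteq> I" using uv ws by auto
        let ?s = "walk mv c (w e us)"
        have s: "?s \<in> C" using walk_in c w_in step sub by blast
        have cx: "col i e \<in> X i" using cl_in step by blast
        have com: "\<forall>l\<in>set (w e vs). m i (fst l) = 2"
        proof
          fix l assume "l \<in> set (w e vs)"
          then have l: "fst l \<in> set vs" by (auto simp: w_def)
          then have "fst l \<noteq> i" "fst l \<in> I" "fst l \<notin> V" using uv ws by auto
          then show "m i (fst l) = 2"
            using off_diagonal[OF step.hyps(2), of "fst l"] V(1) False step.hyps(2)
            by (auto simp: vertex_cover_def diagram_def)
        qed
        have "mv (walk mv c (w e ws)) i y = mv (walk mv (mv ?s i (col i e)) (w e vs)) i y"
          by (simp add: uv w_def)
        also have "\<dots> = walk mv (mv (mv ?s i (col i e)) i y) (w e vs)"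
          using walk_commute[OF mv_in[OF s step.hyps(2) cx] w_in[OF step.hyps(1) sub(2)] step.hyps(2,3) com] by simp
        also have "\<dots> = walk mv (mv ?s i y) (w e vs)" using mv_mv[OF s step.hyps(2) cx step.hyps(3)] by simp
        also have "\<dots> = walk mv c (w (mv e i y) ws)"
        proof -
          have "col j (mv e i y) = col j e" if "j \<in> set us \<union> set vs" for j
            using cl_mv_other[OF step.hyps, of j] uv ws sub that by (cases "j = i") auto
          then have "w (mv e i y) us = w e us" "w (mv e i y) vs = w e vs" by (simp_all add: w_def)
          moreover have "w (mv e i y) ws = w (mv e i y) us @ (i, col i (mv e i y)) # w (mv e i y) vs"
            by (simp add: uv w_def)
          ultimately show ?thesis using cl_mv[OF step.hyps] by simp
        qed
        finally show ?thesis using R_mv[OF step.IH step.hyps] by simp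
      qed
    qed
    have gc: "g c \<in> C" using U_in g c by blast
    have return: "R c (walk mv c (w (g c) vs))" if "distinct vs" "set vs \<subseteq> I" for vs
      using that
    proof (induction vs rule: rev_induct)
      case Nil
      then show ?case using R_refl c by (simp add: w_def)
    next
      case (snoc i vs)
      let ?d = "walk mv c (w (g c) vs)"
      have d: "?d \<in> C" using walk_in c w_in gc snoc.prems by auto
      have i: "i \<in> I" using snoc.prems by auto
      have "col i ?d = col i c"
      proof -
        have "colours_after a (w (g c) vs) i = a i" if "i \<notin> set vs" for a
          using that by (induction vs arbitrary: a) (auto simp: w_def)
        then show ?thesis using cl_walk[OF c w_in[OF gc] i] snoc.prems by auto
      qed
      moreover have "col i (g c) = loc g i c (col i c)"
        using loc_apply[of "col i c" i g c] cl_in c i mv_cl by simp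
      ultimately have "R ?d (mv ?d i (col i (g c)))"
        using R_panel[OF d i U_loc[OF g i c]] by simp
      then have "R ?d (walk mv c (w (g c) (vs @ [i])))" by (simp add: w_def)
      then show ?case using snoc R_trans[OF _ _ c] by auto
    qed
    have "R c (g c)" using reach_word[OF gc] return[OF ws(2)] ws(1) R_sym R_trans gc c by blast
    then obtain h where h: "h \<in> N" "h c = g c" unfolding R_def by blast
    have hU: "h \<in> U" using h NU by blast
    have "(inv\<^bsub>G\<^esub> h \<otimes>\<^bsub>G\<^esub> g) c = c" using hU g c h inv_apply(1)[OF hU c] by simp
    then have "inv\<^bsub>G\<^esub> h \<otimes>\<^bsub>G\<^esub> g \<in> N" using stab c hU g by simp
    then have "h \<otimes>\<^bsub>G\<^esub> (inv\<^bsub>G\<^esub> h \<otimes>\<^bsub>G\<^esub> g) \<in> N" using h subgroup.m_closed[OF Nsub] by blast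
    moreover have "h \<otimes>\<^bsub>G\<^esub> (inv\<^bsub>G\<^esub> h \<otimes>\<^bsub>G\<^esub> g) = g"
      using hU g by (simp add: G.m_assoc[symmetric])
    ultimately show "g \<in> N" by simp
  qed
qed

text \<open>
  A wing that avoids \<open>c\<close> contains a chamber with the colours of \<open>c\<close>.
\<close>
lemma nontrivial_translation:
  obtains g where "g \<in> U" "g \<noteq> \<one>\<^bsub>G\<^esub>" "\<And>e k. e \<in> C \<Longrightarrow> k \<in> I \<Longrightarrow> col k (g e) = col k e"
proof -
  obtain c where c: "c \<in> C" using chambers_nonempty by blast
  obtain l where l: "l \<in> I" using rank by fastforce
  obtain x where x: "x \<in> X l" "x \<noteq> col l c" using colours3[OF l] by metis
  obtain r where r: "r \<in> C" "wing l r \<subseteq> wing l (mv c l x)" "\<And>h. h \<in> I \<Longrightarrow> col h r = col h c"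
    by (rule wing_contains_prescribed_wing[OF mv_in[OF c l x(1)] l l, of "\<lambda>h. col h c"]) (use cl_in c in auto)
  have "r \<noteq> c" using wing_disjoint[OF c l x] r(2) wing.base by blast
  obtain g where g: "g \<in> U" "g c = r" "\<And>e k. e \<in> C \<Longrightarrow> k \<in> I \<Longrightarrow> col k (g e) = col k e"
    using exists_translation[OF c r(1) r(3)] by blast
  then show ?thesis using that \<open>r \<noteq> c\<close> c by (metis one_apply)
qed

theorem simple_if:
  assumes gen: "\<And>i. i \<in> I \<Longrightarrow> generated_by_point_stabilisers (X i) (F i)"
    and V: "vertex_cover I m V" "\<And>i. i \<in> V \<Longrightarrow> transitive_on (X i) (F i)"
  shows "abstractly_simple G"
  unfolding abstractly_simple_def
proof (intro conjI allI impI)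
  show "group G" by (rule G.group_axioms)
  show "U \<noteq> {\<one>\<^bsub>G\<^esub>}" using nontrivial_translation by blast
  show "N = U \<or> N = {\<one>\<^bsub>G\<^esub>}" if "N \<lhd> G" for N
    using normal_subgroup_is_everything[OF that _ gen V] by blast
qed

section \<open>The quotient by the point stabilisers\<close>

lemma loc_mult_eq:
  assumes "g \<in> U" "h \<in> U" "i \<in> I" "e \<in> C"
  shows "loc (g \<otimes>\<^bsub>G\<^esub> h) i e = compose (X i) (loc g i (h e)) (loc h i e)"
proof (rule extensionalityI[of _ "X i"])
  fix x assume x: "x \<in> X i"
  show "loc (g \<otimes>\<^bsub>G\<^esub> h) i e x = compose (X i) (loc g i (h e)) (loc h i e) x"
    using loc_mult[OF assms x] x by (simp add: compose_def)
qed (simp_all add: loc_def compose_def)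

text \<open>
  The subgroup \<open>R\<close> of \<open>F i\<close> generated by the point stabilisers is normal. The local actions of an
  element at the \<open>i\<close>-panels of two chambers adjacent by another type agree at a common colour, hence
  modulo \<open>R\<close>. By connectedness the class of the local action does not depend on the panel, which
  makes it a homomorphism. Translations are in its kernel, and homogeneous elements map onto the
  quotient.
\<close>
theorem generated_if_simple:
  assumes simple: "abstractly_simple G" and i: "i \<in> I"
  shows "generated_by_point_stabilisers (X i) (F i)"
proof (rule ccontr)
  let ?P = "perm_group (X i) (F i)"
  let ?H = "\<Union>x\<in>X i. stabilizer ?P (\<lambda>g. g) x"
  define R where "R = generate ?P ?H"
  assume "\<not> generated_by_point_stabilisers (X i) (F i)"
  then have ne: "R \<noteq> F i" unfolding generated_by_point_stabilisers_def R_def .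
  interpret P: group ?P using perm_group_group i by blast
  have H: "?H = {f \<in> F i. \<exists>x\<in>X i. f x = x}" unfolding stabilizer_perm_group by blast
  have RF: "R \<subseteq> F i" unfolding R_def using P.generate_incl[of ?H] H by auto
  have inv_app: "f ((inv\<^bsub>?P\<^esub> f) x) = x" if "f \<in> F i" "x \<in> X i" for f x
    using perm_group_inv_apply[OF i, of "inv\<^bsub>?P\<^esub> f" x] P.inv_closed[of f] that by simp
  have "R \<lhd> ?P" unfolding R_def
  proof (rule P.normal_generateI)
    show "?H \<subseteq> carrier ?P" using H by auto
    fix h g assume h: "h \<in> ?H" and g: "g \<in> carrier ?P"
    then obtain x where x: "x \<in> X i" "h \<in> F i" "h x = x" "g \<in> F i" using H by auto
    let ?g = "inv\<^bsub>?P\<^esub> g"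
    have g': "?g \<in> F i" using P.inv_closed[of g] x by simp
    have gh: "g \<otimes>\<^bsub>?P\<^esub> h \<in> F i" using P.m_closed[of g h] x by simp
    have gx: "g x \<in> X i" using F_in i x by blast
    have "(g \<otimes>\<^bsub>?P\<^esub> h \<otimes>\<^bsub>?P\<^esub> ?g) (g x) = g x"
      unfolding perm_group_mult[OF i gh g'] unfolding perm_group_mult[OF i x(4,2)]
      using gx x perm_group_inv_apply[OF i x(4,1)] by (simp add: compose_def)
    moreover have "g \<otimes>\<^bsub>?P\<^esub> h \<otimes>\<^bsub>?P\<^esub> ?g \<in> F i" using P.m_closed[of "g \<otimes>\<^bsub>?P\<^esub> h" ?g] gh g' by simp
    ultimately show "g \<otimes>\<^bsub>?P\<^esub> h \<otimes>\<^bsub>?P\<^esub> ?g \<in> ?H" using gx unfolding H by blast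
  qed
  then interpret R: normal R ?P .
  let ?\<pi> = "\<lambda>f. R #>\<^bsub>?P\<^esub> f"
  have \<pi>: "?\<pi> (f \<otimes>\<^bsub>?P\<^esub> f') = ?\<pi> f \<otimes>\<^bsub>?P Mod R\<^esub> ?\<pi> f'" if "f \<in> F i" "f' \<in> F i" for f f'
    using hom_mult[OF R.r_coset_hom_Mod, of f f'] that by simp
  have agree: "?\<pi> f = ?\<pi> f'" if f: "f \<in> F i" "f' \<in> F i" "x \<in> X i" "f x = f' x" for f f' x
  proof -
    let ?r = "inv\<^bsub>?P\<^esub> f \<otimes>\<^bsub>?P\<^esub> f'"
    have r: "?r \<in> F i" "inv\<^bsub>?P\<^esub> f \<in> F i" using P.inv_closed[of f] P.m_closed[of "inv\<^bsub>?P\<^esub> f" f'] f by simp_all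
    have "?r x = x" using perm_group_mult[OF i r(2) f(2)] f perm_group_inv_apply[OF i f(1,3)] by (simp add: compose_def)
    then have "?r \<in> R" unfolding R_def using generate.incl[of ?r ?H] H f r by blast
    then have "?\<pi> ?r = R" using R.rcos_const[OF P.group_axioms] by blast
    have "f' = f \<otimes>\<^bsub>?P\<^esub> ?r" using f(1,2) r(2) by (simp add: P.m_assoc[symmetric])
    then have "?\<pi> f' = ?\<pi> f \<otimes>\<^bsub>?P Mod R\<^esub> ?\<pi> ?r" using \<pi> f r by metis
    also have "\<dots> = ?\<pi> f \<otimes>\<^bsub>?P Mod R\<^esub> \<one>\<^bsub>?P Mod R\<^esub>" using \<open>?\<pi> ?r = R\<close> by (simp add: FactGroup_def)
    also have "\<dots> = ?\<pi> f"
      using monoid.r_one[OF group.is_monoid[OF R.factorgroup_is_group]] hom_in_carrier[OF R.r_coset_hom_Mod] f by simp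
    finally show ?thesis by simp
  qed
  obtain c where c: "c \<in> C" using chambers_nonempty by blast
  have const: "?\<pi> (loc g i e) = ?\<pi> (loc g i c)" if g: "g \<in> U" and e: "e \<in> C" for g e
    using c e
  proof (induction rule: chamber_induct)
    case (step e j y)
    have m: "mv e j y \<in> C" using mv_in step by blast
    have "?\<pi> (loc g i (mv e j y)) = ?\<pi> (loc g i e)"
    proof (cases "j = i")
      case True
      have "loc g i (mv e j y) = loc g i e" unfolding loc_def
        by (rule restrict_ext) (use True step mv_mv in simp)
      then show ?thesis by simp
    next
      case False
      have x: "col i e \<in> X i" "col i (mv e j y) = col i e" using cl_in cl_mv_other step i False by auto
      have "loc g i (mv e j y) (col i e) = col i (g (mv e j y))" 
        using loc_apply[OF x(1), of g "mv e j y"] mv_cl[OF m i] x(2) by simp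
      also have "\<dots> = col i (g e)"
        using U_mv[OF g step.hyps] cl_mv_other[OF U_in[OF g step.hyps(1)] step.hyps(2) loc_in[OF U_aut[OF g] step.hyps] i] False by auto
      also have "\<dots> = loc g i e (col i e)" using loc_apply[OF x(1), of g e] mv_cl[OF step.hyps(1) i] by simp
      finally show ?thesis using agree U_loc[OF g i] m step.hyps(1) x(1) by metis
    qed
    then show ?case using step by simp
  qed simp
  let ?\<Theta> = "\<lambda>g. ?\<pi> (loc g i c)"
  have "group_hom G (?P Mod R) ?\<Theta>"
  proof (intro group_hom.intro group_hom_axioms.intro homI)
    show "group G" by (rule G.group_axioms)
    show "group (?P Mod R)" by (rule R.factorgroup_is_group)
    fix g assume g: "g \<in> U"
    then show "?\<Theta> g \<in> carrier (?P Mod R)" using hom_in_carrier[OF R.r_coset_hom_Mod] U_loc i c by simp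
    fix h assume h: "h \<in> U"
    have hc: "h c \<in> C" using U_in h c by blast
    have "loc (g \<otimes>\<^bsub>G\<^esub> h) i c = loc g i (h c) \<otimes>\<^bsub>?P\<^esub> loc h i c"
      using loc_mult_eq[OF g h i c] perm_group_mult[OF i U_loc[OF g i hc] U_loc[OF h i c]] by simp
    then show "?\<Theta> (g \<otimes>\<^bsub>G\<^esub> h) = ?\<Theta> g \<otimes>\<^bsub>?P Mod R\<^esub> ?\<Theta> h"
      using \<pi> U_loc[OF g i hc] U_loc[OF h i c] const[OF g hc] by simp
  qed
  then have "kernel G (?P Mod R) ?\<Theta> \<lhd> G" by (rule group_hom.normal_kernel)
  then have K: "kernel G (?P Mod R) ?\<Theta> = U \<or> kernel G (?P Mod R) ?\<Theta> = {\<one>\<^bsub>G\<^esub>}"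
    using simple unfolding abstractly_simple_def by blast
  have one: "\<one>\<^bsub>?P Mod R\<^esub> = R" by (simp add: FactGroup_def)
  obtain t where t: "t \<in> U" "t \<noteq> \<one>\<^bsub>G\<^esub>" "\<And>e k. e \<in> C \<Longrightarrow> k \<in> I \<Longrightarrow> col k (t e) = col k e"
    using nontrivial_translation by blast
  have "loc t i c = \<one>\<^bsub>?P\<^esub>" unfolding perm_group_one loc_def
    by (rule restrict_ext) (use t(3) mv_in cl_mv c i in auto)
  then have "t \<in> kernel G (?P Mod R) ?\<Theta>"
    using t(1) one R.rcos_const[OF P.group_axioms R.one_closed] unfolding kernel_def by simp
  moreover obtain f where f: "f \<in> F i" "f \<notin> R" using ne RF by blast
  have fX: "f (col i c) \<in> X i" using F_in i f cl_in c by blast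
  obtain g where g: "g \<in> U" "g c = mv c i (f (col i c))"
    "\<And>e k. e \<in> C \<Longrightarrow> k \<in> I \<Longrightarrow> col k (g e) = (if k = i then f else (\<lambda>x\<in>X k. x)) (col k e)"
    by (rule exists_homogeneous[of "\<lambda>k. if k = i then f else (\<lambda>x\<in>X k. x)" c "mv c i (f (col i c))"])
      (use f c i fX F_id cl_in cl_mv cl_mv_other mv_in in auto)
  have "loc g i c = f"
  proof (rule extensionalityI[of _ "X i"])
    show "f \<in> extensional (X i)" using F_Bij[OF i f(1)] by (simp add: Bij_def)
  qed (use g(3) mv_in cl_mv c i in \<open>auto simp: loc_def\<close>)
  then have "g \<notin> kernel G (?P Mod R) ?\<Theta>"
    using one f P.coset_join1[of R f] R.subgroup_axioms RF unfolding kernel_def by auto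
  ultimately show False using K g(1) t(2) by blast
qed

end

section \<open>Two joined types with intransitive local groups\<close>

text \<open>
  Two involutions that generate a symmetric group of degree three. Their commutator has order three.
\<close>
definition swap01 :: "nat \<Rightarrow> nat" where "swap01 n = (if n = 0 then 1 else if n = 1 then 0 else n)"
definition swap12 :: "nat \<Rightarrow> nat" where "swap12 n = (if n = 1 then 2 else if n = 2 then 1 else n)"

lemma swap_involutions: "swap01 \<circ> swap01 = id" "swap12 \<circ> swap12 = id"
  by (auto simp: swap01_def swap12_def fun_eq_iff)

definition rot :: "nat \<Rightarrow> nat" where "rot = swap01 \<circ> swap12 \<circ> swap01 \<circ> swap12"

lemma rot_ne_id: "rot \<noteq> id"
proof
  assume "rot = id"
  then have "rot 0 = 0" by simp
  then show False by (simp add: rot_def swap01_def swap12_def)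
qed

lemma rot_apply: "rot n = (if n = 0 then 2 else if n = 1 then 0 else if n = 2 then 1 else n)"
  by (simp add: rot_def swap01_def swap12_def)

lemma rot_cubed: "rot \<circ> rot \<circ> rot = id"
  by (simp add: fun_eq_iff rot_apply)

context universal_building
begin

text \<open>
  A step from colour \<open>a\<close> to colour \<open>b\<close> of type \<open>k\<close> contributes \<open>\<kappa> k a \<circ> \<kappa> k b\<close>. Contributions telescope
  in panels as the values of \<open>\<kappa>\<close> are involutions, and contributions of commuting types commute as
  only the non-commuting types \<open>i\<close> and \<open>j\<close> contribute.
\<close>
lemma two_colour_potential:
  assumes ij: "i \<in> I" "j \<in> I" "m i j \<noteq> 2" "i \<noteq> j" and c: "c \<in> C"
    and \<kappa>: "\<kappa> = (\<lambda>k x. if k = i \<and> x \<in> P then swap01 else if k = j \<and> x \<in> Q then swap12 else id)"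
  obtains \<Phi> :: "'c \<Rightarrow> nat \<Rightarrow> nat" where "\<Phi> c = id"
    "\<And>e k x. e \<in> C \<Longrightarrow> k \<in> I \<Longrightarrow> x \<in> X k \<Longrightarrow> \<Phi> (mv e k x) = \<Phi> e \<circ> \<kappa> k (col k e) \<circ> \<kappa> k x"
proof -
  have inv: "\<kappa> k x \<circ> \<kappa> k x = id" for k x using swap_involutions by (simp add: \<kappa>)
  have inv': "p \<circ> \<kappa> k x \<circ> \<kappa> k x = p" for p :: "nat \<Rightarrow> nat" and k x
    using inv[of k x] by (simp add: comp_assoc)
  have com: "\<kappa> k x \<circ> \<kappa> l y = \<kappa> l y \<circ> \<kappa> k x" if "k \<in> I" "l \<in> I" "m k l = 2" for k l x y
  proof -
    have "\<not> (k = i \<and> l = j)" "\<not> (k = j \<and> l = i)" "k \<noteq> l"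
      using that ij symmetric m_diag_ne_2 by metis+
    then show ?thesis unfolding \<kappa> by auto
  qed
  define mv' where "mv' = (\<lambda>(e, p :: nat \<Rightarrow> nat) k x. (mv e k x, p \<circ> \<kappa> k (col k e) \<circ> \<kappa> k x))"
  have mv': "mv' (e, p) k x = (mv e k x, p \<circ> \<kappa> k (col k e) \<circ> \<kappa> k x)" for e k x and p :: "nat \<Rightarrow> nat"
    by (simp add: mv'_def)
  have act: "chamber_act I m X (C \<times> (UNIV :: (nat \<Rightarrow> nat) set)) (\<lambda>k s. col k (fst s)) mv'"
  proof (unfold_locales, goal_cases)
    case (1 s k) then show ?case using cl_in by auto
  next
    case (2 s k x) then show ?case using mv_in by (auto simp: mv'_def)
  next
    case (3 s k x) then show ?case using cl_mv by (auto simp: mv'_def)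
  next
    case (4 s k x l) then show ?case using cl_mv_other by (auto simp: mv'_def)
  next
    case (5 s k x y)
    then obtain e p where s: "s = (e, p)" "e \<in> C" by auto
    then show ?case using 5 inv' by (simp add: mv' mv_mv cl_mv)
  next
    case (6 s k)
    then show ?case using inv' by (cases s) (simp add: mv' mv_cl)
  next
    case (7 s k l x y)
    then obtain e p where s: "s = (e, p)" "e \<in> C" by auto
    have kl: "k \<noteq> l" using 7 m_diag_ne_2 by metis
    have "p \<circ> \<kappa> k (col k e) \<circ> \<kappa> k x \<circ> \<kappa> l (col l e) \<circ> \<kappa> l y = p \<circ> \<kappa> l (col l e) \<circ> \<kappa> l y \<circ> \<kappa> k (col k e) \<circ> \<kappa> k x"
    proof -
      have c': "\<kappa> k a \<circ> (\<kappa> l b \<circ> r) = \<kappa> l b \<circ> (\<kappa> k a \<circ> r)" for a b and r :: "nat \<Rightarrow> nat"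
        using com[OF 7(2,3,4), of a b] by (metis comp_assoc)
      show ?thesis unfolding comp_assoc using c' com[OF 7(2,3,4)] by metis
    qed
    then show ?case using 7 s kl mv_commute[of e k l x y] cl_mv_other[of e k x l] cl_mv_other[of e l y k]
      by (simp add: mv')
  qed
  obtain \<phi> where \<phi>: "\<phi> c = (c, id)" "\<And>e. e \<in> C \<Longrightarrow> \<phi> e \<in> C \<times> UNIV"
    "\<And>e k x. e \<in> C \<Longrightarrow> k \<in> I \<Longrightarrow> x \<in> X k \<Longrightarrow> \<phi> (mv e k x) = mv' (\<phi> e) k x"
    by (rule universal_property[OF act c, of "(c, id)"]) (use c in auto)
  have fst: "fst (\<phi> e) = e" if "e \<in> C" for e
    using c that by (induction rule: chamber_induct) (auto simp: \<phi> mv'_def split: prod.splits)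
  show ?thesis
  proof (rule that[of "\<lambda>e. snd (\<phi> e)"])
    show "snd (\<phi> c) = id" using \<phi> by simp
    fix e k x assume e: "e \<in> C" "k \<in> I" "x \<in> X k"
    have "\<phi> e = (e, snd (\<phi> e))" using fst[OF e(1)] by (simp add: prod_eq_iff)
    then have "\<phi> (mv e k x) = mv' (e, snd (\<phi> e)) k x" using \<phi>(3)[OF e] by simp
    then show "snd (\<phi> (mv e k x)) = snd (\<phi> e) \<circ> \<kappa> k (col k e) \<circ> \<kappa> k x" unfolding mv' by simp
  qed
qed

text \<open>
  Take for \<open>P\<close> and \<open>Q\<close> the orbits of a colour of type \<open>i\<close> and of type \<open>j\<close>. The contributions of steps
  are then invariant under \<open>U\<close>, so that \<open>\<Phi> (g e) = \<Phi> (g c) \<circ> \<Phi> e\<close> and \<open>g \<mapsto> \<Phi> (g c)\<close> is a homomorphism.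
  Leaving and re-entering both orbits in the order \<open>i, j, i, j\<close> leads from \<open>c\<close> to a chamber \<open>T c\<close> with
  the same colours and with \<open>\<Phi> (T c)\<close> of order three. The translation from \<open>c\<close> to \<open>T c\<close> is not in the
  kernel, whereas the one to \<open>T (T (T c))\<close> is, and it is nontrivial since the walk runs through nested
  wings.
\<close>
lemma transitive_if_simple:
  assumes simple: "abstractly_simple G" and ij: "i \<in> I" "j \<in> I" "m i j = \<infinity>"
  shows "transitive_on (X i) (F i) \<or> transitive_on (X j) (F j)"
proof (rule ccontr)
  assume "\<not> (transitive_on (X i) (F i) \<or> transitive_on (X j) (F j))"
  then obtain x0 x1 y0 y1 where x: "x0 \<in> X i" "x1 \<in> X i" "\<not> (\<exists>f\<in>F i. f x0 = x1)"
    and y: "y0 \<in> X j" "y1 \<in> X j" "\<not> (\<exists>f\<in>F j. f y0 = y1)"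
    unfolding transitive_on_iff[OF ij(1)] transitive_on_iff[OF ij(2)] by blast
  have ne: "i \<noteq> j" "m i j \<noteq> 2" "m j i = \<infinity>" using ij diagonal[of i] symmetric[of i j] by auto
  define P where "P = (\<lambda>f. f x0) ` F i"
  define Q where "Q = (\<lambda>f. f y0) ` F j"
  have orbit: "f z \<in> (\<lambda>f. f w) ` F k \<longleftrightarrow> z \<in> (\<lambda>f. f w) ` F k"
    if k: "k \<in> I" "f \<in> F k" "z \<in> X k" "w \<in> X k" for k f z w
  proof
    obtain f' where f': "f' \<in> F k" "\<And>x. x \<in> X k \<Longrightarrow> f' (f x) = x" using F_inverse k by metis
    assume "f z \<in> (\<lambda>f. f w) ` F k"
    then obtain h where h: "h \<in> F k" "f z = h w" by blast
    then have "compose (X k) f' h w = z" using f'(2)[OF k(3)] k by (simp add: compose_def)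
    then show "z \<in> (\<lambda>f. f w) ` F k" using F_compose[OF k(1) f'(1) h(1)] by blast
  next
    assume "z \<in> (\<lambda>f. f w) ` F k"
    then obtain h where h: "h \<in> F k" "z = h w" by blast
    then have "compose (X k) f h w = f z" using k by (simp add: compose_def)
    then show "f z \<in> (\<lambda>f. f w) ` F k" using F_compose[OF k(1,2) h(1)] by (metis image_eqI)
  qed
  have P: "x0 \<in> P" "x1 \<notin> P" and Q: "y0 \<in> Q" "y1 \<notin> Q"
    using x y F_id ij unfolding P_def Q_def by (force intro: rev_image_eqI)+
  define \<kappa> where "\<kappa> = (\<lambda>k x. if k = i \<and> x \<in> P then swap01 else if k = j \<and> x \<in> Q then swap12 else id)"
  have \<kappa>_inv: "\<kappa> k (f z) = \<kappa> k z" if "k \<in> I" "f \<in> F k" "z \<in> X k" for k f z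
  proof -
    have "f z \<in> P \<longleftrightarrow> z \<in> P" if "k = i"
      unfolding P_def using orbit[of i f z x0] \<open>f \<in> F k\<close> \<open>z \<in> X k\<close> that ij x by blast
    moreover have "f z \<in> Q \<longleftrightarrow> z \<in> Q" if "k = j"
      unfolding Q_def using orbit[of j f z y0] \<open>f \<in> F k\<close> \<open>z \<in> X k\<close> that ij y by blast
    ultimately show ?thesis unfolding \<kappa>_def by auto
  qed
  have \<kappa>_simps: "\<kappa> i x0 = swap01" "\<kappa> i x1 = id" "\<kappa> j y0 = swap12" "\<kappa> j y1 = id"
    using P Q ne by (auto simp: \<kappa>_def)
  obtain c' where c': "c' \<in> C" using chambers_nonempty by blast
  define c where "c = mv (mv c' i x0) j y0"
  have c: "c \<in> C" "col i c = x0" "col j c = y0"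
    using c' ij x y ne by (auto simp: c_def mv_in cl_mv cl_mv_other)
  obtain \<Phi> where \<Phi>: "\<Phi> c = id"
    "\<And>e k x. e \<in> C \<Longrightarrow> k \<in> I \<Longrightarrow> x \<in> X k \<Longrightarrow> \<Phi> (mv e k x) = \<Phi> e \<circ> \<kappa> k (col k e) \<circ> \<kappa> k x"
    using two_colour_potential[OF ij(1,2) ne(2,1) c(1) \<kappa>_def] by blast
  have hom: "\<Phi> (g e) = \<Phi> (g c) \<circ> \<Phi> e" if g: "g \<in> U" and e: "e \<in> C" for g e
    using c(1) e
  proof (induction rule: chamber_induct)
    case (step e k z)
    note e = step.hyps
    have ce: "col k e \<in> X k" using cl_in e by blast
    have f: "loc g k e \<in> F k" using U_loc g e by blast
    have lz: "loc g k e z \<in> X k" using F_in e f by blast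
    have "col k (g e) = loc g k e (col k e)" using loc_apply[OF ce, of g e] mv_cl e by simp
    then have 1: "\<kappa> k (col k (g e)) = \<kappa> k (col k e)" "\<kappa> k (loc g k e z) = \<kappa> k z"
      using \<kappa>_inv[OF e(2) f] ce e by simp_all
    have "\<Phi> (g (mv e k z)) = \<Phi> (g e) \<circ> \<kappa> k (col k e) \<circ> \<kappa> k z"
      using \<Phi>(2)[OF U_in[OF g e(1)] e(2) lz] U_mv[OF g e] 1 by simp
    then show ?case using step.IH \<Phi>(2)[OF e] by (simp add: comp_assoc)
  qed (simp add: \<Phi>)
  define N where "N = {g \<in> U. \<Phi> (g c) = id}"
  have Nsub: "subgroup N G"
  proof (rule G.subgroupI)
    show "N \<subseteq> U" by (auto simp: N_def)
    show "N \<noteq> {}" using c \<Phi> by (auto simp: N_def intro!: exI[of _ "\<one>\<^bsub>G\<^esub>"])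
    fix g assume g: "g \<in> N"
    then have gU: "g \<in> U" "\<Phi> (g c) = id" by (auto simp: N_def)
    have "\<Phi> (g ((inv\<^bsub>G\<^esub> g) c)) = \<Phi> (g c) \<circ> \<Phi> ((inv\<^bsub>G\<^esub> g) c)" using hom[OF gU(1)] inv_in[OF gU(1)] c by blast
    then show "inv\<^bsub>G\<^esub> g \<in> N" using gU c \<Phi> by (simp add: N_def)
    fix h assume "h \<in> N"
    then show "g \<otimes>\<^bsub>G\<^esub> h \<in> N" using gU c hom[OF gU(1), of "h c"] U_in by (simp add: N_def)
  qed
  have "N \<lhd> G"
    unfolding G.normal_inv_iff
  proof (intro conjI ballI Nsub)
    fix g h assume g: "g \<in> U" and h: "h \<in> N"
    then have hU: "h \<in> U" "\<Phi> (h c) = id" by (auto simp: N_def)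
    have gc: "(inv\<^bsub>G\<^esub> g) c \<in> C" using inv_in g c by blast
    have "\<Phi> (g (h ((inv\<^bsub>G\<^esub> g) c))) = \<Phi> (g c) \<circ> (\<Phi> (h c) \<circ> \<Phi> ((inv\<^bsub>G\<^esub> g) c))"
      using hom[OF g, of "h ((inv\<^bsub>G\<^esub> g) c)"] hom[OF hU(1) gc] U_in[OF hU(1) gc] by simp
    also have "\<dots> = \<Phi> (g ((inv\<^bsub>G\<^esub> g) c))" using hom[OF g gc] hU by simp
    also have "\<dots> = id" using g c \<Phi> by simp
    finally show "g \<otimes>\<^bsub>G\<^esub> h \<otimes>\<^bsub>G\<^esub> inv\<^bsub>G\<^esub> g \<in> N" using g hU c gc U_in[OF hU(1) gc] by (simp add: N_def)
  qed
  then have N: "N = U \<or> N = {\<one>\<^bsub>G\<^esub>}" using simple unfolding abstractly_simple_def by blast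
  define T where "T e = mv (mv (mv (mv e i x1) j y1) i x0) j y0" for e
  have T: "T e \<in> C" "col i (T e) = x0" "col j (T e) = y0"
      "k \<in> I \<Longrightarrow> k \<noteq> i \<Longrightarrow> k \<noteq> j \<Longrightarrow> col k (T e) = col k e"
      "wing j (T e) \<subseteq> wing i (mv e i x1)" "wing i (mv e i x1) \<subseteq> wing j e" "\<Phi> (T e) = \<Phi> e \<circ> rot"
    if e: "e \<in> C" "col i e = x0" "col j e = y0" for e k
  proof -
    have xy: "x1 \<noteq> x0" "y1 \<noteq> y0" using P Q by auto
    define e1 where "e1 = mv e i x1"
    define e2 where "e2 = mv e1 j y1"
    define e3 where "e3 = mv e2 i x0"
    have T_eq: "T e = mv e3 j y0" by (simp add: T_def e1_def e2_def e3_def)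
    have 1: "e1 \<in> C" "col i e1 = x1" "\<And>k. k \<in> I \<Longrightarrow> k \<noteq> i \<Longrightarrow> col k e1 = col k e"
      using e ij x by (auto simp: e1_def mv_in cl_mv cl_mv_other)
    have 2: "e2 \<in> C" "col j e2 = y1" "\<And>k. k \<in> I \<Longrightarrow> k \<noteq> j \<Longrightarrow> col k e2 = col k e1"
      using 1 ij y by (auto simp: e2_def mv_in cl_mv cl_mv_other)
    have 3: "e3 \<in> C" "col i e3 = x0" "\<And>k. k \<in> I \<Longrightarrow> k \<noteq> i \<Longrightarrow> col k e3 = col k e2"
      using 2 ij x by (auto simp: e3_def mv_in cl_mv cl_mv_other)
    show 4: "T e \<in> C" "col j (T e) = y0" using 3 ij y by (auto simp: T_eq mv_in cl_mv)
    have 5: "col k (T e) = col k e3" if "k \<in> I" "k \<noteq> j" for k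
      using 3 ij y that by (simp add: T_eq cl_mv_other)
    show "col i (T e) = x0" using 5 3 ij ne by simp
    show "col k (T e) = col k e" if "k \<in> I" "k \<noteq> i" "k \<noteq> j" using 1 2 3 5 that by simp
    have "wing j (T e) \<subseteq> wing i e3" unfolding T_eq
      by (rule wing_nest) (use 1 2 3 ij ne y e xy in auto)
    also have "\<dots> \<subseteq> wing j e2" unfolding e3_def
      by (rule wing_nest) (use 1 2 3 ij ne x e xy in auto)
    also have "\<dots> \<subseteq> wing i e1" unfolding e2_def
      by (rule wing_nest) (use 1 2 3 ij ne y e xy in auto)
    finally show "wing j (T e) \<subseteq> wing i (mv e i x1)" by (simp add: e1_def)
    show "wing i (mv e i x1) \<subseteq> wing j e"
      by (rule wing_nest) (use ij ne x e xy in auto)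
    have p1: "\<Phi> e1 = \<Phi> e \<circ> swap01" using \<Phi>(2)[OF e(1) ij(1) x(2)] e \<kappa>_simps by (simp add: e1_def)
    have p2: "\<Phi> e2 = \<Phi> e1 \<circ> swap12" using \<Phi>(2)[OF 1(1) ij(2) y(2)] 1(3)[OF ij(2)] ne e \<kappa>_simps by (simp add: e2_def)
    have p3: "\<Phi> e3 = \<Phi> e2 \<circ> swap01" using \<Phi>(2)[OF 2(1) ij(1) x(1)] 2(3)[OF ij(1)] 1 ne \<kappa>_simps by (simp add: e3_def)
    have p4: "\<Phi> (T e) = \<Phi> e3 \<circ> swap12" using \<Phi>(2)[OF 3(1) ij(2) y(1)] 3(3)[OF ij(2)] 2 ne \<kappa>_simps by (simp add: T_eq)
    show "\<Phi> (T e) = \<Phi> e \<circ> rot" unfolding p4 p3 p2 p1 rot_def by (simp add: comp_assoc)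
  qed
  have colT: "col k (T e) = col k e" if "e \<in> C" "col i e = x0" "col j e = y0" "k \<in> I" for e k
    using T(2,3)[OF that(1-3)] T(4)[OF that(1-3), of k] that by (cases "k = i"; cases "k = j") auto
  have trans: "\<exists>g\<in>U. g c = d" if "d \<in> C" "\<And>k. k \<in> I \<Longrightarrow> col k d = col k c" for d
    using exists_translation[OF c(1) that] by blast
  have T1: "T c \<in> C" "col i (T c) = x0" "col j (T c) = y0" using T[OF c] by auto
  have T2: "T (T c) \<in> C" "col i (T (T c)) = x0" "col j (T (T c)) = y0" using T[OF T1] by auto
  have T3: "T (T (T c)) \<in> C" "col i (T (T (T c))) = x0" "col j (T (T (T c))) = y0" using T[OF T2] by auto
  obtain g where g: "g \<in> U" "g c = T c"
    using trans[OF T1(1) colT[OF c]] by blast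
  have "\<Phi> (g c) \<noteq> id" 
    unfolding g(2) T(7)[OF c] \<Phi>(1) using rot_ne_id by simp
  then have "N \<noteq> U" using g(1) unfolding N_def by blast
  have "col k (T (T (T c))) = col k c" if "k \<in> I" for k
    using colT[OF c that] colT[OF T1 that] colT[OF T2 that] by simp
  from trans[OF T3(1) this] obtain h where h: "h \<in> U" "h c = T (T (T c))" by blast
  have "\<Phi> (h c) = id"
    unfolding h(2) T(7)[OF T2] T(7)[OF T1] T(7)[OF c] \<Phi>(1) using rot_cubed by simp
  then have "h \<in> N" using h by (simp add: N_def)
  moreover have "h \<noteq> \<one>\<^bsub>G\<^esub>"
  proof
    assume "h = \<one>\<^bsub>G\<^esub>"
    then have "T (T (T c)) = c" using h c by simp
    moreover have "wing j (T (T (T c))) \<subseteq> wing i (mv c i x1)"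
      using T(5,6)[OF c] T(5,6)[OF T1] T(5,6)[OF T2] by blast
    moreover have "c \<notin> wing i (mv c i x1)"
      using wing_disjoint[OF c(1) ij(1) x(2)] wing.base[of c i] c P by auto
    ultimately show False using wing.base[of c j] by auto
  qed
  ultimately show False using N \<open>N \<noteq> U\<close> by blast
qed

end

section \<open>The simplicity criterion\<close>

lemma universal_buildingI:
  assumes building: "right_angled_building I m C adj \<delta>" and "irreducible_type I m" "2 \<le> card I"
    and thick: "thick I C adj" and legal: "legal_colouring I C adj X col"
    and "\<And>i. i \<in> I \<Longrightarrow> subgroup (F i) (BijGroup (X i))"
  shows "universal_building I m C adj \<delta> X col F"
proof -
  interpret right_angled_building I m C adj \<delta> by (rule building)
  interpret coloured_building I m C adj \<delta> X col by unfold_locales (rule legal)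
  show ?thesis
  proof (intro universal_building.intro universal_building_axioms.intro
      thick_irreducible_building.intro thick_irreducible_building_axioms.intro)
    show "coloured_building I m C adj \<delta> X col" ..
    fix i a b assume i: "i \<in> I"
    show "\<exists>x\<in>X i. x \<noteq> a \<and> x \<noteq> b"
    proof (rule ccontr)
      assume "\<not> ?thesis"
      then have X: "X i \<subseteq> {a, b}" by blast
      obtain c where c: "c \<in> C" using chambers_nonempty by blast
      let ?P = "adj i `` {c}"
      have "infinite ?P \<or> 3 \<le> card ?P" using thick i panel_in_panels[OF i c] unfolding thick_def by blast
      moreover have "finite ?P \<longleftrightarrow> finite (X i)" "card ?P = card (X i)"
        using bij_betw_finite[OF col_bij[OF i c]] bij_betw_same_card[OF col_bij[OF i c]] by auto
      moreover have "finite (X i)" "card (X i) \<le> card {a, b}" using X finite_subset card_mono[of "{a, b}"] by auto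
      moreover have "card {a, b} \<le> 2" by (simp add: card_insert_if)
      ultimately show False by simp
    qed
  qed (use assms in auto)
qed

theorem theorem5p7:
  fixes I :: "'i set" and m :: "'i \<Rightarrow> 'i \<Rightarrow> enat"
    and C :: "'c set" and adj :: "'i \<Rightarrow> ('c \<times> 'c) set" and \<delta> :: "'c \<Rightarrow> 'c \<Rightarrow> 'i list set"
    and q :: "'i \<Rightarrow> 'q rel"
    and X :: "'i \<Rightarrow> 'x set" and col :: "'i \<Rightarrow> 'c \<Rightarrow> 'x"
    and F :: "'i \<Rightarrow> ('x \<Rightarrow> 'x) set"
  assumes "right_angled_building I m C adj \<delta>"
    and "irreducible_type I m"
    and "2 \<le> card I"
    and "thick I C adj"
    and "semiregular I C adj q"
    and "\<And>i. i \<in> I \<Longrightarrow> |X i| =o q i"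
    and "legal_colouring I C adj X col"
    and "\<And>i. i \<in> I \<Longrightarrow> subgroup (F i) (BijGroup (X i))"
  shows "abstractly_simple (universal_group I C adj X col F) \<longleftrightarrow>
    (\<forall>i\<in>I. generated_by_point_stabilisers (X i) (F i)) \<and>
    (\<exists>V. vertex_cover I m V \<and> (\<forall>i\<in>V. transitive_on (X i) (F i)))"
proof -
  interpret universal_building I m C adj \<delta> X col F
    by (rule universal_buildingI) (use assms in auto)
  show ?thesis
  proof
    assume simple: "abstractly_simple (universal_group I C adj X col F)"
    have "vertex_cover I m {i \<in> I. transitive_on (X i) (F i)}"
      using transitive_if_simple[OF simple] unfolding vertex_cover_def diagram_def by blast
    then show "(\<forall>i\<in>I. generated_by_point_stabilisers (X i) (F i)) \<and>
      (\<exists>V. vertex_cover I m V \<and> (\<forall>i\<in>V. transitive_on (X i) (F i)))"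
      using generated_if_simple[OF simple] by blast
  next
    assume "(\<forall>i\<in>I. generated_by_point_stabilisers (X i) (F i)) \<and>
      (\<exists>V. vertex_cover I m V \<and> (\<forall>i\<in>V. transitive_on (X i) (F i)))"
    then show "abstractly_simple (universal_group I C adj X col F)"
      using simple_if by blast
  qed
qed

end
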